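(* Let $f:T\times X\to\overline{\mathbb R}$ be a convex normal integrand and let $I_f(x)=\int_T f(t,x)\,d\mu(t)$ for $x\in X$. Then for every $x\in X$ and every $\varepsilon\ge 0$ one has $$ \partial_\varepsilon I_f(x)=\bigcap_{L\in\mathcal F(x)}\ \bigcup_{\substack{\varepsilon=\varepsilon_1+\varepsilon_2\\ \varepsilon_1,\varepsilon_2\ge 0\\ \ell\in\mathcal I(\varepsilon_1)}}\left\{\int_T\partial_{\ell(t)}\big(f_t+\delta_{\operatorname{aff}\{L\cap\operatorname{dom}I_f\}}\big)(x)\,d\mu(t)+N^{\varepsilon_2}_{L\cap\operatorname{dom}I_f}(x)\right\} $$ and $$ \partial_\varepsilon I_f(x)=\bigcap_{L\in\mathcal F(x)}\ \bigcup_{\ell\in\mathcal I(\varepsilon)}\int_T\partial_{\ell(t)}\big(f_t+\delta_{L\cap\operatorname{dom}I_f}\big)(x)\,d\mu(t). $$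
   Context: $X$ is a Hausdorff locally convex space and $X^*$ its topological dual, paired by $\langle\cdot,\cdot\rangle$, with $X^*$ carrying a locally convex topology compatible with the pairing (e.g. the weak$^*$ or the Mackey topology). $(T,\Sigma,\mu)$ is a nonnegative complete $\sigma$-finite measure space. Conventions: $0\cdot\infty=0=0\cdot(-\infty)$ and $\infty+(-\infty)=(-\infty)+\infty=\infty$; $\int_T h\,d\mu$ for measurable $h:T\to\overline{\mathbb R}$ is the infimum of $\int_T g\,d\mu$ over $g\in L^1(T,\mathbb R)$ with $h\le g$ a.e. ($+\infty$ if there is no such $g$). $f_t:=f(t,\cdot)$. $f$ is a convex normal integrand if $f$ is $\Sigma\otimes\mathcal B(X)$-measurable and, for a.e. $t$, $f_t\in\Gamma_0(X)$ (proper, lower semicontinuous, convex). $\operatorname{dom}g=\{g<+\infty\}$; $\delta_A$ is the indicator function of $A$ ($0$ on $A$, $+\infty$ off $A$); $\operatorname{aff}$ is the affine hull. For $\eta\ge0$, $\partial_\eta g(x)=\{x^*\in X^*:\langle x^*,y-x\rangle\le g(y)-g(x)+\eta\ \forall y\in X\}$ if $g(x)\in\mathbb R$, and $\partial_\eta g(x)=\emptyset$ otherwise; $N_A^\eta(x):=\partial_\eta\delta_A(x)$. $\mathcal F(x)$ is the set of all finite-dimensional linear subspaces $L$ of $X$ with $x\in L$. $\mathcal I(\eta)=\{\ell\in L^1(T,\mathbb R_+):\int_T\ell\,d\mu\le\eta\}$. A function $m:T\to X^*$ is (strongly) integrable if it is the a.e. pointwise limit of a sequence of simple functions (functions taking finitely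 many values on a finite measurable partition) and the upper integral $\int_T^*\sup_{x\in B}\langle m(t),x\rangle\,d\mu(t)$ (infimum of integrals of integrable a.e. majorants) is finite for every bounded balanced $B\subseteq X$. Its integral $\int_T m\,d\mu$ is the linear functional $x\mapsto\int_T\langle m(t),x\rangle d\mu(t)$. For a multifunction $G:T\rightrightarrows X^*$, $\int_T G(t)\,d\mu(t):=\{\int_T m\,d\mu\in X^*: m\text{ integrable},\ m(t)\in G(t)\text{ a.e.}\}$.
   Formalization: The formulas are proved at points x with I_f(x) ≠ −∞; where I_f(x) = −∞ the claim can fail (T = ℕ with counting measure, f_t ≡ −1: the left side is empty while both right sides contain 0). *)

theory Defs
  imports "HOL-Analysis.Analysis"
begin

section \<open>Locally convex spaces and duality\<close>

text \<open>Convexity of \<open>V\<close> is spelled out since \<^const>\<open>convex\<close> cannot be used in a class specification.\<close>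

class locally_convex_space = real_vector + topological_ab_group_add + t2_space +
  assumes tendsto_scaleR_nhds:
    "LIM p (nhds (c::real) \<times>\<^sub>F nhds x). fst p *\<^sub>R snd p :> nhds (c *\<^sub>R x)"
  and convex_nhds_0:
    "open U \<Longrightarrow> 0 \<in> U \<Longrightarrow>
      \<exists>V. open V \<and> 0 \<in> V \<and> V \<subseteq> U \<and>
        (\<forall>x\<in>V. \<forall>y\<in>V. \<forall>u\<ge>0. \<forall>v\<ge>0. u + v = 1 \<longrightarrow> u *\<^sub>R x + v *\<^sub>R y \<in> V)"

definition tdual :: "('x::locally_convex_space \<Rightarrow> real) set" where
  "tdual = {\<phi>. linear \<phi> \<and> continuous_on UNIV \<phi>}"

text \<open>Locally convex vector topologies on the dual whose continuous linear functionals are exactly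
  the evaluations at the points of the space. Such a topology is automatically Hausdorff. It is
  unrelated to the product topology that the type class puts on function types.\<close>

definition compatible_topology :: "('x::locally_convex_space \<Rightarrow> real) topology \<Rightarrow> bool" where
  "compatible_topology \<tau> \<longleftrightarrow>
     topspace \<tau> = tdual \<and>
     continuous_map (prod_topology \<tau> \<tau>) \<tau> (\<lambda>(\<phi>, \<psi>). (\<lambda>x. \<phi> x + \<psi> x)) \<and>
     continuous_map (prod_topology euclideanreal \<tau>) \<tau> (\<lambda>(c, \<phi>). (\<lambda>x. c * \<phi> x)) \<and>
     (\<forall>U. openin \<tau> U \<and> (\<lambda>x. 0) \<in> U \<longrightarrow>
        (\<exists>V. openin \<tau> V \<and> (\<lambda>x. 0) \<in> V \<and> V \<subseteq> U \<and>
          (\<forall>\<phi>\<in>V. \<forall>\<psi>\<in>V. \<forall>u\<ge>0. \<forall>v\<ge>0. u + v = 1 \<longrightarrow> (\<lambda>x. u * \<phi> x + v * \<psi> x) \<in> V))) \<and>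
     (\<forall>\<Lambda> :: ('x \<Rightarrow> real) \<Rightarrow> real.
        continuous_map \<tau> euclideanreal \<Lambda> \<and>
        (\<forall>\<phi>\<in>tdual. \<forall>\<psi>\<in>tdual. \<Lambda> (\<lambda>x. \<phi> x + \<psi> x) = \<Lambda> \<phi> + \<Lambda> \<psi>) \<and>
        (\<forall>c. \<forall>\<phi>\<in>tdual. \<Lambda> (\<lambda>x. c * \<phi> x) = c * \<Lambda> \<phi>)
        \<longleftrightarrow> (\<exists>x. \<forall>\<phi>\<in>tdual. \<Lambda> \<phi> = \<phi> x))"

definition vn_bounded :: "'x::locally_convex_space set \<Rightarrow> bool" where
  "vn_bounded B \<longleftrightarrow>
     (\<forall>U. open U \<and> 0 \<in> U \<longrightarrow> (\<exists>s>0. \<forall>r>s. B \<subseteq> (\<lambda>x. r *\<^sub>R x) ` U))"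

text \<open>Balanced sets are nonempty by convention; otherwise the supremum over \<open>{}\<close> in the definition
  of integrability below would be \<open>- \<infinity>\<close> and no function would be integrable.\<close>

definition balanced :: "'x::real_vector set \<Rightarrow> bool" where
  "balanced B \<longleftrightarrow> B \<noteq> {} \<and> (\<forall>c. \<bar>c\<bar> \<le> 1 \<longrightarrow> (\<lambda>x. c *\<^sub>R x) ` B \<subseteq> B)"

definition fin_dim_subspaces :: "'x::real_vector \<Rightarrow> 'x set set" where
  "fin_dim_subspaces x = {L. subspace L \<and> (\<exists>B. finite B \<and> span B = L) \<and> x \<in> L}"

definition msum :: "('x \<Rightarrow> real) set \<Rightarrow> ('x \<Rightarrow> real) set \<Rightarrow> ('x \<Rightarrow> real) set" where
  "msum A B = {(\<lambda>x. \<phi> x + \<psi> x) | \<phi> \<psi>. \<phi> \<in> A \<and> \<psi> \<in> B}"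

section \<open>Extended-real-valued convex functions\<close>

text \<open>The library's arithmetic on \<^typ>\<open>ereal\<close> satisfies \<open>\<infinity> + (- \<infinity>) = (- \<infinity>) + \<infinity> = \<infinity>\<close> and
  \<open>0 * \<infinity> = 0 * (- \<infinity>) = 0\<close>, so \<open>+\<close> follows the convention for extended-real-valued functions used
  here.\<close>

definition Gamma0 :: "('x::locally_convex_space \<Rightarrow> ereal) set" where
  "Gamma0 = {g. (\<exists>x. g x < \<infinity>) \<and> (\<forall>x. g x \<noteq> -\<infinity>) \<and>
                (\<forall>a. open {x. a < g x}) \<and>
                (\<forall>x y u v. 0 \<le> u \<and> 0 \<le> v \<and> u + v = 1 \<longrightarrow>
                   g (u *\<^sub>R x + v *\<^sub>R y) \<le> ereal u * g x + ereal v * g y)}"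

definition edom :: "('x \<Rightarrow> ereal) \<Rightarrow> 'x set" where
  "edom g = {x. g x < \<infinity>}"

definition delta :: "'x set \<Rightarrow> 'x \<Rightarrow> ereal" where
  "delta A x = (if x \<in> A then 0 else \<infinity>)"

definition eps_subdiff ::
  "real \<Rightarrow> ('x::locally_convex_space \<Rightarrow> ereal) \<Rightarrow> 'x \<Rightarrow> ('x \<Rightarrow> real) set" where
  "eps_subdiff \<eta> g x =
     (if \<bar>g x\<bar> \<noteq> \<infinity>
      then {\<phi> \<in> tdual. \<forall>y. ereal (\<phi> (y - x)) \<le> g y - g x + ereal \<eta>}
      else {})"

definition eps_normal :: "real \<Rightarrow> 'x::locally_convex_space set \<Rightarrow> 'x \<Rightarrow> ('x \<Rightarrow> real) set" where
  "eps_normal \<eta> A x = eps_subdiff \<eta> (delta A) x"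

section \<open>Integrals\<close>

definition upper_integral :: "'t measure \<Rightarrow> ('t \<Rightarrow> ereal) \<Rightarrow> ereal" where
  "upper_integral M h =
     (INF g\<in>{g. integrable M g \<and> (AE t in M. h t \<le> ereal (g t))}. ereal (\<integral>t. g t \<partial>M))"

definition convex_normal_integrand ::
  "'t measure \<Rightarrow> ('t \<Rightarrow> 'x::locally_convex_space \<Rightarrow> ereal) \<Rightarrow> bool" where
  "convex_normal_integrand M f \<longleftrightarrow>
     (\<lambda>(t, x). f t x) \<in> borel_measurable (M \<Otimes>\<^sub>M borel) \<and> (AE t in M. f t \<in> Gamma0)"

definition integral_functional :: "'t measure \<Rightarrow> ('t \<Rightarrow> 'x \<Rightarrow> ereal) \<Rightarrow> 'x \<Rightarrow> ereal" where
  "integral_functional M f x = upper_integral M (\<lambda>t. f t x)"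

definition L1_budget :: "'t measure \<Rightarrow> real \<Rightarrow> ('t \<Rightarrow> real) set" where
  "L1_budget M \<eta> =
     {l. integrable M l \<and> (\<forall>t\<in>space M. 0 \<le> l t) \<and> (\<integral>t. l t \<partial>M) \<le> \<eta>}"

definition strongly_integrable ::
  "'t measure \<Rightarrow> ('x::locally_convex_space \<Rightarrow> real) topology \<Rightarrow> ('t \<Rightarrow> 'x \<Rightarrow> real) \<Rightarrow> bool" where
  "strongly_integrable M \<tau> m \<longleftrightarrow>
     (\<forall>t\<in>space M. m t \<in> tdual) \<and>
     (\<exists>s. (\<forall>n::nat. simple_function M (s n) \<and> (\<forall>t\<in>space M. s n t \<in> tdual)) \<and>
          (AE t in M. limitin \<tau> (\<lambda>n. s n t) (m t) sequentially)) \<and>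
     (\<forall>B. vn_bounded B \<and> balanced B \<longrightarrow>
        \<bar>upper_integral M (\<lambda>t. SUP x\<in>B. ereal (m t x))\<bar> \<noteq> \<infinity>)"

definition weak_integral :: "'t measure \<Rightarrow> ('t \<Rightarrow> 'x \<Rightarrow> real) \<Rightarrow> 'x \<Rightarrow> real" where
  "weak_integral M m = (\<lambda>x. \<integral>t. m t x \<partial>M)"

definition set_valued_integral ::
  "'t measure \<Rightarrow> ('x::locally_convex_space \<Rightarrow> real) topology \<Rightarrow> ('t \<Rightarrow> ('x \<Rightarrow> real) set)
    \<Rightarrow> ('x \<Rightarrow> real) set" where
  "set_valued_integral M \<tau> G =
     {weak_integral M m | m.
        strongly_integrable M \<tau> m \<and> (AE t in M. m t \<in> G t) \<and> weak_integral M m \<in> tdual}"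

end

theory Submission
  imports Defs
begin

text \<open>
The inclusion from right to left is an integration. If \<open>m\<close> is a selection of the \<open>l\<close>-subdifferentials,
then \<open>f\<^sub>t(y) \<ge> f\<^sub>t(x) + m\<^sub>t(y - x) - l(t)\<close> on the set to which \<open>f\<^sub>t\<close> is restricted; integrating this
with the subspace \<open>L\<close> spanned by \<open>x\<close> and \<open>y\<close> gives the subgradient inequality of the integral functional
\<open>I\<close> at \<open>y\<close> (\<open>integral_subgradient_le\<close>).

For the other inclusion fix \<open>L\<close> and an \<open>\<epsilon>\<close>-subgradient \<open>\<phi>\<close>, and let \<open>A\<close> be the part of \<open>L\<close> on which \<open>I\<close> is
finite. Choose finitely many points of \<open>A\<close>, \<open>x\<close> among them, that form an affine basis \<open>P\<close> of \<open>aff A\<close>.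
Affine functions on \<open>aff A\<close> are given by their values on \<open>P\<close>, and \<open>\<Phi>(z) = \<phi>(z - x) + I(x) - \<epsilon>\<close> is one
that lies below \<open>I\<close>. Everything follows once integrable functions \<open>u\<^sub>p\<close> (\<open>p \<in> P\<close>) are found such that the
affine function \<open>h\<^sub>t\<close> with values \<open>u\<^sub>p(t)\<close> on \<open>P\<close> satisfies \<open>h\<^sub>t \<le> f\<^sub>t\<close> on \<open>aff A\<close> for almost every \<open>t\<close>, and
\<open>\<integral>h \<ge> \<Phi>\<close> on \<open>A\<close>. Indeed, let \<open>m\<^sub>t\<close> be the linear part of \<open>h\<^sub>t\<close>, extended to the whole space by continuous
functionals dual to the basis directions (these exist by the Hahn-Banach theorem), let
\<open>l(t) = f\<^sub>t(x) - h\<^sub>t(x)\<close> and \<open>\<psi> = \<phi> - \<integral>m\<close>. The first inequality says that \<open>m\<^sub>t\<close> is an \<open>l(t)\<close>-subgradient, the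
second one that \<open>\<psi>\<close> is an \<open>(\<epsilon> - \<integral>l)\<close>-normal (\<open>eps_subgradient_decomposition\<close>). For the second formula
the normal vector is spread over \<open>T\<close>: replace \<open>m\<close> by \<open>m + \<rho>\<psi>\<close> and \<open>l\<close> by \<open>l + \<epsilon>\<^sub>2\<rho>\<close>, where \<open>\<rho> \<ge> 0\<close> has integral
one (\<open>absorb_normal_vector\<close>).

The functions \<open>u\<^sub>p\<close> are found without a measurable selection theorem, in two steps.

First require \<open>h\<^sub>t \<le> f\<^sub>t\<close> at finitely many points only. Then the vectors \<open>(\<integral>u\<^sub>p)\<close> come arbitrarily close to
\<open>\<Phi>\<close> (\<open>admissible_approximation\<close>). Otherwise a separating hyperplane yields a point \<open>y \<in> aff A\<close> and a
constant \<open>c < \<Phi>(y)\<close> with \<open>\<integral>h(y) \<le> c\<close> for all admissible choices. But by Fenchel-Moreau \<open>f\<^sub>t(y)\<close> is the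
supremum of the values at \<open>y\<close> of affine functions below \<open>f\<^sub>t\<close>; as only finitely many inequalities count, rational
affine functions suffice. These are countably many, so switching between them on sets of finite measure
and monotone convergence give \<open>I(y) \<le> c\<close>, contradicting \<open>\<Phi> \<le> I\<close>.

Then let the finite set of points grow to the rational points of \<open>aff A\<close>
(\<open>convergent_approximants\<close>, \<open>limit_of_approximants\<close>). Among the approximate solutions of stage \<open>n\<close> take a
near-minimiser of the strictly convex functional \<open>\<Sum>\<^sub>p \<integral> exp (- (f(p) - u\<^sub>p)) \<rho>\<close>. The identity
\<open>exp (- a) + exp (- b) - 2 exp (- (a + b) / 2) = (exp (- a / 2) - exp (- b / 2))\<^sup>2\<close> makes the functions \<open>exp (- (f(p) - u\<^sub>p) / 2)\<close> a Cauchy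
sequence in the weighted \<open>L\<^sup>2\<close> space, so a subsequence converges almost everywhere, and Fatou's lemma passes
both required inequalities to the limit at rational points. The remaining points are reached because an
affine function that is below a convex function at the rational points of \<open>aff A\<close> is below it
everywhere, even on the boundary of its domain (\<open>affine_le_econvex_of_rational\<close>).
\<close>

section \<open>Continuous functionals on a locally convex space\<close>

text \<open>Only one inequality of positive homogeneity is demanded; rescaling by \<open>1/c\<close> gives the other.\<close>


definition sublinear :: "('a::real_vector \<Rightarrow> real) \<Rightarrow> bool" where
  "sublinear p \<longleftrightarrow> (\<forall>x y. p (x + y) \<le> p x + p y) \<and> (\<forall>c>0. \<forall>x. p (c *\<^sub>R x) \<le> c * p x)"

lemma sublinear_add: "sublinear p \<Longrightarrow> p (x + y) \<le> p x + p y"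
  by (auto simp: sublinear_def)

lemma sublinear_scale_le: "sublinear p \<Longrightarrow> c > 0 \<Longrightarrow> p (c *\<^sub>R x) \<le> c * p x"
  by (auto simp: sublinear_def)

lemma sublinear_scale:
  assumes p: "sublinear p" and c: "c > 0"
  shows "p (c *\<^sub>R x) = c * p x"
proof (rule antisym)
  have "p ((1/c) *\<^sub>R (c *\<^sub>R x)) \<le> (1/c) * p (c *\<^sub>R x)"
    by (rule sublinear_scale_le[OF p]) (use c in simp)
  then show "c * p x \<le> p (c *\<^sub>R x)"
    using c by (simp add: field_simps)
qed (rule sublinear_scale_le[OF p c])

lemma sublinear_0: assumes p: "sublinear p" shows "p 0 = 0"
  using sublinear_scale[OF p, of 2 0] by simp

lemma sublinear_neg: assumes p: "sublinear p" shows "- p (- x) \<le> p x"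
  using sublinear_add[OF p, of x "- x"] sublinear_0[OF p] by simp

lemma odd_sublinear_linear:
  assumes p: "sublinear p" and odd: "\<And>x. p (- x) = - p x"
  shows "linear p"
proof (rule linearI)
  fix x y
  have "p (- x + - y) \<le> p (- x) + p (- y)" by (rule sublinear_add[OF p])
  then have "p x + p y \<le> p (x + y)"
    using odd[of "x + y"] by (simp add: odd)
  then show "p (x + y) = p x + p y" using sublinear_add[OF p, of x y] by simp
next
  fix c :: real and x
  consider "c > 0" | "c = 0" | "c < 0" by linarith
  then show "p (c *\<^sub>R x) = c *\<^sub>R p x"
  proof cases
    case 3
    then have "p ((- c) *\<^sub>R x) = (- c) * p x" by (intro sublinear_scale[OF p]) simp
    then show ?thesis using odd[of "c *\<^sub>R x"] by simp
  qed (simp_all add: sublinear_scale[OF p] sublinear_0[OF p])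
qed

text \<open>Lowering \<open>p\<close> along the ray through \<open>a\<close> keeps it sublinear. The resulting \<open>q\<close> forces every linear \<open>f \<le> q\<close> to
satisfy \<open>f a = p a\<close>, and if \<open>p\<close> is minimal then \<open>q = p\<close> shows that \<open>p\<close> is odd at \<open>a\<close>.\<close>

lemma sublinear_lower_at:
  assumes p: "sublinear p"
  obtains q where "sublinear q" "\<And>x. q x \<le> p x" "q (- a) \<le> - p a"
proof -
  define q where "q x = (INF t\<in>{0..}. p (x + t *\<^sub>R a) - t * p a)" for x
  have lower: "- p (- x) \<le> p (x + t *\<^sub>R a) - t * p a" if "t \<ge> 0" for t x
  proof -
    have "p (t *\<^sub>R a) \<le> p (x + t *\<^sub>R a) + p (- x)"
      using sublinear_add[OF p, of "x + t *\<^sub>R a" "- x"] by simp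
    moreover have "p (t *\<^sub>R a) = t * p a"
      using that sublinear_scale[OF p, of t a] sublinear_0[OF p] by (cases "t = 0") auto
    ultimately show ?thesis by simp
  qed
  then have bdd: "bdd_below ((\<lambda>t. p (x + t *\<^sub>R a) - t * p a) ` {0..})" for x
    by (intro bdd_belowI2[where m = "- p (- x)"]) auto
  have q_le: "q x \<le> p (x + t *\<^sub>R a) - t * p a" if "t \<ge> 0" for t x
    unfolding q_def by (rule cINF_lower[OF bdd]) (use that in auto)
  have q_ge: "c \<le> q x" if "\<And>t. t \<ge> 0 \<Longrightarrow> c \<le> p (x + t *\<^sub>R a) - t * p a" for c x
    unfolding q_def by (rule cINF_greatest) (use that in auto)
  have "sublinear q"
    unfolding sublinear_def
  proof (intro conjI allI impI)
    fix x y
    have "q (x + y) - (p (x + t *\<^sub>R a) - t * p a) \<le> p (y + s *\<^sub>R a) - s * p a" if "t \<ge> 0" "s \<ge> 0" for t s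
    proof -
      have "q (x + y) \<le> p ((x + y) + (t + s) *\<^sub>R a) - (t + s) * p a"
        using that by (intro q_le) simp
      also have "(x + y) + (t + s) *\<^sub>R a = (x + t *\<^sub>R a) + (y + s *\<^sub>R a)"
        by (simp add: algebra_simps)
      also have "p \<dots> \<le> p (x + t *\<^sub>R a) + p (y + s *\<^sub>R a)" by (rule sublinear_add[OF p])
      finally show ?thesis by (simp add: algebra_simps)
    qed
    then have "q (x + y) - (p (x + t *\<^sub>R a) - t * p a) \<le> q y" if "t \<ge> 0" for t
      by (intro q_ge) (use that in auto)
    then have "q (x + y) - q y \<le> p (x + t *\<^sub>R a) - t * p a" if "t \<ge> 0" for t
      using that by (simp add: algebra_simps)
    then have "q (x + y) - q y \<le> q x" by (rule q_ge)
    then show "q (x + y) \<le> q x + q y" by simp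
  next
    fix c :: real and x assume c: "c > 0"
    have "(1/c) * q (c *\<^sub>R x) \<le> p (x + t *\<^sub>R a) - t * p a" if "t \<ge> 0" for t
    proof -
      have "q (c *\<^sub>R x) \<le> p (c *\<^sub>R x + (c * t) *\<^sub>R a) - (c * t) * p a"
        using that c by (intro q_le) simp
      also have "c *\<^sub>R x + (c * t) *\<^sub>R a = c *\<^sub>R (x + t *\<^sub>R a)" by (simp add: algebra_simps)
      also have "p \<dots> = c * p (x + t *\<^sub>R a)" by (rule sublinear_scale[OF p c])
      finally show ?thesis using c by (simp add: field_simps)
    qed
    then have "(1/c) * q (c *\<^sub>R x) \<le> q x" by (rule q_ge)
    then show "q (c *\<^sub>R x) \<le> c * q x" using c by (simp add: field_simps)
  qed
  moreover have "q x \<le> p x" for x using q_le[of 0 x] by simp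
  moreover have "q (- a) \<le> - p a" using q_le[of 1 "- a"] sublinear_0[OF p] by simp
  ultimately show thesis by (rule that)
qed

text \<open>A minimal sublinear functional below \<open>p\<close> is odd by the preceding lemma, hence linear. Zorn's lemma
provides one: along a chain the pointwise infimum is subadditive since the smaller of two members of
the chain bounds both of their values.\<close>

lemma linear_below_sublinear:
  fixes p :: "'a::real_vector \<Rightarrow> real"
  assumes p: "sublinear p"
  obtains f where "linear f" "\<And>x. f x \<le> p x"
proof -
  define A where "A = {q :: 'a \<Rightarrow> real. sublinear q \<and> (\<forall>x. q x \<le> p x)}"
  define P where "P = (\<lambda>a b :: 'a \<Rightarrow> real. b \<le> a)"
  have "\<exists>m\<in>A. \<forall>a\<in>A. P m a \<longrightarrow> a = m"
  proof (rule predicate_Zorn)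
    show "partial_order_on A (relation_of P A)"
      by (rule partial_order_on_relation_ofI) (auto simp: P_def)
  next
    fix C assume C: "C \<in> Chains (relation_of P A)"
    have CA: "C \<subseteq> A" using C by (rule Chains_relation_of)
    have tot: "a \<le> b \<or> b \<le> a" if "a \<in> C" "b \<in> C" for a b
      using C that unfolding Chains_def relation_of_def P_def by blast
    show "\<exists>u\<in>A. \<forall>a\<in>C. P a u"
    proof (cases "C = {}")
      case True
      then show ?thesis using p by (auto simp: A_def)
    next
      case False
      define u where "u x = (INF q\<in>C. q x)" for x
      have bdd: "bdd_below ((\<lambda>q. q x) ` C)" for x
      proof (rule bdd_belowI2[where m = "- p (- x)"])
        fix q assume "q \<in> C"
        then have "sublinear q" "q (- x) \<le> p (- x)" using CA by (auto simp: A_def)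
        then show "- p (- x) \<le> q x" using sublinear_neg[of q x] by simp
      qed
      have u_le: "u x \<le> q x" if "q \<in> C" for q x
        unfolding u_def by (rule cINF_lower[OF bdd that])
      have u_ge: "c \<le> u x" if "\<And>q. q \<in> C \<Longrightarrow> c \<le> q x" for c x
        unfolding u_def by (rule cINF_greatest[OF False]) (use that in auto)
      have "sublinear u"
        unfolding sublinear_def
      proof (intro conjI allI impI)
        fix x y
        have "u (x + y) - q1 x \<le> q2 y" if q12: "q1 \<in> C" "q2 \<in> C" for q1 q2
        proof -
          obtain q where q: "q \<in> C" "q \<le> q1" "q \<le> q2"
            using tot[OF q12] q12 by blast
          have "u (x + y) \<le> q (x + y)" by (rule u_le[OF q(1)])
          also have "\<dots> \<le> q x + q y" using q(1) CA by (intro sublinear_add) (auto simp: A_def)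
          also have "\<dots> \<le> q1 x + q2 y" using q(2,3) by (auto simp: le_fun_def intro: add_mono)
          finally show ?thesis by simp
        qed
        then have "u (x + y) - q1 x \<le> u y" if "q1 \<in> C" for q1
          by (intro u_ge) (use that in auto)
        then have "u (x + y) - u y \<le> u x" by (intro u_ge) (simp add: algebra_simps)
        then show "u (x + y) \<le> u x + u y" by simp
      next
        fix c :: real and x assume c: "c > 0"
        have "(1/c) * u (c *\<^sub>R x) \<le> u x"
        proof (rule u_ge)
          fix q assume q: "q \<in> C"
          then have "u (c *\<^sub>R x) \<le> c * q x"
            using u_le[OF q, of "c *\<^sub>R x"] sublinear_scale[of q c x] c CA by (auto simp: A_def)
          then show "(1/c) * u (c *\<^sub>R x) \<le> q x" using c by (simp add: field_simps)
        qed
        then show "u (c *\<^sub>R x) \<le> c * u x" using c by (simp add: field_simps)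
      qed
      moreover have "u x \<le> p x" for x
        using False CA u_le by (force simp: A_def intro: order_trans)
      ultimately show ?thesis using u_le by (auto simp: A_def P_def le_fun_def)
    qed
  qed
  then obtain m where m: "m \<in> A" and min: "\<And>a. a \<in> A \<Longrightarrow> a \<le> m \<Longrightarrow> a = m"
    unfolding P_def by blast
  have sm: "sublinear m" and mp: "\<And>x. m x \<le> p x" using m by (auto simp: A_def)
  have "m (- a) = - m a" for a
  proof -
    obtain q where q: "sublinear q" "\<And>x. q x \<le> m x" "q (- a) \<le> - m a"
      using sublinear_lower_at[OF sm] by blast
    have "q \<in> A" using q mp by (auto simp: A_def intro: order_trans)
    then have "q = m" using q(2) by (intro min) (auto simp: le_fun_def)
    then show ?thesis using q(3) sublinear_neg[OF sm, of a] by simp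
  qed
  then show thesis using that odd_sublinear_linear[OF sm] mp by blast
qed

lemma hahn_banach_attained:
  assumes p: "sublinear p"
  obtains f where "linear f" "\<And>x. f x \<le> p x" "f a = p a"
proof -
  obtain q where q: "sublinear q" "\<And>x. q x \<le> p x" "q (- a) \<le> - p a"
    using sublinear_lower_at[OF p] by blast
  obtain f where f: "linear f" "\<And>x. f x \<le> q x" using linear_below_sublinear[OF q(1)] by blast
  have "f (- a) = - f a" by (rule linear_neg[OF f(1)])
  then have "f a = p a" using f(2)[of "- a"] q(3) f(2)[of a] q(2)[of a] by simp
  then show thesis using that f q(2) by (blast intro: order_trans)
qed

lemma tendsto_scaleR_lcs:
  fixes g :: "'b \<Rightarrow> 'x::locally_convex_space"
  assumes "(c \<longlongrightarrow> a) F" "(g \<longlongrightarrow> b) F"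
  shows "((\<lambda>i. c i *\<^sub>R g i) \<longlongrightarrow> a *\<^sub>R b) F"
  using filterlim_compose[OF tendsto_scaleR_nhds filterlim_Pair[OF assms]] by simp

text \<open>If \<open>\<phi> \<le> 1\<close> on \<open>U\<close> then \<open>\<bar>\<phi>\<bar> \<le> e\<close> on the intersection of \<open>e U\<close> and \<open>- e U\<close>, and translation carries this
estimate to every point.\<close>

lemma tdual_bounded_on_nhds:
  fixes \<phi> :: "'x::locally_convex_space \<Rightarrow> real"
  assumes lin: "linear \<phi>" and U: "open U" "0 \<in> U" and bd: "\<And>v. v \<in> U \<Longrightarrow> \<phi> v \<le> 1"
  shows "\<phi> \<in> tdual"
proof -
  have "(\<phi> \<longlongrightarrow> \<phi> a) (nhds a)" for a
  proof (rule tendstoI)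
    fix e :: real assume e: "e > 0"
    define V where "V = {v. (2/e) *\<^sub>R (v - a) \<in> U} \<inter> {v. (- (2/e)) *\<^sub>R (v - a) \<in> U}"
    have cont: "continuous_on UNIV (\<lambda>v. c *\<^sub>R (v - a))" for c :: real
      unfolding continuous_on_def
      by (auto intro!: tendsto_scaleR_lcs tendsto_diff tendsto_const tendsto_ident_at)
    have "open V" unfolding V_def
      using open_vimage[OF U(1) cont[of "2/e"]] open_vimage[OF U(1) cont[of "-(2/e)"]]
      by (auto simp: vimage_def)
    moreover have "a \<in> V" using U by (simp add: V_def)
    moreover have "dist (\<phi> v) (\<phi> a) < e" if "v \<in> V" for v
    proof -
      have "\<phi> ((2/e) *\<^sub>R (v - a)) \<le> 1" "\<phi> ((- (2/e)) *\<^sub>R (v - a)) \<le> 1"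
        using that by (auto simp: V_def intro: bd)
      then have "(2/e) * (\<phi> v - \<phi> a) \<le> 1" "- (2/e) * (\<phi> v - \<phi> a) \<le> 1"
        by (simp_all only: linear_scale[OF lin] linear_diff[OF lin] real_scaleR_def)
      then have "\<phi> v - \<phi> a \<le> e/2" "- (\<phi> v - \<phi> a) \<le> e/2" using e by (simp_all add: field_simps)
      then have "\<bar>\<phi> v - \<phi> a\<bar> \<le> e/2" by (rule abs_leI)
      then show ?thesis using e by (simp add: dist_real_def)
    qed
    ultimately show "\<forall>\<^sub>F v in nhds a. dist (\<phi> v) (\<phi> a) < e"
      unfolding eventually_nhds by blast
  qed
  then have "continuous_on UNIV \<phi>"
    by (auto simp: continuous_on_def intro: tendsto_mono[OF at_le] filterlim_mono at_within_le_nhds)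
  then show ?thesis using lin by (simp add: tdual_def)
qed

text \<open>The gauge of a convex neighbourhood of the origin that misses \<open>v\<close> is sublinear and at least one at \<open>v\<close>. A
linear functional below it with the same value at \<open>v\<close> is continuous, being at most one on the neighbourhood.\<close>

lemma tdual_separates:
  fixes v :: "'x::locally_convex_space"
  assumes v: "v \<noteq> 0"
  obtains \<phi> where "\<phi> \<in> tdual" "\<phi> v \<noteq> 0"
proof -
  obtain W where W: "open W" "0 \<in> W" "v \<notin> W" using t1_space[of 0 v] v by metis
  obtain U where U: "open U" "0 \<in> U" "U \<subseteq> W"
    and conv: "\<And>x y u w. x \<in> U \<Longrightarrow> y \<in> U \<Longrightarrow> u \<ge> 0 \<Longrightarrow> w \<ge> 0 \<Longrightarrow> u + w = 1 \<Longrightarrow> u *\<^sub>R x + w *\<^sub>R y \<in> U"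
    using convex_nhds_0[OF W(1,2)] by metis
  have "v \<notin> U" using W(3) U(3) by blast
  define G where "G x = {s::real. s > 0 \<and> (1/s) *\<^sub>R x \<in> U}" for x
  define p where "p x = Inf (G x)" for x
  have bdd: "bdd_below (G x)" for x by (rule bdd_belowI[of _ 0]) (auto simp: G_def)
  have ne: "G x \<noteq> {}" for x
  proof -
    have "(\<lambda>n. (1 / real (Suc n)) *\<^sub>R x) \<longlonglongrightarrow> 0 *\<^sub>R x"
      by (intro tendsto_scaleR_lcs tendsto_const) (rule LIMSEQ_Suc[OF lim_1_over_n])
    then have "\<forall>\<^sub>F n in sequentially. (1 / real (Suc n)) *\<^sub>R x \<in> U"
      by (rule topological_tendstoD) (use U in auto)
    then obtain n where "(1 / real (Suc n)) *\<^sub>R x \<in> U" by (meson eventually_sequentially order_refl)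
    then have "real (Suc n) \<in> G x" by (simp add: G_def)
    then show ?thesis by blast
  qed
  have p_le: "p x \<le> s" if "s \<in> G x" for s x unfolding p_def by (rule cInf_lower[OF that bdd])
  have p_ge: "c \<le> p x" if "\<And>s. s \<in> G x \<Longrightarrow> c \<le> s" for c x
    unfolding p_def by (rule cInf_greatest[OF ne that])
  have "sublinear p"
    unfolding sublinear_def
  proof (intro conjI allI impI)
    fix x y
    have "p (x + y) - s \<le> r" if "s \<in> G x" "r \<in> G y" for s r
    proof -
      have s: "s > 0" "(1/s) *\<^sub>R x \<in> U" and r: "r > 0" "(1/r) *\<^sub>R y \<in> U"
        using that by (auto simp: G_def)
      have "(s/(s+r)) *\<^sub>R ((1/s) *\<^sub>R x) + (r/(s+r)) *\<^sub>R ((1/r) *\<^sub>R y) \<in> U"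
        using s r by (intro conv) (auto simp: add_divide_distrib[symmetric])
      then have "s + r \<in> G (x + y)" using s r by (simp add: G_def scaleR_add_right)
      then show ?thesis using p_le by fastforce
    qed
    then have "p (x + y) - s \<le> p y" if "s \<in> G x" for s by (intro p_ge) (use that in auto)
    then have "p (x + y) - p y \<le> p x" by (intro p_ge) (simp add: algebra_simps)
    then show "p (x + y) \<le> p x + p y" by simp
  next
    fix c :: real and x assume c: "c > 0"
    have "(1/c) * p (c *\<^sub>R x) \<le> p x"
    proof (rule p_ge)
      fix s assume "s \<in> G x"
      then have "c * s \<in> G (c *\<^sub>R x)" using c by (simp add: G_def)
      then have "p (c *\<^sub>R x) \<le> c * s" by (rule p_le)
      then show "(1/c) * p (c *\<^sub>R x) \<le> s" using c by (simp add: field_simps)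
    qed
    then show "p (c *\<^sub>R x) \<le> c * p x" using c by (simp add: field_simps)
  qed
  then obtain \<phi> where \<phi>: "linear \<phi>" "\<And>x. \<phi> x \<le> p x" "\<phi> v = p v"
    using hahn_banach_attained by blast
  have "1 \<le> p v"
  proof (rule p_ge, rule ccontr)
    fix s assume "s \<in> G v" and s1: "\<not> 1 \<le> s"
    then have s: "s > 0" "(1/s) *\<^sub>R v \<in> U" by (auto simp: G_def)
    have "s *\<^sub>R ((1/s) *\<^sub>R v) + (1 - s) *\<^sub>R 0 \<in> U" using s s1 U by (intro conv) auto
    then show False using s \<open>v \<notin> U\<close> by simp
  qed
  moreover have "\<phi> \<in> tdual"
  proof (rule tdual_bounded_on_nhds[OF \<phi>(1) U(1,2)])
    fix u assume "u \<in> U"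
    then have "1 \<in> G u" by (simp add: G_def)
    then show "\<phi> u \<le> 1" using \<phi>(2)[of u] p_le[of 1 u] by simp
  qed
  ultimately show thesis using that \<phi>(3) by force
qed

lemma tdual_0: "(\<lambda>v. 0) \<in> tdual"
  by (simp add: tdual_def linear_zero)

lemma tdual_add: "\<phi> \<in> tdual \<Longrightarrow> \<psi> \<in> tdual \<Longrightarrow> (\<lambda>v. \<phi> v + \<psi> v) \<in> tdual"
  by (auto simp: tdual_def intro: linear_compose_add continuous_on_add)

lemma tdual_cmult: "\<phi> \<in> tdual \<Longrightarrow> (\<lambda>v. c * \<phi> v) \<in> tdual"
  using linear_compose_scale_right[of \<phi> c] by (auto simp: tdual_def intro: continuous_on_mult_left)

lemma tdual_sum: "finite J \<Longrightarrow> (\<And>i. i \<in> J \<Longrightarrow> \<phi> i \<in> tdual) \<Longrightarrow> (\<lambda>v. \<Sum>i\<in>J. c i * \<phi> i v) \<in> tdual"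
  by (induction J rule: finite_induct) (auto intro!: tdual_0 tdual_add tdual_cmult)

text \<open>Induction as in the Gram-Schmidt process: a functional that does not vanish at the remainder of the new
vector modulo the old ones is made to vanish on the old vectors, and the old functionals are then
corrected to vanish at the new vector.\<close>

lemma dual_system:
  fixes B :: "'x::locally_convex_space set"
  assumes "finite B" "independent B"
  shows "\<exists>\<phi>. (\<forall>b\<in>B. \<phi> b \<in> tdual) \<and> (\<forall>b\<in>B. \<forall>b'\<in>B. \<phi> b b' = (if b = b' then 1 else 0))"
  using assms
proof (induction B rule: finite_induct)
  case empty
  then show ?case by simp
next
  case (insert a B)
  have indB: "independent B" and aB: "a \<notin> span B"
    using insert.prems insert.hyps by (auto simp: independent_insert)
  obtain \<phi> where \<phi>: "\<And>b. b \<in> B \<Longrightarrow> \<phi> b \<in> tdual"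
    and d: "\<And>b b'. b \<in> B \<Longrightarrow> b' \<in> B \<Longrightarrow> \<phi> b b' = (if b = b' then 1 else 0)"
    using insert.IH[OF indB] by blast
  define r where "r = a - (\<Sum>b\<in>B. \<phi> b a *\<^sub>R b)"
  have "(\<Sum>b\<in>B. \<phi> b a *\<^sub>R b) \<in> span B" by (intro span_sum span_scale span_base)
  then have "r \<noteq> 0" using aB by (auto simp: r_def)
  then obtain \<psi> where \<psi>: "\<psi> \<in> tdual" "\<psi> r \<noteq> 0" by (rule tdual_separates)
  define \<theta> where "\<theta> v = (1 / \<psi> r) * (\<psi> v + (\<Sum>b\<in>B. (- \<psi> b) * \<phi> b v))" for v
  have \<theta>: "\<theta> \<in> tdual" unfolding \<theta>_def
    by (intro tdual_cmult tdual_add tdual_sum \<psi> insert.hyps \<phi>)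
  have lin\<psi>: "linear \<psi>" using \<psi> by (simp add: tdual_def)
  have \<theta>B: "\<theta> b = 0" if "b \<in> B" for b
  proof -
    have "(\<Sum>c\<in>B. (- \<psi> c) * \<phi> c b) = (\<Sum>c\<in>B. if c = b then - \<psi> c else 0)"
      by (rule sum.cong) (auto simp: d that)
    then show ?thesis using that insert.hyps by (simp add: \<theta>_def)
  qed
  have "\<psi> r = \<psi> a + (\<Sum>b\<in>B. (- \<psi> b) * \<phi> b a)"
    by (simp add: r_def linear_diff[OF lin\<psi>] linear_sum[OF lin\<psi>] linear_scale[OF lin\<psi>]
        sum_negf mult.commute)
  then have \<theta>a: "\<theta> a = 1" using \<psi> by (simp add: \<theta>_def)
  define \<phi>' where "\<phi>' b = (if b = a then \<theta> else (\<lambda>v. \<phi> b v + (- \<phi> b a) * \<theta> v))" for b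
  have "\<phi>' b \<in> tdual" if "b \<in> insert a B" for b
    using that \<theta> tdual_add[OF \<phi> tdual_cmult[OF \<theta>, of "- \<phi> b a"]] unfolding \<phi>'_def by auto
  moreover have "\<phi>' b b' = (if b = b' then 1 else 0)" if "b \<in> insert a B" "b' \<in> insert a B" for b b'
    using that insert.hyps d \<theta>a \<theta>B by (auto simp: \<phi>'_def)
  ultimately show ?case by blast
qed


section \<open>Affine minorants of convex functions\<close>

text \<open>The vector \<open>w\<close> is the point of least Euclidean norm in the closure of \<open>S\<close>, obtained as the limit of a minimising
sequence that is Cauchy by the parallelogram law. Vectors are functions on a finite index set because
the dimension depends on a subspace chosen in the middle of a proof.\<close>

lemma min_norm_separation:
  fixes S :: "('i \<Rightarrow> real) set"
  assumes J: "finite J" and ne: "S \<noteq> {}"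
    and conv: "\<And>s t u. s \<in> S \<Longrightarrow> t \<in> S \<Longrightarrow> 0 \<le> u \<Longrightarrow> u \<le> 1 \<Longrightarrow> (\<lambda>i. (1 - u) * s i + u * t i) \<in> S"
    and far: "\<And>s. s \<in> S \<Longrightarrow> d \<le> (\<Sum>i\<in>J. (s i)\<^sup>2)"
  obtains w where "\<And>s. s \<in> S \<Longrightarrow> d \<le> (\<Sum>i\<in>J. w i * s i)"
proof -
  define N where "N s = (\<Sum>i\<in>J. (s i)\<^sup>2)" for s :: "'i \<Rightarrow> real"
  define m where "m = Inf (N ` S)"
  have bdd: "bdd_below (N ` S)" by (rule bdd_belowI2[of _ d]) (use far in \<open>simp add: N_def\<close>)
  have m_le: "m \<le> N s" if "s \<in> S" for s unfolding m_def by (rule cINF_lower[OF bdd that])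
  have dm: "d \<le> m" unfolding m_def by (rule cINF_greatest[OF ne]) (use far in \<open>simp add: N_def\<close>)
  have "\<exists>s\<in>S. N s < m + 1 / real (Suc n)" for n
    using cInf_lessD[of "N ` S" "m + 1 / real (Suc n)"] ne by (auto simp: m_def)
  then obtain s where sS: "\<And>n. s n \<in> S" and sN: "\<And>n. N (s n) < m + 1 / real (Suc n)" by metis
  have close: "\<bar>s n i - s k i\<bar>\<^sup>2 \<le> 2 / real (Suc n) + 2 / real (Suc k)" if i: "i \<in> J" for i n k
  proof -
    have "(\<lambda>i. (1 - 1/2) * s n i + 1/2 * s k i) \<in> S" by (rule conv) (use sS in auto)
    then have "m \<le> N (\<lambda>i. (1 - 1/2) * s n i + 1/2 * s k i)" by (rule m_le)
    also have "4 * N (\<lambda>i. (1 - 1/2) * s n i + 1/2 * s k i) = 2 * N (s n) + 2 * N (s k) - N (\<lambda>i. s n i - s k i)"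
      unfolding N_def sum_distrib_left sum.distrib[symmetric] sum_subtractf[symmetric]
      by (intro sum.cong) (auto simp: power2_eq_square algebra_simps)
    finally have "N (\<lambda>i. s n i - s k i) \<le> 2 / real (Suc n) + 2 / real (Suc k)"
      using sN[of n] sN[of k] by simp
    moreover have "(s n i - s k i)\<^sup>2 \<le> N (\<lambda>i. s n i - s k i)"
      unfolding N_def by (rule member_le_sum) (use i J in auto)
    ultimately show ?thesis by simp
  qed
  have cauchy: "Cauchy (\<lambda>n. s n i)" if i: "i \<in> J" for i
  proof (rule metric_CauchyI)
    fix e :: real assume e: "e > 0"
    obtain M where M: "4 / e\<^sup>2 < real M" using reals_Archimedean2 by blast
    have "dist (s n i) (s k i) < e" if "n \<ge> M" "k \<ge> M" for n k
    proof -
      have "0 < 4 / e\<^sup>2" using e by simp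
      then have M0: "real M > 0" using M by linarith
      have "2 / real (Suc n) < 2 / real M" "2 / real (Suc k) < 2 / real M"
        using that M0 by (simp_all add: frac_less2)
      then have "\<bar>s n i - s k i\<bar>\<^sup>2 < 4 / real M" using close[OF i, of n k] by simp
      also have "4 / real M < e\<^sup>2" using M M0 e by (simp add: field_simps)
      finally have "\<bar>s n i - s k i\<bar> < e" by (rule power2_less_imp_less) (use e in simp)
      then show ?thesis by (simp add: dist_real_def)
    qed
    then show "\<exists>M. \<forall>m\<ge>M. \<forall>n\<ge>M. dist (s m i) (s n i) < e" by blast
  qed
  define w where "w i = lim (\<lambda>n. s n i)" for i
  have w: "(\<lambda>n. s n i) \<longlonglongrightarrow> w i" if "i \<in> J" for i
    unfolding w_def by (rule iffD1[OF convergent_LIMSEQ_iff Cauchy_convergent[OF cauchy[OF that]]])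
  have "(\<lambda>n. N (s n)) \<longlonglongrightarrow> N w" unfolding N_def by (intro tendsto_sum tendsto_power w)
  moreover have "(\<lambda>n. N (s n)) \<longlonglongrightarrow> m"
  proof (rule tendsto_sandwich)
    show "\<forall>\<^sub>F n in sequentially. m \<le> N (s n)" using m_le[OF sS] by simp
    show "\<forall>\<^sub>F n in sequentially. N (s n) \<le> m + 1 / real (Suc n)" using less_imp_le[OF sN] by simp
    show "(\<lambda>n. m + 1 / real (Suc n)) \<longlonglongrightarrow> m"
      using tendsto_add[OF tendsto_const LIMSEQ_Suc[OF lim_1_over_n], of m] by simp
  qed simp
  ultimately have Nw: "N w = m" by (rule LIMSEQ_unique)
  have "d \<le> (\<Sum>i\<in>J. w i * t i)" if t: "t \<in> S" for t
  proof -
    define c where "c = (\<Sum>i\<in>J. w i * t i)"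
    \<comment> \<open>First-order condition at \<open>w\<close>, divided by the step length \<open>u\<close>.\<close>
    have ineq: "0 \<le> (u - 2) * m + 2 * (1 - u) * c + u * N t" if u: "0 < u" "u \<le> 1" for u
    proof -
      have lim: "(\<lambda>n. N (\<lambda>i. (1 - u) * s n i + u * t i)) \<longlonglongrightarrow> N (\<lambda>i. (1 - u) * w i + u * t i)"
        unfolding N_def by (intro tendsto_sum tendsto_power tendsto_add tendsto_mult tendsto_const w)
      have "m \<le> N (\<lambda>i. (1 - u) * s n i + u * t i)" for n
        by (intro m_le conv) (use sS t u in auto)
      then have "m \<le> N (\<lambda>i. (1 - u) * w i + u * t i)" by (intro LIMSEQ_le_const[OF lim]) blast
      also have "\<dots> = (1 - u)\<^sup>2 * N w + 2 * u * (1 - u) * c + u\<^sup>2 * N t"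
        unfolding N_def c_def sum_distrib_left sum.distrib[symmetric]
        by (intro sum.cong) (auto simp: power2_eq_square algebra_simps)
      finally have "0 \<le> u * ((u - 2) * m + 2 * (1 - u) * c + u * N t)"
        by (simp add: Nw power2_eq_square algebra_simps)
      then show ?thesis using u by (simp add: zero_le_mult_iff)
    qed
    have lim0: "(\<lambda>n. 1 / real (Suc n)) \<longlonglongrightarrow> 0" by (rule LIMSEQ_Suc[OF lim_1_over_n])
    have "(\<lambda>n. (1 / real (Suc n) - 2) * m + 2 * (1 - 1 / real (Suc n)) * c + 1 / real (Suc n) * N t)
        \<longlonglongrightarrow> (0 - 2) * m + 2 * (1 - 0) * c + 0 * N t"
      by (intro tendsto_intros lim0)
    then have "0 \<le> (0 - 2) * m + 2 * (1 - 0) * c + 0 * N t"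
    proof (rule LIMSEQ_le_const, intro exI allI impI)
      fix n :: nat
      show "0 \<le> (1 / real (Suc n) - 2) * m + 2 * (1 - 1 / real (Suc n)) * c + 1 / real (Suc n) * N t"
        by (rule ineq) simp_all
    qed
    then show ?thesis using dm by (simp add: c_def)
  qed
  then show thesis by (rule that)
qed

lemma tendsto_combination_lcs:
  fixes P :: "'x::locally_convex_space set"
  assumes "\<And>p. p \<in> P \<Longrightarrow> (\<lambda>n. b n p) \<longlonglongrightarrow> y p"
  shows "(\<lambda>n. \<Sum>p\<in>P. b n p *\<^sub>R p) \<longlonglongrightarrow> (\<Sum>p\<in>P. y p *\<^sub>R p)"
  by (intro tendsto_sum tendsto_scaleR_lcs tendsto_const assms)

lemma combination_affine:
  fixes P :: "'x::real_vector set"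
  shows "(\<Sum>p\<in>P. (u * b p + v * c p) *\<^sub>R p) = u *\<^sub>R (\<Sum>p\<in>P. b p *\<^sub>R p) + v *\<^sub>R (\<Sum>p\<in>P. c p *\<^sub>R p)"
  by (simp add: scaleR_add_left sum.distrib scaleR_sum_right)

lemma Gamma0_convex:
  assumes "g \<in> Gamma0" "0 \<le> u" "0 \<le> v" "u + v = 1"
  shows "g (u *\<^sub>R x + v *\<^sub>R y) \<le> ereal u * g x + ereal v * g y"
  using assms by (auto simp: Gamma0_def)

lemma Gamma0_le_combination:
  assumes "g \<in> Gamma0" "0 \<le> u" "0 \<le> v" "u + v = 1" "g x \<le> ereal a" "g y \<le> ereal b"
  shows "g (u *\<^sub>R x + v *\<^sub>R y) \<le> ereal (u * a + v * b)"
proof -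
  have "g (u *\<^sub>R x + v *\<^sub>R y) \<le> ereal u * g x + ereal v * g y" by (rule Gamma0_convex) fact+
  also have "\<dots> \<le> ereal u * ereal a + ereal v * ereal b"
    by (intro add_mono ereal_mult_left_mono) (use assms in auto)
  finally show ?thesis by simp
qed

text \<open>Lower semicontinuity keeps the point \<open>(y, r)\<close> at a positive distance from the epigraph of \<open>g\<close> in the
coordinates given by weights on \<open>P\<close>, so it can be separated strictly. The index \<open>None\<close> carries the height.\<close>

lemma separate_from_epigraph:
  fixes P :: "'x::locally_convex_space set"
  assumes g: "g \<in> Gamma0" and P: "finite P" "\<exists>p\<in>P. g p < \<infinity>"
    and y: "(\<Sum>p\<in>P. y p) = 1" and r: "ereal r < g (\<Sum>p\<in>P. y p *\<^sub>R p)"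
  obtains w \<beta> \<delta> where "\<beta> \<ge> 0" "\<delta> > 0"
    "\<And>b \<rho>. (\<Sum>p\<in>P. b p) = 1 \<Longrightarrow> g (\<Sum>p\<in>P. b p *\<^sub>R p) \<le> ereal \<rho> \<Longrightarrow>
      \<delta> \<le> (\<Sum>p\<in>P. w p * (b p - y p)) + \<beta> * (\<rho> - r)"
proof -
  define z where "z b = (\<Sum>p\<in>P. b p *\<^sub>R p)" for b
  define mk where "mk b \<rho> = case_option (\<rho> - r) (\<lambda>p. b p - y p)" for b \<rho>
  define E where "E = {mk b \<rho> | b \<rho>. (\<Sum>p\<in>P. b p) = 1 \<and> g (z b) \<le> ereal \<rho>}"
  define J where "J = insert None (Some ` P)"
  have J: "finite J" using P by (simp add: J_def)
  have sumJ: "(\<Sum>j\<in>J. h j) = h None + (\<Sum>p\<in>P. h (Some p))" for h :: "'x option \<Rightarrow> real"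
    using P by (simp add: J_def sum.reindex)
  obtain p0 where p0: "p0 \<in> P" "g p0 < \<infinity>" using P by blast
  have g_ninf: "g v \<noteq> - \<infinity>" for v using g by (simp add: Gamma0_def)
  obtain a0 where a0: "g p0 = ereal a0" using p0 g_ninf[of p0] by (cases "g p0") auto
  define e0 where "e0 = (\<lambda>p. if p = p0 then 1 else 0 :: real)"
  have ze0: "z e0 = p0"
  proof -
    have "z e0 = (\<Sum>p\<in>P. if p = p0 then p else 0)" unfolding z_def e0_def by (rule sum.cong) auto
    then show ?thesis using P p0 by simp
  qed
  have e0: "(\<Sum>p\<in>P. e0 p) = 1" using P p0 by (simp add: e0_def)
  have "mk e0 a0 \<in> E" unfolding E_def using e0 ze0 a0 by (intro CollectI exI[of _ e0] exI[of _ a0]) simp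
  then have ne: "E \<noteq> {}" by blast
  have conv: "(\<lambda>i. (1 - u) * s i + u * t i) \<in> E" if E: "s \<in> E" "t \<in> E" and u: "0 \<le> u" "u \<le> 1" for s t u
  proof -
    obtain b \<rho> c \<sigma> where s: "s = mk b \<rho>" "(\<Sum>p\<in>P. b p) = 1" "g (z b) \<le> ereal \<rho>"
      and t: "t = mk c \<sigma>" "(\<Sum>p\<in>P. c p) = 1" "g (z c) \<le> ereal \<sigma>"
      using E unfolding E_def by blast
    have "(\<lambda>i. (1 - u) * s i + u * t i) = mk (\<lambda>p. (1 - u) * b p + u * c p) ((1 - u) * \<rho> + u * \<sigma>)"
    proof
      fix i show "(1 - u) * s i + u * t i = mk (\<lambda>p. (1 - u) * b p + u * c p) ((1 - u) * \<rho> + u * \<sigma>) i"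
        unfolding s(1) t(1) mk_def by (cases i) (simp_all add: algebra_simps)
    qed
    moreover have "(\<Sum>p\<in>P. (1 - u) * b p + u * c p) = 1"
      using s(2) t(2) by (simp add: sum.distrib sum_distrib_left[symmetric])
    moreover have "g (z (\<lambda>p. (1 - u) * b p + u * c p)) \<le> ereal ((1 - u) * \<rho> + u * \<sigma>)"
      unfolding z_def combination_affine
      by (rule Gamma0_le_combination[OF g]) (use u s t in \<open>auto simp: z_def\<close>)
    ultimately show ?thesis unfolding E_def by blast
  qed
  obtain r' where r': "r < r'" "ereal r' < g (z y)"
    using ereal_dense2[OF r] by (auto simp: z_def)
  have "\<exists>d>0. \<forall>s\<in>E. d \<le> (\<Sum>j\<in>J. (s j)\<^sup>2)"
  proof (rule ccontr)
    assume neg: "\<not> ?thesis"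
    have "\<exists>b \<rho>. (\<Sum>p\<in>P. b p) = 1 \<and> g (z b) \<le> ereal \<rho> \<and> (\<Sum>j\<in>J. (mk b \<rho> j)\<^sup>2) < 1 / real (Suc n)" for n
    proof -
      have "0 < 1 / real (Suc n)" by simp
      then obtain s where s: "s \<in> E" "(\<Sum>j\<in>J. (s j)\<^sup>2) < 1 / real (Suc n)"
        using neg by (meson not_le)
      from s(1) obtain b \<rho> where "s = mk b \<rho>" "(\<Sum>p\<in>P. b p) = 1" "g (z b) \<le> ereal \<rho>"
        unfolding E_def by blast
      with s(2) show ?thesis by blast
    qed
    then obtain b \<rho> where b1: "\<And>n. (\<Sum>p\<in>P. b n p) = 1" and gb: "\<And>n. g (z (b n)) \<le> ereal (\<rho> n)"
      and small: "\<And>n. (\<Sum>j\<in>J. (mk (b n) (\<rho> n) j)\<^sup>2) < 1 / real (Suc n)" by metis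
    have coord: "(\<lambda>n. mk (b n) (\<rho> n) j) \<longlonglongrightarrow> 0" if "j \<in> J" for j
    proof -
      have "(\<lambda>n. (mk (b n) (\<rho> n) j)\<^sup>2) \<longlonglongrightarrow> 0"
      proof (rule tendsto_sandwich)
        show "\<forall>\<^sub>F n in sequentially. 0 \<le> (mk (b n) (\<rho> n) j)\<^sup>2" by simp
        show "\<forall>\<^sub>F n in sequentially. (mk (b n) (\<rho> n) j)\<^sup>2 \<le> 1 / real (Suc n)"
        proof (rule always_eventually, rule allI)
          fix n
          have "(mk (b n) (\<rho> n) j)\<^sup>2 \<le> (\<Sum>j\<in>J. (mk (b n) (\<rho> n) j)\<^sup>2)"
            by (rule member_le_sum) (use that J in auto)
          then show "(mk (b n) (\<rho> n) j)\<^sup>2 \<le> 1 / real (Suc n)" using small[of n] by simp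
        qed
        show "(\<lambda>n. 1 / real (Suc n)) \<longlonglongrightarrow> 0" by (rule LIMSEQ_Suc[OF lim_1_over_n])
      qed simp
      then have "(\<lambda>n. \<bar>mk (b n) (\<rho> n) j\<bar>) \<longlonglongrightarrow> 0"
        using tendsto_real_sqrt[of "\<lambda>n. (mk (b n) (\<rho> n) j)\<^sup>2" 0] by simp
      then show ?thesis by (simp add: tendsto_rabs_zero_iff)
    qed
    have "(\<lambda>n. \<rho> n - r) \<longlonglongrightarrow> 0" using coord[of None] by (simp add: J_def mk_def)
    then have \<rho>: "\<rho> \<longlonglongrightarrow> r" by (simp add: LIM_zero_iff)
    have bconv: "(\<lambda>n. b n p) \<longlonglongrightarrow> y p" if "p \<in> P" for p
      using coord[of "Some p"] that by (simp add: J_def mk_def LIM_zero_iff)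
    have zb: "(\<lambda>n. z (b n)) \<longlonglongrightarrow> z y" unfolding z_def by (rule tendsto_combination_lcs) (rule bconv)
    have "open {v. ereal r' < g v}" using g by (auto simp: Gamma0_def)
    then have "\<forall>\<^sub>F n in sequentially. z (b n) \<in> {v. ereal r' < g v}"
      by (rule topological_tendstoD[OF zb]) (use r' in auto)
    moreover have "\<forall>\<^sub>F n in sequentially. \<rho> n < r'" by (rule order_tendstoD(2)[OF \<rho> r'(1)])
    ultimately have "\<forall>\<^sub>F n in sequentially. False"
    proof eventually_elim
      case (elim n)
      then have "ereal r' < ereal (\<rho> n)"
        using less_le_trans[of "ereal r'" "g (z (b n))" "ereal (\<rho> n)"] gb[of n] by simp
      then show False using elim by simp
    qed
    then show False by simp
  qed
  then obtain d where d: "d > 0" "\<And>s. s \<in> E \<Longrightarrow> d \<le> (\<Sum>j\<in>J. (s j)\<^sup>2)" by blast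
  obtain w where w: "\<And>s. s \<in> E \<Longrightarrow> d \<le> (\<Sum>j\<in>J. w j * s j)"
    using min_norm_separation[OF J ne conv d(2)] by blast
  have sep: "d \<le> (\<Sum>p\<in>P. w (Some p) * (b p - y p)) + w None * (\<rho> - r)"
    if "(\<Sum>p\<in>P. b p) = 1" "g (\<Sum>p\<in>P. b p *\<^sub>R p) \<le> ereal \<rho>" for b \<rho>
  proof -
    have "mk b \<rho> \<in> E" using that unfolding E_def z_def by blast
    from w[OF this] show ?thesis by (simp add: sumJ mk_def)
  qed
  have "w None \<ge> 0"
  proof (rule ccontr)
    assume neg: "\<not> w None \<ge> 0"
    define k where "k = (\<Sum>p\<in>P. w (Some p) * (e0 p - y p))"
    define \<rho> where "\<rho> = max a0 (r + k / - w None)"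
    have "d \<le> k + w None * (\<rho> - r)" unfolding k_def
      by (rule sep[OF e0]) (use ze0 a0 in \<open>auto simp: \<rho>_def z_def\<close>)
    moreover have "\<rho> - r \<ge> k / - w None" by (simp add: \<rho>_def)
    then have "(- w None) * (\<rho> - r) \<ge> k" using neg by (simp add: field_simps)
    ultimately show False using d(1) by simp
  qed
  then show thesis by (rule that[OF _ d(1) sep])
qed

text \<open>This is the Fenchel-Moreau theorem for the restriction of \<open>g\<close> to the affine hull of \<open>P\<close>: affine functions
\<open>\<Sum>p. b p * q p\<close> below \<open>g\<close> come arbitrarily close to \<open>g\<close> at each point, including points outside its domain.\<close>

lemma affine_minorant:
  fixes P :: "'x::locally_convex_space set"
  assumes g: "g \<in> Gamma0" and P: "finite P" "P \<noteq> {}" "\<And>p. p \<in> P \<Longrightarrow> g p < \<infinity>"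
    and y: "(\<Sum>p\<in>P. y p) = 1" and r: "ereal r < g (\<Sum>p\<in>P. y p *\<^sub>R p)"
  obtains q where "r < (\<Sum>p\<in>P. y p * q p)"
    "\<And>b. (\<Sum>p\<in>P. b p) = 1 \<Longrightarrow> ereal (\<Sum>p\<in>P. b p * q p) \<le> g (\<Sum>p\<in>P. b p *\<^sub>R p)"
proof -
  obtain p0 where p0: "p0 \<in> P" using P by blast
  have ex: "\<exists>p\<in>P. g p < \<infinity>" using P by blast
  have g_ninf: "g v \<noteq> - \<infinity>" for v using g by (simp add: Gamma0_def)
  define e where "e = (\<lambda>(p' :: 'x) p. if p = p' then 1 else 0 :: real)"
  have affine: "(\<Sum>p\<in>P. b p * (k + (\<Sum>p'\<in>P. w p' * (e p p' - y' p')))) = k + (\<Sum>p\<in>P. w p * (b p - y' p))"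
    if "(\<Sum>p\<in>P. b p) = 1" for b w y' :: "'x \<Rightarrow> real" and k
  proof -
    have *: "(\<Sum>p'\<in>P. w p' * (e p p' - y' p')) = w p - (\<Sum>p'\<in>P. w p' * y' p')" if "p \<in> P" for p
    proof -
      have "(\<Sum>p'\<in>P. w p' * (e p p' - y' p')) = (\<Sum>p'\<in>P. (if p' = p then w p' else 0) - w p' * y' p')"
        by (rule sum.cong) (auto simp: e_def algebra_simps)
      then show ?thesis using P(1) that by (simp add: sum_subtractf)
    qed
    have "(\<Sum>p\<in>P. b p * (k + (\<Sum>p'\<in>P. w p' * (e p p' - y' p'))))
        = (\<Sum>p\<in>P. b p * (k + (w p - (\<Sum>p'\<in>P. w p' * y' p'))))"
      by (rule sum.cong) (auto simp: *)
    also have "\<dots> = (\<Sum>p\<in>P. b p * k + w p * b p - b p * (\<Sum>p'\<in>P. w p' * y' p'))"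
      by (rule sum.cong) (auto simp: algebra_simps)
    also have "\<dots> = (\<Sum>p\<in>P. b p) * k + (\<Sum>p\<in>P. w p * b p) - (\<Sum>p\<in>P. b p) * (\<Sum>p'\<in>P. w p' * y' p')"
      by (simp only: sum_subtractf sum.distrib sum_distrib_right)
    finally show ?thesis using that by (simp add: sum_subtractf right_diff_distrib)
  qed
  \<comment> \<open>A separating hyperplane that is not vertical is the graph of an affine minorant.\<close>
  have main: "\<exists>q. r' < (\<Sum>p\<in>P. y' p * q p) \<and>
      (\<forall>b. (\<Sum>p\<in>P. b p) = 1 \<longrightarrow> ereal (\<Sum>p\<in>P. b p * q p) \<le> g (\<Sum>p\<in>P. b p *\<^sub>R p))"
    if \<beta>: "\<beta> > 0" and \<delta>: "\<delta> > 0" and y': "(\<Sum>p\<in>P. y' p) = 1"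
      and sep: "\<And>b \<rho>. (\<Sum>p\<in>P. b p) = 1 \<Longrightarrow> g (\<Sum>p\<in>P. b p *\<^sub>R p) \<le> ereal \<rho> \<Longrightarrow>
      \<delta> \<le> (\<Sum>p\<in>P. w p * (b p - y' p)) + \<beta> * (\<rho> - r')" for \<beta> \<delta> w r' y'
  proof -
    define k where "k = r' + \<delta> / \<beta>"
    define q where "q = (\<lambda>p. k + (\<Sum>p'\<in>P. (- w p' / \<beta>) * (e p p' - y' p')))"
    have q: "(\<Sum>p\<in>P. b p * q p) = k + (\<Sum>p\<in>P. (- w p / \<beta>) * (b p - y' p))" if "(\<Sum>p\<in>P. b p) = 1" for b
      unfolding q_def by (rule affine[OF that])
    have "r' < (\<Sum>p\<in>P. y' p * q p)" using \<beta> \<delta> by (simp add: q[OF y'] k_def)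
    moreover have "ereal (\<Sum>p\<in>P. b p * q p) \<le> g (\<Sum>p\<in>P. b p *\<^sub>R p)" if b: "(\<Sum>p\<in>P. b p) = 1" for b
    proof (cases "g (\<Sum>p\<in>P. b p *\<^sub>R p)")
      case (real \<rho>)
      define W where "W = (\<Sum>p\<in>P. w p * (b p - y' p))"
      have "\<delta> \<le> W + \<beta> * (\<rho> - r')" unfolding W_def by (rule sep[OF b]) (simp add: real)
      then have "(\<delta> - W) / \<beta> \<le> \<rho> - r'" using \<beta> by (simp add: pos_divide_le_eq mult.commute)
      then have "k + (- W / \<beta>) \<le> \<rho>" by (simp add: k_def diff_divide_distrib)
      moreover have "(\<Sum>p\<in>P. (- w p / \<beta>) * (b p - y' p)) = - W / \<beta>" unfolding W_def
        unfolding sum_negf[symmetric] sum_divide_distrib by (rule sum.cong) auto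
      ultimately show ?thesis unfolding q[OF b] real by simp
    qed (use g_ninf in auto)
    ultimately show ?thesis by blast
  qed
  obtain w \<beta> \<delta> where sep: "\<beta> \<ge> 0" "\<delta> > 0"
    "\<And>b \<rho>. (\<Sum>p\<in>P. b p) = 1 \<Longrightarrow> g (\<Sum>p\<in>P. b p *\<^sub>R p) \<le> ereal \<rho> \<Longrightarrow>
      \<delta> \<le> (\<Sum>p\<in>P. w p * (b p - y p)) + \<beta> * (\<rho> - r)"
    by (rule separate_from_epigraph[OF g P(1) ex y r]) (rule that)
  show thesis
  proof (cases "\<beta> > 0")
    case True
    then show thesis using main[where w = w and r' = r and y' = y, OF True sep(2) y sep(3)] that by blast
  next
    case False
    then have \<beta>: "\<beta> = 0" using sep(1) by simp
    \<comment> \<open>The hyperplane is vertical and cuts \<open>y\<close> off from the domain of \<open>g\<close>: a large multiple of the cut is added to an affine minorant obtained at \<open>p0\<close>, where \<open>g\<close> is finite and a vertical hyperplane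
      is impossible.\<close>
    have e0: "(\<Sum>p\<in>P. e p0 p) = 1" using P p0 by (simp add: e_def)
    have ze0: "(\<Sum>p\<in>P. e p0 p *\<^sub>R p) = p0"
    proof -
      have "(\<Sum>p\<in>P. e p0 p *\<^sub>R p) = (\<Sum>p\<in>P. if p = p0 then p else 0)" unfolding e_def by (rule sum.cong) auto
      then show ?thesis using P p0 by simp
    qed
    obtain a0 where a0: "g p0 = ereal a0" using P(3)[OF p0] g_ninf[of p0] by (cases "g p0") auto
    have "ereal (a0 - 1) < g (\<Sum>p\<in>P. e p0 p *\<^sub>R p)" by (simp add: ze0 a0)
    then obtain w0 \<beta>0 \<delta>0 where sep0: "\<beta>0 \<ge> 0" "\<delta>0 > 0"
      "\<And>b \<rho>. (\<Sum>p\<in>P. b p) = 1 \<Longrightarrow> g (\<Sum>p\<in>P. b p *\<^sub>R p) \<le> ereal \<rho> \<Longrightarrow>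
        \<delta>0 \<le> (\<Sum>p\<in>P. w0 p * (b p - e p0 p)) + \<beta>0 * (\<rho> - (a0 - 1))"
      by (rule separate_from_epigraph[OF g P(1) ex e0]) (rule that)
    have "\<delta>0 \<le> \<beta>0" using sep0(3)[OF e0, of a0] by (simp add: ze0 a0)
    then have "\<beta>0 > 0" using sep0(2) by simp
    then obtain q0 where q0: "\<And>b. (\<Sum>p\<in>P. b p) = 1 \<Longrightarrow> ereal (\<Sum>p\<in>P. b p * q0 p) \<le> g (\<Sum>p\<in>P. b p *\<^sub>R p)"
      using main[where w = w0 and r' = "a0 - 1" and y' = "e p0", OF _ sep0(2) e0 sep0(3)] by blast
    obtain n :: nat where "(r - (\<Sum>p\<in>P. y p * q0 p)) / \<delta> < real n" using reals_Archimedean2 by blast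
    then have n: "r < (\<Sum>p\<in>P. y p * q0 p) + n * \<delta>" using sep(2) by (simp add: pos_divide_less_eq)
    define q where "q = (\<lambda>p. q0 p + (n * \<delta> + (\<Sum>p'\<in>P. (- real n * w p') * (e p p' - y p'))))"
    have q: "(\<Sum>p\<in>P. b p * q p) = (\<Sum>p\<in>P. b p * q0 p) + n * (\<delta> - (\<Sum>p\<in>P. w p * (b p - y p)))"
      if "(\<Sum>p\<in>P. b p) = 1" for b
    proof -
      have "(\<Sum>p\<in>P. b p * q p) = (\<Sum>p\<in>P. b p * q0 p)
          + (\<Sum>p\<in>P. b p * (n * \<delta> + (\<Sum>p'\<in>P. (- real n * w p') * (e p p' - y p'))))"
        unfolding sum.distrib[symmetric] q_def by (rule sum.cong[OF refl]) (rule distrib_left)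
      also have "\<dots> = (\<Sum>p\<in>P. b p * q0 p) + (n * \<delta> + (\<Sum>p\<in>P. (- real n * w p) * (b p - y p)))"
        by (subst affine[OF that]) (rule refl)
      also have "(\<Sum>p\<in>P. (- real n * w p) * (b p - y p)) = - (n * (\<Sum>p\<in>P. w p * (b p - y p)))"
        unfolding sum_distrib_left sum_negf[symmetric] by (rule sum.cong) auto
      finally show ?thesis by (simp add: right_diff_distrib)
    qed
    have "r < (\<Sum>p\<in>P. y p * q p)" using n by (simp add: q[OF y])
    moreover have "ereal (\<Sum>p\<in>P. b p * q p) \<le> g (\<Sum>p\<in>P. b p *\<^sub>R p)" if b: "(\<Sum>p\<in>P. b p) = 1" for b
    proof (cases "g (\<Sum>p\<in>P. b p *\<^sub>R p)")
      case (real \<rho>)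
      have "\<delta> \<le> (\<Sum>p\<in>P. w p * (b p - y p))" using sep(3)[OF b, of \<rho>] real \<beta> by simp
      then have "n * (\<delta> - (\<Sum>p\<in>P. w p * (b p - y p))) \<le> 0" by (simp add: mult_nonneg_nonpos)
      then have "ereal (\<Sum>p\<in>P. b p * q p) \<le> ereal (\<Sum>p\<in>P. b p * q0 p)" by (simp add: q[OF b])
      then show ?thesis using q0[OF b] by (rule order_trans)
    qed (use g_ninf in auto)
    ultimately show thesis by (rule that)
  qed
qed


section \<open>Upper integrals and limit theorems\<close>

lemma beppo_levi:
  fixes h :: "nat \<Rightarrow> 't \<Rightarrow> real"
  assumes int: "\<And>n. integrable M (h n)" and mono: "\<And>n. AE t in M. h n t \<le> h (Suc n) t"
    and bd: "\<And>n. (\<integral>t. h n t \<partial>M) \<le> K"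
  obtains U where "integrable M U" "AE t in M. \<forall>n. h n t \<le> U t" "(\<integral>t. U t \<partial>M) \<le> K"
    "AE t in M. (\<lambda>n. h n t) \<longlonglongrightarrow> U t"
proof -
  have meas[measurable]: "\<And>n. h n \<in> borel_measurable M" using int by simp
  define d where "d n t = ennreal (h n t - h 0 t)" for n t
  have AEmono: "AE t in M. \<forall>n. h n t \<le> h (Suc n) t" using mono by (simp add: AE_all_countable)
  have h_inc: "AE t in M. incseq (\<lambda>n. h n t)"
    using AEmono by eventually_elim (auto intro: incseq_SucI)
  have "(\<integral>\<^sup>+ t. (SUP n. d n t) \<partial>M) = (SUP n. \<integral>\<^sup>+ t. d n t \<partial>M)"
  proof (rule nn_integral_monotone_convergence_SUP_AE)
    show "AE t in M. d n t \<le> d (Suc n) t" for n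
      using mono[of n] by eventually_elim (auto simp: d_def intro!: ennreal_leI)
  qed (simp add: d_def)
  also have "\<dots> \<le> ennreal (K - (\<integral>t. h 0 t \<partial>M))"
  proof (rule SUP_least)
    fix n
    have "(\<integral>\<^sup>+ t. d n t \<partial>M) = ennreal (\<integral>t. h n t - h 0 t \<partial>M)"
      unfolding d_def
    proof (rule nn_integral_eq_integral)
      show "AE t in M. 0 \<le> h n t - h 0 t"
        using h_inc by eventually_elim (auto simp: incseq_def)
    qed (use int in auto)
    also have "\<dots> \<le> ennreal (K - (\<integral>t. h 0 t \<partial>M))" using int bd[of n] by (intro ennreal_leI) simp
    finally show "(\<integral>\<^sup>+ t. d n t \<partial>M) \<le> ennreal (K - (\<integral>t. h 0 t \<partial>M))" .
  qed
  finally have "(\<integral>\<^sup>+ t. (SUP n. d n t) \<partial>M) \<noteq> \<infinity>" by (auto simp: top_unique)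
  then have "AE t in M. (SUP n. d n t) \<noteq> \<infinity>"
    by (intro nn_integral_noteq_infinite) (auto simp: d_def)
  with h_inc have conv: "AE t in M. convergent (\<lambda>n. h n t)"
  proof eventually_elim
    case (elim t)
    then obtain c where c: "c \<ge> 0" "(SUP n. d n t) = ennreal c"
      by (cases "SUP n. d n t") auto
    have "h n t \<le> c + h 0 t" for n
    proof -
      have "d n t \<le> ennreal c" unfolding c(2)[symmetric] by (rule SUP_upper) simp
      then show ?thesis using c(1) by (simp add: d_def ennreal_le_iff)
    qed
    then obtain l where "(\<lambda>n. h n t) \<longlonglongrightarrow> l" using incseq_convergent[OF elim(1), of "c + h 0 t"] by blast
    then show ?case by (auto simp: convergent_def)
  qed
  define U where "U t = lim (\<lambda>n. h n t)" for t
  have lim: "AE t in M. (\<lambda>n. h n t) \<longlonglongrightarrow> U t"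
    using conv by eventually_elim (simp add: U_def convergent_LIMSEQ_iff)
  have "incseq (\<lambda>n. \<integral>t. h n t \<partial>M)" by (intro incseq_SucI integral_mono_AE int mono)
  then obtain l where l: "(\<lambda>n. \<integral>t. h n t \<partial>M) \<longlonglongrightarrow> l" "\<forall>i. (\<integral>t. h i t \<partial>M) \<le> l"
    using incseq_convergent[of "\<lambda>n. \<integral>t. h n t \<partial>M" K] bd by blast
  have Um: "U \<in> borel_measurable M" unfolding U_def by measurable
  have mono': "AE t in M. mono (\<lambda>n. h n t)" using h_inc by simp
  have U: "integrable M U" "(\<integral>t. U t \<partial>M) = l"
    by (rule integrable_monotone_convergence[OF int mono' lim l(1) Um],
        rule integral_monotone_convergence[OF int mono' lim l(1) Um])
  have "l \<le> K" by (rule LIMSEQ_le_const2[OF l(1)]) (use bd in auto)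
  moreover have "AE t in M. \<forall>n. h n t \<le> U t"
    using h_inc lim by eventually_elim (auto intro: incseq_le)
  ultimately show thesis using that[OF U(1)] U(2) lim by simp
qed

lemma upper_integral_le:
  "integrable M g \<Longrightarrow> AE t in M. h t \<le> ereal (g t) \<Longrightarrow> upper_integral M h \<le> ereal (\<integral>t. g t \<partial>M)"
  unfolding upper_integral_def by (rule INF_lower) simp

lemma upper_integral_ge:
  assumes k: "integrable M k" and le: "AE t in M. ereal (k t) \<le> h t"
  shows "ereal (\<integral>t. k t \<partial>M) \<le> upper_integral M h"
  unfolding upper_integral_def
proof (rule INF_greatest)
  fix g assume "g \<in> {g. integrable M g \<and> (AE t in M. h t \<le> ereal (g t))}"
  then have g: "integrable M g" "AE t in M. h t \<le> ereal (g t)" by auto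
  have "AE t in M. k t \<le> g t"
    using le g(2)
  proof eventually_elim
    case (elim t)
    then have "ereal (k t) \<le> ereal (g t)" by (rule order_trans)
    then show ?case by simp
  qed
  then show "ereal (\<integral>t. k t \<partial>M) \<le> ereal (\<integral>t. g t \<partial>M)"
    by (simp add: integral_mono_AE k g)
qed

lemma upper_integral_eq:
  assumes k: "integrable M k" and eq: "AE t in M. h t = ereal (k t)"
  shows "upper_integral M h = ereal (\<integral>t. k t \<partial>M)"
proof (rule antisym)
  show "upper_integral M h \<le> ereal (\<integral>t. k t \<partial>M)"
    by (rule upper_integral_le[OF k]) (use eq in eventually_elim, simp)
  show "ereal (\<integral>t. k t \<partial>M) \<le> upper_integral M h"
    by (rule upper_integral_ge[OF k]) (use eq in eventually_elim, simp)
qed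

lemma upper_integral_majorant:
  assumes "upper_integral M h < \<infinity>"
  obtains g where "integrable M g" "AE t in M. h t \<le> ereal (g t)"
  using assms that unfolding upper_integral_def INF_less_iff by auto

text \<open>A finite upper integral yields an integrable majorant \<open>g\<close> and a lower bound on the integrals of all
integrable majorants. Cutting \<open>h\<close> off below at \<open>g - n\<rho>\<close>, with \<open>\<rho> > 0\<close> integrable, gives integrable majorants
that decrease to \<open>h\<close>, so their limit is integrable as well.\<close>

lemma (in sigma_finite_measure) upper_integral_finite:
  assumes h[measurable]: "h \<in> borel_measurable M" and ninf: "AE t in M. h t \<noteq> - \<infinity>"
    and fin: "\<bar>upper_integral M h\<bar> \<noteq> \<infinity>"
  shows "integrable M (\<lambda>t. real_of_ereal (h t))"
    and "AE t in M. h t = ereal (real_of_ereal (h t))"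
    and "upper_integral M h = ereal (\<integral>t. real_of_ereal (h t) \<partial>M)"
proof -
  have "upper_integral M h < \<infinity>" using fin by auto
  then obtain g where g: "integrable M g" "AE t in M. h t \<le> ereal (g t)"
    by (rule upper_integral_majorant)
  have [measurable]: "g \<in> borel_measurable M" using g by simp
  define k where "k t = real_of_ereal (h t)" for t
  have k_meas[measurable]: "k \<in> borel_measurable M" unfolding k_def by simp
  show eq: "AE t in M. h t = ereal (real_of_ereal (h t))"
    using ninf g(2)
  proof eventually_elim
    case (elim t) then show ?case by (cases "h t") auto
  qed
  then have kg: "AE t in M. k t \<le> g t"
    using g(2)
  proof eventually_elim
    case (elim t)
    then have "ereal (k t) \<le> ereal (g t)" by (simp add: k_def)
    then show ?case by simp
  qed
  obtain K where K: "upper_integral M h = ereal K" using fin by (cases "upper_integral M h") auto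
  obtain \<rho> :: "'a \<Rightarrow> real" where \<rho>: "\<rho> \<in> borel_measurable M" "\<And>t. \<rho> t > 0" "integrable M \<rho>"
    by (rule obtain_positive_integrable_function) (rule that)
  define w where "w n t = min (- k t) (real n * \<rho> t - g t)" for n t
  have wm[measurable]: "w n \<in> borel_measurable M" for n
    unfolding w_def[abs_def]
    by (intro borel_measurable_min borel_measurable_uminus k_meas borel_measurable_diff borel_measurable_times
        borel_measurable_const \<rho>(1) borel_measurable_integrable g(1))
  have w_int: "integrable M (w n)" for n
  proof (rule Bochner_Integration.integrable_bound)
    show "integrable M (\<lambda>t. \<bar>g t\<bar> + real n * \<rho> t)" using g(1) \<rho>(3) by simp
    show "AE t in M. norm (w n t) \<le> norm (\<bar>g t\<bar> + real n * \<rho> t)"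
      using kg
    proof eventually_elim
      case (elim t)
      have "real n * \<rho> t \<ge> 0" using \<rho>(2)[of t] by simp
      then show ?case using elim by (auto simp: w_def min_def)
    qed
  qed simp
  have w_bd: "(\<integral>t. w n t \<partial>M) \<le> - K" for n
  proof -
    have "upper_integral M h \<le> ereal (\<integral>t. - w n t \<partial>M)"
    proof (rule upper_integral_le)
      show "AE t in M. h t \<le> ereal (- w n t)"
        using eq
      proof eventually_elim
        case (elim t)
        have "k t \<le> - w n t" by (simp add: w_def)
        then show ?case using elim by (cases "h t") (simp_all add: k_def)
      qed
    qed (use w_int in simp)
    then show ?thesis using K by simp
  qed
  have w_mono: "AE t in M. w n t \<le> w (Suc n) t" for n
  proof (rule AE_I2)
    fix t
    have "real n * \<rho> t - g t \<le> real (Suc n) * \<rho> t - g t" using \<rho>(2)[of t] by (simp add: algebra_simps)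
    then show "w n t \<le> w (Suc n) t" unfolding w_def by (intro min.mono) auto
  qed
  obtain U where U: "integrable M U" "AE t in M. (\<lambda>n. w n t) \<longlonglongrightarrow> U t"
    by (rule beppo_levi[of M w "- K", OF w_int w_mono w_bd]) (rule that)
  have "AE t in M. - U t = k t"
    using U(2)
  proof eventually_elim
    case (elim t)
    obtain N where N: "(g t - k t) / \<rho> t < real N" using reals_Archimedean2 by blast
    have "w n t = - k t" if "n \<ge> N" for n
    proof -
      have "(g t - k t) / \<rho> t \<le> real n" using N that by simp
      then have "g t - k t \<le> real n * \<rho> t" using \<rho>(2)[of t] by (simp add: pos_divide_le_eq)
      then show ?thesis by (simp add: w_def)
    qed
    then have "(\<lambda>n. w n t) \<longlonglongrightarrow> - k t"
      by (intro tendsto_eventually) (auto simp: eventually_sequentially)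
    then show ?case using LIMSEQ_unique[OF elim] by simp
  qed
  then show int: "integrable M (\<lambda>t. real_of_ereal (h t))"
    using integrable_cong_AE[of "\<lambda>t. - U t" M k] U(1) unfolding k_def[symmetric] by simp
  show "upper_integral M h = ereal (\<integral>t. real_of_ereal (h t) \<partial>M)"
    by (rule upper_integral_eq[OF int eq])
qed

lemma fatou_real:
  fixes v :: "nat \<Rightarrow> 't \<Rightarrow> real"
  assumes int: "\<And>n. integrable M (v n)" and pos: "\<And>n. AE t in M. 0 \<le> v n t"
    and lim: "AE t in M. (\<lambda>n. v n t) \<longlonglongrightarrow> w t" and w: "w \<in> borel_measurable M"
    and c: "(\<lambda>n. \<integral>t. v n t \<partial>M) \<longlonglongrightarrow> c"
  shows "integrable M w" and "(\<integral>t. w t \<partial>M) \<le> c"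
proof -
  have posAll: "AE t in M. \<forall>n. 0 \<le> v n t" using pos by (simp add: AE_all_countable)
  have wpos: "AE t in M. 0 \<le> w t"
    using posAll lim by eventually_elim (auto intro: LIMSEQ_le_const)
  have c0: "0 \<le> c" by (rule LIMSEQ_le_const[OF c]) (use pos in \<open>auto intro: integral_nonneg_AE\<close>)
  have "(\<integral>\<^sup>+ t. ennreal (w t) \<partial>M) = (\<integral>\<^sup>+ t. liminf (\<lambda>n. ennreal (v n t)) \<partial>M)"
  proof (rule nn_integral_cong_AE)
    show "AE t in M. ennreal (w t) = liminf (\<lambda>n. ennreal (v n t))"
      using lim by eventually_elim (auto intro!: lim_imp_Liminf[symmetric] tendsto_ennrealI)
  qed
  also have "\<dots> \<le> liminf (\<lambda>n. \<integral>\<^sup>+ t. ennreal (v n t) \<partial>M)"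
    by (rule nn_integral_liminf) (use int in simp)
  also have "\<dots> = liminf (\<lambda>n. ennreal (\<integral>t. v n t \<partial>M))"
    using nn_integral_eq_integral[OF int pos] by simp
  also have "\<dots> = ennreal c"
    by (intro lim_imp_Liminf tendsto_ennrealI c) simp
  finally have le: "(\<integral>\<^sup>+ t. ennreal (w t) \<partial>M) \<le> ennreal c" .
  show wi: "integrable M w"
  proof (rule integrableI_bounded[OF w])
    have "(\<integral>\<^sup>+ t. ennreal (norm (w t)) \<partial>M) = (\<integral>\<^sup>+ t. ennreal (w t) \<partial>M)"
      by (rule nn_integral_cong_AE) (use wpos in eventually_elim, simp)
    then show "(\<integral>\<^sup>+ t. ennreal (norm (w t)) \<partial>M) < \<infinity>" using le by (auto intro: le_less_trans)
  qed
  show "(\<integral>t. w t \<partial>M) \<le> c"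
    using le c0 unfolding nn_integral_eq_integral[OF wi wpos] by (simp add: ennreal_le_iff)
qed

text \<open>Along a subsequence with distances below \<open>4\<^sup>-\<^sup>k\<close> the series \<open>\<Sum>\<^sub>k 2\<^sup>k d\<^sub>k\<^sup>2\<close> of consecutive differences has a finite
integral, and \<open>2 \<bar>d\<^sub>k\<bar> \<le> 2\<^sup>k d\<^sub>k\<^sup>2 + 2\<^sup>-\<^sup>k\<close> then makes the differences themselves summable almost everywhere.\<close>

lemma AE_convergent_subsequence:
  fixes E :: "nat \<Rightarrow> 'p \<Rightarrow> 't \<Rightarrow> real"
  assumes meas[measurable]: "\<And>n p. p \<in> P \<Longrightarrow> E n p \<in> borel_measurable M"
    and \<rho>[measurable]: "\<rho> \<in> borel_measurable M" and \<rho>pos: "\<And>t. \<rho> t > 0" and P: "finite P"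
    and cauchy: "\<And>n m. n \<le> m \<Longrightarrow>
      (\<integral>\<^sup>+ t. ennreal (\<Sum>p\<in>P. (E n p t - E m p t)\<^sup>2 * \<rho> t) \<partial>M) \<le> ennreal (c n)"
    and c: "c \<longlonglongrightarrow> 0"
  obtains r :: "nat \<Rightarrow> nat" where "strict_mono r" "AE t in M. \<forall>p\<in>P. convergent (\<lambda>k. E (r k) p t)"
proof -
  have ex: "\<exists>N. \<forall>n\<ge>N. c n < (1/4)^k" for k
    using order_tendstoD(2)[OF c, of "(1/4)^k"] by (simp add: eventually_sequentially)
  have "\<exists>r. \<forall>k. c (r k) < (1/4)^k \<and> r k < r (Suc k)"
  proof (rule dependent_nat_choice)
    show "\<exists>n. c n < (1/4)^0" using ex[of 0] by blast
  next
    fix n k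
    obtain N where "\<forall>n\<ge>N. c n < (1/4)^(Suc k)" using ex by blast
    then show "\<exists>m. c m < (1/4)^(Suc k) \<and> n < m" by (intro exI[of _ "max N (Suc n)"]) auto
  qed
  then obtain r where r: "\<And>k. c (r k) < (1/4)^k" and rmono: "strict_mono r"
    by (auto simp: strict_mono_Suc_iff)
  define D where "D k t = (\<Sum>p\<in>P. (E (r k) p t - E (r (Suc k)) p t)\<^sup>2 * \<rho> t)" for k t
  have Dm[measurable]: "D k \<in> borel_measurable M" for k unfolding D_def by measurable
  have Dpos: "0 \<le> D k t" for k t
    unfolding D_def using \<rho>pos[of t] by (intro sum_nonneg mult_nonneg_nonneg) auto
  have "(\<integral>\<^sup>+ t. (\<Sum>k. ennreal (2^k * D k t)) \<partial>M) = (\<Sum>k. \<integral>\<^sup>+ t. ennreal (2^k * D k t) \<partial>M)"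
    by (rule nn_integral_suminf) simp
  also have "\<dots> \<le> (\<Sum>k. ennreal ((1/2)^k))"
  proof (rule suminf_le)
    fix k
    have "(\<integral>\<^sup>+ t. ennreal (2^k * D k t) \<partial>M) = ennreal (2^k) * (\<integral>\<^sup>+ t. ennreal (D k t) \<partial>M)"
      by (simp add: ennreal_mult' nn_integral_cmult)
    also have "\<dots> \<le> ennreal (2^k) * ennreal (c (r k))"
      unfolding D_def by (intro mult_left_mono cauchy) (use strict_monoD[OF rmono, of k "Suc k"] in auto)
    also have "\<dots> \<le> ennreal (2^k) * ennreal ((1/4)^k)"
      by (intro mult_left_mono ennreal_leI less_imp_le r) simp
    also have "\<dots> = ennreal ((1/2)^k)"
      by (simp add: ennreal_mult[symmetric] power_mult_distrib[symmetric])
    finally show "(\<integral>\<^sup>+ t. ennreal (2^k * D k t) \<partial>M) \<le> ennreal ((1/2)^k)" .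
  qed auto
  also have "\<dots> = ennreal (\<Sum>k. (1/2)^k)" by (rule suminf_ennreal2) (auto intro: summable_geometric)
  finally have "(\<integral>\<^sup>+ t. (\<Sum>k. ennreal (2^k * D k t)) \<partial>M) \<noteq> \<infinity>" by (auto simp: top_unique)
  then have "AE t in M. (\<Sum>k. ennreal (2^k * D k t)) \<noteq> \<infinity>"
    by (intro nn_integral_noteq_infinite) simp_all
  then have "AE t in M. \<forall>p\<in>P. convergent (\<lambda>k. E (r k) p t)"
  proof eventually_elim
    case (elim t)
    then have sD: "summable (\<lambda>k. 2^k * D k t)"
      by (intro summable_suminf_not_top) (use Dpos in auto)
    show ?case
    proof
      fix p assume p: "p \<in> P"
      define d where "d k = E (r (Suc k)) p t - E (r k) p t" for k
      have "summable (\<lambda>k. (1 / \<rho> t) * (2^k * D k t) + (1/2)^k)"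
        by (intro summable_add summable_mult sD summable_geometric) simp
      then have "summable d"
      proof (rule summable_comparison_test')
        fix k :: nat assume "k \<ge> 0"
        have "(E (r k) p t - E (r (Suc k)) p t)\<^sup>2 * \<rho> t \<le> D k t"
          unfolding D_def using \<rho>pos[of t] by (intro member_le_sum p P) auto
        then have "(d k)\<^sup>2 * \<rho> t \<le> D k t" by (simp add: d_def power2_commute)
        then have "(d k)\<^sup>2 \<le> (1 / \<rho> t) * D k t" using \<rho>pos[of t] by (simp add: pos_le_divide_eq)
        then have "2^k * (d k)\<^sup>2 \<le> 2^k * ((1 / \<rho> t) * D k t)" by (intro mult_left_mono) auto
        then have A: "2^k * (d k)\<^sup>2 \<le> (1 / \<rho> t) * (2^k * D k t)" by (simp add: mult.left_commute)
        have square: "(a * \<bar>x\<bar> - 1)\<^sup>2 = a * (a * x\<^sup>2) - 2 * (a * \<bar>x\<bar>) + 1" for a x :: real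
          by (simp add: power2_diff power_mult_distrib power2_eq_square[of a])
        have "0 \<le> (2^k * \<bar>d k\<bar> - 1)\<^sup>2" by simp
        also have "\<dots> = 2^k * (2^k * (d k)\<^sup>2) - 2 * (2^k * \<bar>d k\<bar>) + 1" by (rule square)
        finally have "2^k * (2 * \<bar>d k\<bar>) \<le> 2^k * (2^k * (d k)\<^sup>2 + (1/2)^k)"
          by (simp add: distrib_left power_mult_distrib[symmetric])
        then have "2 * \<bar>d k\<bar> \<le> 2^k * (d k)\<^sup>2 + (1/2)^k" by (subst (asm) mult_le_cancel_left_pos) auto
        then show "norm (d k) \<le> (1 / \<rho> t) * (2^k * D k t) + (1/2)^k" using A by simp
      qed
      then have "(\<lambda>n. \<Sum>k<n. d k) \<longlonglongrightarrow> suminf d" by (rule summable_LIMSEQ)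
      moreover have "(\<Sum>k<n. d k) = E (r n) p t - E (r 0) p t" for n
        unfolding d_def by (rule sum_lessThan_telescope)
      ultimately have "(\<lambda>n. E (r n) p t - E (r 0) p t + E (r 0) p t) \<longlonglongrightarrow> suminf d + E (r 0) p t"
        by (intro tendsto_add tendsto_const) simp
      then show "convergent (\<lambda>k. E (r k) p t)" by (auto simp: convergent_def)
    qed
  qed
  then show thesis using that rmono by blast
qed


section \<open>Rational points and convexity\<close>

text \<open>Convexity is stated for the epigraph, which avoids arithmetic with infinite values and turns Jensen's
inequality into the closure of a convex set under finite convex combinations.\<close>

definition econvex :: "('x::real_vector \<Rightarrow> ereal) \<Rightarrow> bool" where
  "econvex g \<longleftrightarrow> convex {(v, r). g v \<le> ereal r}"

lemma econvexD:
  assumes g: "econvex g" and "0 \<le> u" "0 \<le> v" "u + v = 1" "g x \<le> ereal a" "g y \<le> ereal b"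
  shows "g (u *\<^sub>R x + v *\<^sub>R y) \<le> ereal (u * a + v * b)"
proof -
  have "u *\<^sub>R (x, a) + v *\<^sub>R (y, b) \<in> {(v, r). g v \<le> ereal r}"
    by (rule convexD[OF g[unfolded econvex_def]]) (use assms in auto)
  then show ?thesis by simp
qed

lemma econvex_combination:
  fixes P :: "'x::real_vector set"
  assumes g: "econvex g" and P: "finite P" and w: "\<And>p. p \<in> P \<Longrightarrow> 0 \<le> w p" "(\<Sum>p\<in>P. w p) = 1"
    and a: "\<And>p. p \<in> P \<Longrightarrow> g p \<le> ereal (a p)"
  shows "g (\<Sum>p\<in>P. w p *\<^sub>R p) \<le> ereal (\<Sum>p\<in>P. w p * a p)"
proof -
  have "(\<Sum>p\<in>P. w p *\<^sub>R (p, a p)) \<in> {(v, r). g v \<le> ereal r}"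
    by (rule convex_sum[OF P g[unfolded econvex_def] w(2)]) (use w a in auto)
  moreover have "(\<Sum>p\<in>P. w p *\<^sub>R (p, a p)) = (\<Sum>p\<in>P. w p *\<^sub>R p, \<Sum>p\<in>P. w p * a p)"
    by (simp add: prod_eq_iff fst_sum snd_sum)
  ultimately show ?thesis by simp
qed

lemma Gamma0_econvex: "g \<in> Gamma0 \<Longrightarrow> econvex g"
  unfolding econvex_def convex_def by (auto intro: Gamma0_le_combination)

text \<open>Weights vanish outside \<open>P\<close> so that there are only countably many of them.\<close>

definition rational_weights :: "'x set \<Rightarrow> ('x \<Rightarrow> real) set" where
  "rational_weights P = {b. (\<forall>p\<in>P. b p \<in> \<rat>) \<and> (\<forall>p. p \<notin> P \<longrightarrow> b p = 0)}"

lemma countable_rational_weights: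
  assumes "finite P" shows "countable (rational_weights P)"
proof -
  have "countable ((\<lambda>b p. if p \<in> P then b p else 0) ` (PiE P (\<lambda>_. \<rat> :: real set)))"
    by (intro countable_image countable_PiE assms) (simp add: countable_rat)
  moreover have "rational_weights P \<subseteq> (\<lambda>b p. if p \<in> P then b p else 0) ` (PiE P (\<lambda>_. \<rat>))"
  proof
    fix b :: "'a \<Rightarrow> real" assume b: "b \<in> rational_weights P"
    have "b = (\<lambda>p. if p \<in> P then restrict b P p else 0)"
      using b by (auto simp: rational_weights_def fun_eq_iff)
    moreover have "restrict b P \<in> PiE P (\<lambda>_. \<rat>)" using b by (auto simp: rational_weights_def)
    ultimately show "b \<in> (\<lambda>b p. if p \<in> P then b p else 0) ` (PiE P (\<lambda>_. \<rat>))" by (rule image_eqI)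
  qed
  ultimately show ?thesis by (rule countable_subset[rotated])
qed

lemma rational_weights_near:
  fixes c :: "'x \<Rightarrow> real"
  assumes "\<delta> > 0"
  obtains q where "q \<in> rational_weights P" "\<And>p. p \<in> P \<Longrightarrow> c p \<le> q p" "\<And>p. p \<in> P \<Longrightarrow> q p \<le> c p + \<delta>"
proof -
  have "\<exists>r\<in>\<rat>. c p < r \<and> r < c p + \<delta>" for p using Rats_dense_in_real[of "c p" "c p + \<delta>"] assms by auto
  then obtain r where r: "\<And>p. r p \<in> \<rat>" "\<And>p. c p < r p" "\<And>p. r p < c p + \<delta>" by metis
  show thesis
    by (rule that[of "\<lambda>p. if p \<in> P then r p else 0"])
      (auto simp: rational_weights_def r less_imp_le)
qed

text \<open>What is needed of \<open>q\<close> is that \<open>q - (1 - \<delta>) b\<close> is \<open>\<delta>\<close> times a convex combination: the rational point lies on the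
segment from \<open>b\<close> to a point of the simplex, close to \<open>b\<close>. All weights but one are rounded up; the weight at
\<open>p0\<close> restores the sum.\<close>

lemma rational_weights_dense:
  fixes P :: "'x set" and b :: "'x \<Rightarrow> real"
  assumes P: "finite P" "P \<noteq> {}" and b: "(\<Sum>p\<in>P. b p) = 1" and \<delta>: "0 < \<delta>" "\<delta> \<le> 1"
  obtains q where "q \<in> rational_weights P" "(\<Sum>p\<in>P. q p) = 1"
    "\<And>p. p \<in> P \<Longrightarrow> (1 - \<delta>) * b p \<le> q p"
proof -
  obtain p0 where p0: "p0 \<in> P" using P by blast
  define N where "N = real (card P)"
  have N: "N > 0" using P by (simp add: N_def card_gt_0_iff)
  obtain r where r: "r \<in> rational_weights P" "\<And>p. p \<in> P \<Longrightarrow> (1 - \<delta>) * b p \<le> r p"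
    "\<And>p. p \<in> P \<Longrightarrow> r p \<le> (1 - \<delta>) * b p + \<delta> / N"
    using rational_weights_near[of "\<delta> / N" P "\<lambda>p. (1 - \<delta>) * b p"] \<delta> N by (metis divide_pos_pos)
  define q where "q = r(p0 := 1 - (\<Sum>p\<in>P - {p0}. r p))"
  have q_other: "(\<Sum>p\<in>P - {p0}. q p) = (\<Sum>p\<in>P - {p0}. r p)"
    by (rule sum.cong) (auto simp: q_def)
  have sum: "(\<Sum>p\<in>P. q p) = 1"
    using sum.remove[OF P(1) p0, of q] q_other by (simp add: q_def)
  have rat: "(\<Sum>p\<in>P - {p0}. r p) \<in> \<rat>" by (rule Rats_sum) (use r in \<open>auto simp: rational_weights_def\<close>)
  have "q \<in> rational_weights P"
    using r(1) p0 rat by (auto simp: rational_weights_def q_def)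
  moreover have "(1 - \<delta>) * b p \<le> q p" if "p \<in> P" for p
  proof (cases "p = p0")
    case True
    have "(\<Sum>p\<in>P - {p0}. r p) \<le> (\<Sum>p\<in>P - {p0}. (1 - \<delta>) * b p + \<delta> / N)"
      by (rule sum_mono) (use r in auto)
    also have "\<dots> = (1 - \<delta>) * (\<Sum>p\<in>P - {p0}. b p) + real (card (P - {p0})) * (\<delta> / N)"
      by (simp add: sum.distrib sum_distrib_left)
    also have "(\<Sum>p\<in>P - {p0}. b p) = 1 - b p0" using sum.remove[OF P(1) p0, of b] b by simp
    also have "real (card (P - {p0})) = N - 1" using p0 P by (simp add: N_def of_nat_diff card_gt_0_iff Suc_leI)
    also have "(N - 1) * (\<delta> / N) \<le> \<delta>" using N \<delta> by (simp add: field_simps)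
    finally show ?thesis using True by (simp add: q_def algebra_simps)
  next
    case False
    then show ?thesis using r that by (simp add: q_def)
  qed
  ultimately show thesis using that sum by blast
qed

text \<open>A rational point on a short segment from \<open>b\<close> into the simplex spanned by \<open>P\<close> bounds the affine function there by
\<open>(1 - \<delta>) g(b) + \<delta> C\<close>, with \<open>C\<close> independent of \<open>\<delta>\<close>; let \<open>\<delta>\<close> tend to zero. Moving into the simplex is what
makes this work when \<open>b\<close> is a boundary point of the domain of \<open>g\<close>, where \<open>g\<close> may be discontinuous.\<close>

lemma affine_le_econvex_of_rational:
  fixes P :: "'x::real_vector set"
  assumes P: "finite P" "P \<noteq> {}" and g: "econvex g" and gP: "\<And>p. p \<in> P \<Longrightarrow> g p \<le> ereal (a p)"
    and le: "\<And>b. b \<in> rational_weights P \<Longrightarrow> (\<Sum>p\<in>P. b p) = 1 \<Longrightarrow>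
      ereal (\<Sum>p\<in>P. b p * q p) \<le> g (\<Sum>p\<in>P. b p *\<^sub>R p)"
    and b: "(\<Sum>p\<in>P. b p) = 1"
  shows "ereal (\<Sum>p\<in>P. b p * q p) \<le> g (\<Sum>p\<in>P. b p *\<^sub>R p)"
proof (rule ereal_le_real)
  fix r assume "g (\<Sum>p\<in>P. b p *\<^sub>R p) \<le> ereal r"
  then have r: "g (\<Sum>p\<in>P. b p *\<^sub>R p) \<le> ereal r" .
  define B where "B = (\<Sum>p\<in>P. b p * q p)"
  define C where "C = (\<Sum>p\<in>P. \<bar>a p - q p\<bar>)"
  have key: "(1 - \<delta>) * (B - r) \<le> \<delta> * C" if \<delta>: "0 < \<delta>" "\<delta> < 1" for \<delta>
  proof -
    obtain s where s: "s \<in> rational_weights P" "(\<Sum>p\<in>P. s p) = 1" "\<And>p. p \<in> P \<Longrightarrow> (1 - \<delta>) * b p \<le> s p"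
      using rational_weights_dense[OF P b, of \<delta>] \<delta> by (metis less_imp_le)
    define c where "c p = (s p - (1 - \<delta>) * b p) / \<delta>" for p
    have c: "\<And>p. p \<in> P \<Longrightarrow> 0 \<le> c p" using s(3) \<delta> by (simp add: c_def)
    have csum: "(\<Sum>p\<in>P. c p) = 1"
      using \<delta> s(2) b by (simp add: c_def sum_divide_distrib[symmetric] sum_subtractf sum_distrib_left[symmetric])
    have c1: "c p \<le> 1" if "p \<in> P" for p
      using member_le_sum[OF that, of c] c P csum by simp
    have s_eq: "s p = (1 - \<delta>) * b p + \<delta> * c p" for p using \<delta> by (simp add: c_def)
    have gc: "g (\<Sum>p\<in>P. c p *\<^sub>R p) \<le> ereal (\<Sum>p\<in>P. c p * a p)"
      by (rule econvex_combination[OF g P(1) c csum gP])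
    have "ereal (\<Sum>p\<in>P. s p * q p) \<le> g (\<Sum>p\<in>P. s p *\<^sub>R p)" by (rule le[OF s(1,2)])
    also have "(\<Sum>p\<in>P. s p *\<^sub>R p) = (1 - \<delta>) *\<^sub>R (\<Sum>p\<in>P. b p *\<^sub>R p) + \<delta> *\<^sub>R (\<Sum>p\<in>P. c p *\<^sub>R p)"
      unfolding s_eq by (rule combination_affine)
    also have "g \<dots> \<le> ereal ((1 - \<delta>) * r + \<delta> * (\<Sum>p\<in>P. c p * a p))"
      by (rule econvexD[OF g _ _ _ r gc]) (use \<delta> in auto)
    finally have "(\<Sum>p\<in>P. s p * q p) \<le> (1 - \<delta>) * r + \<delta> * (\<Sum>p\<in>P. c p * a p)" by simp
    moreover have "(\<Sum>p\<in>P. s p * q p) = (1 - \<delta>) * B + \<delta> * (\<Sum>p\<in>P. c p * q p)"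
      unfolding s_eq B_def by (simp add: distrib_right sum.distrib sum_distrib_left mult.assoc)
    ultimately have "(1 - \<delta>) * (B - r) \<le> \<delta> * (\<Sum>p\<in>P. c p * (a p - q p))"
      by (simp add: right_diff_distrib sum_subtractf)
    also have "\<dots> \<le> \<delta> * C"
    proof (rule mult_left_mono)
      show "(\<Sum>p\<in>P. c p * (a p - q p)) \<le> C" unfolding C_def
      proof (rule sum_mono)
        fix p assume p: "p \<in> P"
        have "c p * (a p - q p) \<le> c p * \<bar>a p - q p\<bar>" by (rule mult_left_mono) (use c p in auto)
        also have "\<dots> \<le> 1 * \<bar>a p - q p\<bar>" by (rule mult_right_mono) (use c1 p in auto)
        finally show "c p * (a p - q p) \<le> \<bar>a p - q p\<bar>" by simp
      qed
    qed (use \<delta> in simp)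
    finally show ?thesis .
  qed
  have lim0: "(\<lambda>n. 1 / real (Suc (Suc n))) \<longlonglongrightarrow> 0" by (intro LIMSEQ_Suc lim_1_over_n)
  have "(\<lambda>n. (1 - 1 / real (Suc (Suc n))) * (B - r)) \<longlonglongrightarrow> (1 - 0) * (B - r)"
    by (intro tendsto_mult tendsto_diff tendsto_const lim0)
  moreover have "(\<lambda>n. 1 / real (Suc (Suc n)) * C) \<longlonglongrightarrow> 0 * C"
    by (intro tendsto_mult tendsto_const lim0)
  ultimately have "(1 - 0) * (B - r) \<le> 0 * C"
    by (rule LIMSEQ_le) (intro exI allI impI key, simp_all)
  then show "ereal (\<Sum>p\<in>P. b p * q p) \<le> ereal r" by (simp add: B_def)
qed

lemma sum_unit_weight:
  assumes "finite P" "p \<in> P"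
  shows "(\<Sum>p'\<in>P. (if p' = p then 1 else 0 :: real)) = 1"
    "(\<Sum>p'\<in>P. (if p' = p then 1 else 0 :: real) * q p') = q p"
  using assms by (simp_all add: if_distrib[of "\<lambda>c. c * _"] cong: if_cong)

lemma sum_unit_weight_scaleR:
  fixes P :: "'x::real_vector set"
  assumes "finite P" "p \<in> P"
  shows "(\<Sum>p'\<in>P. (if p' = p then 1 else 0 :: real) *\<^sub>R p') = p"
proof -
  have "(\<Sum>p'\<in>P. (if p' = p then 1 else 0 :: real) *\<^sub>R p') = (\<Sum>p'\<in>P. if p' = p then p' else 0)"
    by (rule sum.cong) auto
  then show ?thesis using assms by simp
qed

lemma convex_normal_section:
  assumes "convex_normal_integrand M f"
  shows "(\<lambda>t. f t z) \<in> borel_measurable M"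
proof -
  have "(\<lambda>(t, x). f t x) \<in> borel_measurable (M \<Otimes>\<^sub>M borel)"
    using assms by (simp add: convex_normal_integrand_def)
  then have "(\<lambda>t. (\<lambda>(t, x). f t x) (t, z)) \<in> borel_measurable M"
    by (rule measurable_compose[rotated]) (rule measurable_Pair2', simp)
  then show ?thesis by simp
qed


section \<open>Affine functions below finitely many values of an integrand\<close>

text \<open>The points \<open>\<Sum>p\<in>P. b p *\<^sub>R p\<close> with weights of sum one fill the affine hull of \<open>P\<close>. Affine functions on it are
given by their values on \<open>P\<close>: the constants \<open>\<Phi> p\<close> for the given minorant of the integral functional, and
functions \<open>u p\<close> of \<open>t\<close> for the minorants of \<open>f t\<close> that are to be constructed.\<close>

locale weighted_integrand = sigma_finite_measure M for M :: "'t measure" +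
  fixes f :: "'t \<Rightarrow> 'x::locally_convex_space \<Rightarrow> ereal" and P :: "'x set" and \<Phi> :: "'x \<Rightarrow> real"
  assumes normal: "convex_normal_integrand M f"
    and nonnull: "emeasure M (space M) \<noteq> 0"
    and finP: "finite P" and P_ne: "P \<noteq> {}"
    and dom: "\<And>p. p \<in> P \<Longrightarrow> integral_functional M f p < \<infinity>"
    and minorant: "\<And>b. (\<Sum>p\<in>P. b p) = 1 \<Longrightarrow>
      ereal (\<Sum>p\<in>P. b p * \<Phi> p) \<le> integral_functional M f (\<Sum>p\<in>P. b p *\<^sub>R p)"
begin

abbreviation pt :: "('x \<Rightarrow> real) \<Rightarrow> 'x" where
  "pt b \<equiv> (\<Sum>p\<in>P. b p *\<^sub>R p)"

abbreviation unit_weight :: "'x \<Rightarrow> 'x \<Rightarrow> real" where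
  "unit_weight p \<equiv> (\<lambda>p'. if p' = p then 1 else 0)"

definition F :: "'x \<Rightarrow> 't \<Rightarrow> real" where
  "F p t = real_of_ereal (f t p)"

lemma f_meas[measurable]: "(\<lambda>t. f t z) \<in> borel_measurable M"
  by (rule convex_normal_section[OF normal])

lemma AE_Gamma0: "AE t in M. f t \<in> Gamma0"
  using normal by (simp add: convex_normal_integrand_def)

lemma AE_not_MInf: "AE t in M. f t z \<noteq> - \<infinity>"
  using AE_Gamma0 by eventually_elim (simp add: Gamma0_def)

lemma
  assumes b: "(\<Sum>p\<in>P. b p) = 1" and fin: "integral_functional M f (pt b) < \<infinity>"
  shows integrable_at_pt: "integrable M (\<lambda>t. real_of_ereal (f t (pt b)))"
    and AE_at_pt: "AE t in M. f t (pt b) = ereal (real_of_ereal (f t (pt b)))"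
    and integral_at_pt: "integral_functional M f (pt b) = ereal (\<integral>t. real_of_ereal (f t (pt b)) \<partial>M)"
proof -
  have "\<bar>upper_integral M (\<lambda>t. f t (pt b))\<bar> \<noteq> \<infinity>"
    using minorant[OF b] fin unfolding integral_functional_def by auto
  note * = upper_integral_finite[OF f_meas AE_not_MInf this]
  show "integrable M (\<lambda>t. real_of_ereal (f t (pt b)))" by (rule *(1))
  show "AE t in M. f t (pt b) = ereal (real_of_ereal (f t (pt b)))" by (rule *(2))
  show "integral_functional M f (pt b) = ereal (\<integral>t. real_of_ereal (f t (pt b)) \<partial>M)"
    unfolding integral_functional_def by (rule *(3))
qed

lemma
  assumes p: "p \<in> P"
  shows integrable_F: "integrable M (F p)" and AE_F: "AE t in M. f t p = ereal (F p t)"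
    and integral_F: "integral_functional M f p = ereal (\<integral>t. F p t \<partial>M)"
proof -
  have *: "integral_functional M f (pt (unit_weight p)) < \<infinity>"
    unfolding sum_unit_weight_scaleR[OF finP p] by (rule dom[OF p])
  note ** = integrable_at_pt[OF sum_unit_weight(1)[OF finP p] *]
    AE_at_pt[OF sum_unit_weight(1)[OF finP p] *] integral_at_pt[OF sum_unit_weight(1)[OF finP p] *]
  show "integrable M (F p)" "AE t in M. f t p = ereal (F p t)"
    "integral_functional M f p = ereal (\<integral>t. F p t \<partial>M)"
    using ** unfolding sum_unit_weight_scaleR[OF finP p] F_def[abs_def] by simp_all
qed

lemma AE_all_F: "AE t in M. \<forall>p\<in>P. f t p = ereal (F p t)"
  using AE_F finP by (simp add: AE_finite_all)

text \<open>The barycentre \<open>c\<close> of \<open>P\<close> lies strictly between \<open>b\<close> and some point \<open>w\<close> of the simplex. The value of \<open>f t\<close> at \<open>c\<close> is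
integrable and its value at \<open>w\<close> has an integrable upper bound, so convexity bounds \<open>f t\<close> from below at \<open>b\<close>.\<close>

lemma integrable_minorant_at:
  assumes b: "(\<Sum>p\<in>P. b p) = 1"
  obtains k where "integrable M k" "AE t in M. ereal (k t) \<le> f t (pt b)"
proof -
  define N where "N = real (card P)"
  have N: "N > 0" using finP P_ne by (simp add: N_def card_gt_0_iff)
  define S where "S = 1 + (\<Sum>p\<in>P. \<bar>b p\<bar>)"
  have S: "S > 0" by (simp add: S_def add_pos_nonneg sum_nonneg)
  \<comment> \<open>Small enough for all coordinates of \<open>w = (1 + s) c - s b\<close> to be nonnegative.\<close>
  define s where "s = 1 / (N * S)"
  have s: "s > 0" using N S by (simp add: s_def)
  define c where "c = (\<lambda>p :: 'x. 1 / N)"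
  define w where "w p = (1 + s) * c p - s * b p" for p
  have csum: "(\<Sum>p\<in>P. c p) = 1" using N by (simp add: c_def N_def)
  have cpos: "\<And>p. p \<in> P \<Longrightarrow> 0 \<le> c p" using N by (simp add: c_def)
  have wsum: "(\<Sum>p\<in>P. w p) = 1"
    unfolding w_def sum_subtractf sum_distrib_left[symmetric] csum b by simp
  have wpos: "0 \<le> w p" if p: "p \<in> P" for p
  proof -
    have "\<bar>b p\<bar> \<le> (\<Sum>p\<in>P. \<bar>b p\<bar>)" by (rule member_le_sum[OF p]) (use finP in auto)
    then have "b p \<le> S" by (simp add: S_def)
    then have "s * b p \<le> s * S" using s by (intro mult_left_mono) auto
    also have "s * S = 1 / N" using S N by (simp add: s_def)
    also have "\<dots> \<le> (1 + s) * c p" using s N by (simp add: c_def divide_right_mono)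
    finally show ?thesis by (simp add: w_def)
  qed
  define W where "W t = (\<Sum>p\<in>P. w p * F p t)" for t
  have W_int: "integrable M W" unfolding W_def[abs_def] by (intro Bochner_Integration.integrable_sum integrable_mult_right integrable_F)
  have comb: "AE t in M. f t (pt a) \<le> ereal (\<Sum>p\<in>P. a p * F p t)"
    if "\<And>p. p \<in> P \<Longrightarrow> 0 \<le> a p" "(\<Sum>p\<in>P. a p) = 1" for a
    using AE_Gamma0 AE_all_F
    by eventually_elim (rule econvex_combination[OF Gamma0_econvex finP that], simp_all)
  have comb_c: "AE t in M. f t (pt c) \<le> ereal (\<Sum>p\<in>P. c p * F p t)"
    and comb_w: "AE t in M. f t (pt w) \<le> ereal (\<Sum>p\<in>P. w p * F p t)"
    by (rule comb; use cpos csum wpos wsum in blast)+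
  have "integral_functional M f (pt c) \<le> ereal (\<integral>t. (\<Sum>p\<in>P. c p * F p t) \<partial>M)"
    unfolding integral_functional_def
    by (rule upper_integral_le) (intro Bochner_Integration.integrable_sum integrable_mult_right integrable_F, simp, rule comb_c)
  then have "integral_functional M f (pt c) < \<infinity>" by (rule le_less_trans) simp
  note C = integrable_at_pt[OF csum this] AE_at_pt[OF csum this]
  define G where "G t = real_of_ereal (f t (pt c))" for t
  define k where "k t = ((1 + s) * G t - W t) / s" for t
  have "integrable M k" unfolding k_def[abs_def] using C(1) W_int by (simp add: G_def[abs_def])
  moreover have "AE t in M. ereal (k t) \<le> f t (pt b)"
    using AE_Gamma0 C(2) comb_w
  proof eventually_elim
    case (elim t)
    have c_eq: "c p = 1 / (1 + s) * w p + s / (1 + s) * b p" for p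
    proof -
      have "1 / (1 + s) * w p + s / (1 + s) * b p = (w p + s * b p) / (1 + s)"
        by (simp add: add_divide_distrib)
      also have "w p + s * b p = (1 + s) * c p" by (simp add: w_def)
      finally show ?thesis using s by simp
    qed
    have "pt c = (1 / (1 + s)) *\<^sub>R pt w + (s / (1 + s)) *\<^sub>R pt b"
      by (subst c_eq) (rule combination_affine)
    then have pc: "f t (pt c) = f t ((1 / (1 + s)) *\<^sub>R pt w + (s / (1 + s)) *\<^sub>R pt b)" by simp
    show ?case
    proof (rule ereal_le_real)
      fix r assume r: "f t (pt b) \<le> ereal r"
      have "ereal (G t) \<le> ereal (1 / (1 + s) * W t + s / (1 + s) * r)"
      proof -
        have "ereal (G t) = f t (pt c)" using elim(2) by (simp add: G_def)
        also have "\<dots> \<le> ereal (1 / (1 + s) * W t + s / (1 + s) * r)"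
          unfolding pc
          by (rule econvexD[OF Gamma0_econvex[OF elim(1)] _ _ _ _ r])
            (use s elim(3) in \<open>auto simp: W_def add_divide_distrib[symmetric]\<close>)
        finally show ?thesis .
      qed
      then have "G t \<le> (W t + s * r) / (1 + s)" by (simp add: add_divide_distrib)
      then have "(1 + s) * G t \<le> W t + s * r" using s by (simp add: pos_le_divide_eq mult.commute)
      then have "(1 + s) * G t - W t \<le> r * s" by (simp add: mult.commute)
      then show "ereal (k t) \<le> ereal r" using s by (simp add: k_def pos_divide_le_eq)
    qed
  qed
  ultimately show thesis by (rule that)
qed

text \<open>The set \<open>Z\<close> of weights will be finite: a constant vector can then be made rational without
violating the inequalities, and the set of \<open>t\<close> at which it satisfies them is measurable.\<close>

definition admissible :: "('x \<Rightarrow> real) set \<Rightarrow> ('x \<Rightarrow> 't \<Rightarrow> real) \<Rightarrow> bool" where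
  "admissible Z u \<longleftrightarrow> (\<forall>p\<in>P. integrable M (u p)) \<and>
     (\<forall>b\<in>Z. AE t in M. ereal (\<Sum>p\<in>P. b p * u p t) \<le> f t (pt b))"

lemma admissible_mono: "admissible Z u \<Longrightarrow> Z' \<subseteq> Z \<Longrightarrow> admissible Z' u"
  by (auto simp: admissible_def)

lemma admissible_sum_integrable:
  "admissible Z u \<Longrightarrow> integrable M (\<lambda>t. \<Sum>p\<in>P. b p * u p t)"
  by (auto simp: admissible_def)

lemma admissible_integral_sum:
  "admissible Z u \<Longrightarrow> (\<integral>t. (\<Sum>p\<in>P. b p * u p t) \<partial>M) = (\<Sum>p\<in>P. b p * (\<integral>t. u p t \<partial>M))"
  by (auto simp: admissible_def)

lemma admissible_convex:
  assumes u: "admissible Z u" "admissible Z v" and c: "0 \<le> c" "c \<le> 1"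
  shows "admissible Z (\<lambda>p t. (1 - c) * u p t + c * v p t)"
  unfolding admissible_def
proof (intro conjI ballI)
  fix p assume "p \<in> P"
  then show "integrable M (\<lambda>t. (1 - c) * u p t + c * v p t)" using u by (auto simp: admissible_def)
next
  fix b assume b: "b \<in> Z"
  have "AE t in M. ereal (\<Sum>p\<in>P. b p * u p t) \<le> f t (pt b)" "AE t in M. ereal (\<Sum>p\<in>P. b p * v p t) \<le> f t (pt b)"
    using u b by (auto simp: admissible_def)
  then show "AE t in M. ereal (\<Sum>p\<in>P. b p * ((1 - c) * u p t + c * v p t)) \<le> f t (pt b)"
  proof eventually_elim
    case (elim t)
    show ?case
    proof (rule ereal_le_real)
      fix r assume r: "f t (pt b) \<le> ereal r"
      have 1: "(\<Sum>p\<in>P. b p * u p t) \<le> r" using order_trans[OF elim(1) r] by simp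
      have 2: "(\<Sum>p\<in>P. b p * v p t) \<le> r" using order_trans[OF elim(2) r] by simp
      have "(\<Sum>p\<in>P. b p * ((1 - c) * u p t + c * v p t))
          = (1 - c) * (\<Sum>p\<in>P. b p * u p t) + c * (\<Sum>p\<in>P. b p * v p t)"
        unfolding sum_distrib_left sum.distrib[symmetric]
        by (rule sum.cong) (auto simp: algebra_simps)
      also have "\<dots> \<le> (1 - c) * r + c * r" using 1 2 c by (intro add_mono mult_left_mono) auto
      finally show "ereal (\<Sum>p\<in>P. b p * ((1 - c) * u p t + c * v p t)) \<le> ereal r"
        by (simp add: algebra_simps)
    qed
  qed
qed

lemma admissible_decrease:
  assumes u: "admissible Z u" and Z: "\<And>b. b \<in> Z \<Longrightarrow> (\<Sum>p\<in>P. b p) = 1"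
    and k: "integrable M k" "\<And>t. 0 \<le> k t"
  shows "admissible Z (\<lambda>p t. u p t - k t)"
  unfolding admissible_def
proof (intro conjI ballI)
  fix p assume "p \<in> P"
  then show "integrable M (\<lambda>t. u p t - k t)" using u k by (auto simp: admissible_def)
next
  fix b assume b: "b \<in> Z"
  have "AE t in M. ereal (\<Sum>p\<in>P. b p * u p t) \<le> f t (pt b)" using u b by (auto simp: admissible_def)
  then show "AE t in M. ereal (\<Sum>p\<in>P. b p * (u p t - k t)) \<le> f t (pt b)"
  proof eventually_elim
    case (elim t)
    have "(\<Sum>p\<in>P. b p * (u p t - k t)) = (\<Sum>p\<in>P. b p * u p t) - (\<Sum>p\<in>P. b p) * k t"
      by (simp add: right_diff_distrib sum_subtractf sum_distrib_right)
    also have "\<dots> \<le> (\<Sum>p\<in>P. b p * u p t)" using Z[OF b] k(2)[of t] by simp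
    finally have "ereal (\<Sum>p\<in>P. b p * (u p t - k t)) \<le> ereal (\<Sum>p\<in>P. b p * u p t)" by simp
    then show ?case using elim by (rule order_trans)
  qed
qed

lemma admissible_exists:
  assumes Z: "finite Z" "\<And>b. b \<in> Z \<Longrightarrow> (\<Sum>p\<in>P. b p) = 1"
  obtains u where "admissible Z u"
proof -
  have "\<exists>k. integrable M k \<and> (\<forall>b\<in>Z. AE t in M. ereal (k t) \<le> f t (pt b))"
    using Z
  proof (induction Z rule: finite_induct)
    case empty
    then show ?case by (intro exI[of _ "\<lambda>t. 0"]) simp
  next
    case (insert b Z)
    then obtain k where k: "integrable M k" "\<forall>b\<in>Z. AE t in M. ereal (k t) \<le> f t (pt b)" by auto
    have "(\<Sum>p\<in>P. b p) = 1" using insert.prems by simp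
    then obtain l where l: "integrable M l" "AE t in M. ereal (l t) \<le> f t (pt b)"
      by (rule integrable_minorant_at)
    have "integrable M (\<lambda>t. min (k t) (l t))" using k(1) l(1) by (rule integrable_min)
    moreover have "AE t in M. ereal (min (k t) (l t)) \<le> f t (pt b')" if "b' \<in> insert b Z" for b'
    proof (cases "b' = b")
      case True
      show ?thesis unfolding True using l(2)
        by eventually_elim (rule order_trans[rotated], auto)
    next
      case False
      then have "AE t in M. ereal (k t) \<le> f t (pt b')" using that k(2) by auto
      then show ?thesis by eventually_elim (rule order_trans[rotated], auto)
    qed
    ultimately show ?case by blast
  qed
  then obtain k where k: "integrable M k" "\<forall>b\<in>Z. AE t in M. ereal (k t) \<le> f t (pt b)" by blast
  have "admissible Z (\<lambda>p. k)"
    using k Z(2) by (simp add: admissible_def sum_distrib_right[symmetric])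
  then show thesis by (rule that)
qed

text \<open>Wherever the constant vector \<open>q\<close> is admissible at \<open>t \<in> T\<close> and has a larger value at \<open>y\<close>, it replaces \<open>u\<close>.
Finite measure of \<open>T\<close> keeps the result integrable.\<close>

lemma switch_admissible:
  assumes u: "admissible Z u" and Z: "finite Z"
    and T: "T \<in> sets M" "emeasure M T < \<infinity>"
  obtains u' where "admissible Z u'"
    "\<And>t. (\<Sum>p\<in>P. y p * u p t) \<le> (\<Sum>p\<in>P. y p * u' p t)"
    "\<And>t. t \<in> T \<Longrightarrow> (\<forall>b\<in>Z. ereal (\<Sum>p\<in>P. b p * q p) \<le> f t (pt b)) \<Longrightarrow>
      (\<Sum>p\<in>P. y p * q p) \<le> (\<Sum>p\<in>P. y p * u' p t)"
proof -
  have int: "\<And>p. p \<in> P \<Longrightarrow> integrable M (u p)" using u by (simp add: admissible_def)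
  have [measurable]: "\<And>p. p \<in> P \<Longrightarrow> u p \<in> borel_measurable M" using int by simp
  define A where "A = {t \<in> space M. t \<in> T \<and> (\<forall>b\<in>Z. ereal (\<Sum>p\<in>P. b p * q p) \<le> f t (pt b)) \<and>
      (\<Sum>p\<in>P. y p * u p t) < (\<Sum>p\<in>P. y p * q p)}"
  have A: "A \<in> sets M" unfolding A_def using T(1) Z by measurable
  have "A \<subseteq> T" by (auto simp: A_def)
  then have Afin: "emeasure M A < \<infinity>" using emeasure_mono[OF _ T(1), of A] T(2) by (auto intro: le_less_trans)
  define u' where "u' p t = (if t \<in> A then q p else u p t)" for p t
  have "admissible Z u'"
    unfolding admissible_def
  proof (intro conjI ballI)
    fix p assume p: "p \<in> P"
    have "integrable M (\<lambda>t. q p * indicator A t + (u p t - u p t * indicator A t))"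
      using A Afin int[OF p]
      by (intro Bochner_Integration.integrable_add Bochner_Integration.integrable_diff
          integrable_real_mult_indicator integrable_mult_right integrable_real_indicator)
    moreover have "u' p = (\<lambda>t. q p * indicator A t + (u p t - u p t * indicator A t))"
      by (auto simp: u'_def fun_eq_iff)
    ultimately show "integrable M (u' p)" by simp
  next
    fix b assume b: "b \<in> Z"
    have "AE t in M. ereal (\<Sum>p\<in>P. b p * u p t) \<le> f t (pt b)" using u b by (auto simp: admissible_def)
    then show "AE t in M. ereal (\<Sum>p\<in>P. b p * u' p t) \<le> f t (pt b)"
    proof eventually_elim
      case (elim t)
      show ?case
      proof (cases "t \<in> A")
        case True
        then show ?thesis using b by (simp add: u'_def) (simp add: A_def)
      next
        case False
        then show ?thesis using elim by (simp add: u'_def)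
      qed
    qed
  qed
  moreover have "(\<Sum>p\<in>P. y p * u p t) \<le> (\<Sum>p\<in>P. y p * u' p t)" for t
  proof (cases "t \<in> A")
    case True
    then have "(\<Sum>p\<in>P. y p * u p t) < (\<Sum>p\<in>P. y p * q p)" by (simp add: A_def)
    then show ?thesis using True by (simp add: u'_def)
  qed (simp add: u'_def)
  moreover have "(\<Sum>p\<in>P. y p * q p) \<le> (\<Sum>p\<in>P. y p * u' p t)"
    if "t \<in> T" "\<forall>b\<in>Z. ereal (\<Sum>p\<in>P. b p * q p) \<le> f t (pt b)" for t
  proof (cases "t \<in> A")
    case True
    then show ?thesis by (simp add: u'_def)
  next
    case False
    have "t \<in> space M" using that(1) sets.sets_into_space[OF T(1)] by blast
    then have "\<not> (\<Sum>p\<in>P. y p * u p t) < (\<Sum>p\<in>P. y p * q p)" using False that by (simp add: A_def)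
    then show ?thesis using False by (simp add: u'_def)
  qed
  ultimately show thesis by (rule that)
qed

end


section \<open>Approximate solutions by separation\<close>

lemma (in sigma_finite_measure) positive_integral_weight:
  assumes nonnull: "emeasure M (space M) \<noteq> 0"
  obtains \<rho> :: "'a \<Rightarrow> real" where "integrable M \<rho>" "\<And>t. 0 < \<rho> t" "0 < (\<integral>t. \<rho> t \<partial>M)"
proof -
  obtain \<rho> :: "'a \<Rightarrow> real" where \<rho>: "\<rho> \<in> borel_measurable M" "\<And>t. 0 < \<rho> t" "integrable M \<rho>"
    by (rule obtain_positive_integrable_function) (rule that)
  have "(\<integral>t. \<rho> t \<partial>M) \<noteq> 0"
  proof
    assume "(\<integral>t. \<rho> t \<partial>M) = 0"
    then have "AE t in M. \<rho> t = 0"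
      using integral_nonneg_eq_0_iff_AE[OF \<rho>(3)] \<rho>(2) by (simp add: less_imp_le)
    then have "AE t in M. False" by eventually_elim (use \<rho>(2) in \<open>metis less_irrefl\<close>)
    then show False using nonnull by (simp add: AE_iff_measurable[OF sets.top])
  qed
  moreover have "0 \<le> (\<integral>t. \<rho> t \<partial>M)" by (rule integral_nonneg_AE) (use \<rho>(2) in \<open>simp add: less_imp_le\<close>)
  ultimately show thesis using that[OF \<rho>(3,2)] by simp
qed

context weighted_integrand begin

text \<open>An affine minorant of \<open>f t\<close> is lowered by a constant and then made rational; the finitely many inequalities
and the strict inequality at \<open>y\<close> survive.\<close>

lemma rational_minorant:
  assumes g: "f t \<in> Gamma0" and gP: "\<And>p. p \<in> P \<Longrightarrow> f t p < \<infinity>"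
    and Z: "finite Z" "\<And>b. b \<in> Z \<Longrightarrow> (\<Sum>p\<in>P. b p) = 1"
    and y: "(\<Sum>p\<in>P. y p) = 1" and r: "ereal r < f t (pt y)"
  obtains q where "q \<in> rational_weights P" "r < (\<Sum>p\<in>P. y p * q p)"
    "\<forall>b\<in>Z. ereal (\<Sum>p\<in>P. b p * q p) \<le> f t (pt b)"
proof -
  obtain q where q: "r < (\<Sum>p\<in>P. y p * q p)"
    "\<And>b. (\<Sum>p\<in>P. b p) = 1 \<Longrightarrow> ereal (\<Sum>p\<in>P. b p * q p) \<le> f t (pt b)"
    by (rule affine_minorant[OF g finP P_ne gP y r]) (assumption, rule that)
  define e where "e = ((\<Sum>p\<in>P. y p * q p) - r) / 3"
  have e: "e > 0" using q(1) by (simp add: e_def)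
  define K where "K = 1 + (\<Sum>b\<in>insert y Z. \<Sum>p\<in>P. \<bar>b p\<bar>)"
  have K: "K > 0" unfolding K_def by (intro add_pos_nonneg sum_nonneg) auto
  have normK: "(\<Sum>p\<in>P. \<bar>b p\<bar>) \<le> K" if "b \<in> insert y Z" for b
  proof -
    have "(\<Sum>p\<in>P. \<bar>b p\<bar>) \<le> (\<Sum>b\<in>insert y Z. \<Sum>p\<in>P. \<bar>b p\<bar>)"
      by (rule member_le_sum[OF that]) (use Z in \<open>auto intro: sum_nonneg\<close>)
    then show ?thesis by (simp add: K_def)
  qed
  obtain q' where q': "q' \<in> rational_weights P" "\<And>p. p \<in> P \<Longrightarrow> q p - e \<le> q' p"
    "\<And>p. p \<in> P \<Longrightarrow> q' p \<le> (q p - e) + e / K"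
    by (rule rational_weights_near[of "e / K" P "\<lambda>p. q p - e"]) (use e K in simp, rule that)
  have near: "\<bar>(\<Sum>p\<in>P. b p * q' p) - ((\<Sum>p\<in>P. b p * q p) - e)\<bar> \<le> e"
    if b: "b \<in> insert y Z" "(\<Sum>p\<in>P. b p) = 1" for b
  proof -
    have "(\<Sum>p\<in>P. b p * q' p) - ((\<Sum>p\<in>P. b p * q p) - (\<Sum>p\<in>P. b p) * e) = (\<Sum>p\<in>P. b p * (q' p - (q p - e)))"
      unfolding sum_distrib_right sum_subtractf[symmetric] by (rule sum.cong) (auto simp: algebra_simps)
    then have "\<bar>(\<Sum>p\<in>P. b p * q' p) - ((\<Sum>p\<in>P. b p * q p) - e)\<bar> = \<bar>\<Sum>p\<in>P. b p * (q' p - (q p - e))\<bar>"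
      by (simp add: b(2))
    also have "\<dots> \<le> (\<Sum>p\<in>P. \<bar>b p * (q' p - (q p - e))\<bar>)" by (rule sum_abs)
    also have "\<dots> \<le> (\<Sum>p\<in>P. \<bar>b p\<bar> * (e / K))"
    proof (rule sum_mono)
      fix p assume p: "p \<in> P"
      have "\<bar>q' p - (q p - e)\<bar> \<le> e / K" using q'(2,3)[OF p] by simp
      then show "\<bar>b p * (q' p - (q p - e))\<bar> \<le> \<bar>b p\<bar> * (e / K)"
        unfolding abs_mult by (rule mult_left_mono) simp
    qed
    also have "\<dots> = (\<Sum>p\<in>P. \<bar>b p\<bar>) * (e / K)" by (rule sum_distrib_right[symmetric])
    also have "\<dots> \<le> K * (e / K)" by (rule mult_right_mono[OF normK[OF b(1)]]) (use e K in simp)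
    finally show ?thesis using K by simp
  qed
  have "(\<Sum>p\<in>P. y p * q p) - r = 3 * e" by (simp add: e_def)
  moreover have "(\<Sum>p\<in>P. y p * q p) - e - e \<le> (\<Sum>p\<in>P. y p * q' p)" using near[of y] y by simp
  ultimately have "r < (\<Sum>p\<in>P. y p * q' p)" using e by linarith
  moreover have "\<forall>b\<in>Z. ereal (\<Sum>p\<in>P. b p * q' p) \<le> f t (pt b)"
  proof
    fix b assume b: "b \<in> Z"
    have "(\<Sum>p\<in>P. b p * q' p) \<le> (\<Sum>p\<in>P. b p * q p)" using near[of b] b Z(2)[OF b] by simp
    then have "ereal (\<Sum>p\<in>P. b p * q' p) \<le> ereal (\<Sum>p\<in>P. b p * q p)" by simp
    then show "ereal (\<Sum>p\<in>P. b p * q' p) \<le> f t (pt b)" using q(2)[OF Z(2)[OF b]] by (rule order_trans)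
  qed
  ultimately show thesis using q'(1) that by blast
qed

text \<open>Run through all rational vectors and all sets of a \<open>\<sigma>\<close>-finite exhaustion, switching whenever this raises the
value at \<open>y\<close>. The values at \<open>y\<close> increase, have integrals at most \<open>c\<close>, and by the preceding lemma their
limit is at least \<open>f t (y)\<close>.\<close>

lemma integral_functional_le_of_admissible:
  assumes Z: "finite Z" "\<And>b. b \<in> Z \<Longrightarrow> (\<Sum>p\<in>P. b p) = 1"
    and y: "(\<Sum>p\<in>P. y p) = 1"
    and le: "\<And>u. admissible Z u \<Longrightarrow> (\<Sum>p\<in>P. y p * (\<integral>t. u p t \<partial>M)) \<le> c"
  shows "integral_functional M f (pt y) \<le> ereal c"
proof -
  obtain T :: "nat \<Rightarrow> 't set" where T: "range T \<subseteq> sets M" "(\<Union>i. T i) = space M"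
    "\<And>i. emeasure M (T i) \<noteq> \<infinity>"
    by (rule sigma_finite) (rule that)
  define q where "q = from_nat_into (rational_weights P)"
  have ne: "rational_weights P \<noteq> {}" unfolding rational_weights_def by (auto intro!: exI[of _ "\<lambda>p. 0"])
  have q_surj: "\<exists>j. q j = w" if "w \<in> rational_weights P" for w
    unfolding q_def using from_nat_into_surj[OF countable_rational_weights[OF finP] that] by blast
  define H where "H u t = (\<Sum>p\<in>P. y p * u p t)" for u :: "'x \<Rightarrow> 't \<Rightarrow> real" and t
  \<comment> \<open>Stage \<open>n\<close> codes a pair: the index of a rational vector and the index of a set of finite measure.\<close>
  define step where "step n u u' \<longleftrightarrow> (\<forall>t. H u t \<le> H u' t) \<and>
    (\<forall>t\<in>T (snd (prod_decode n)). (\<forall>b\<in>Z. ereal (\<Sum>p\<in>P. b p * q (fst (prod_decode n)) p) \<le> f t (pt b)) \<longrightarrow>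
      (\<Sum>p\<in>P. y p * q (fst (prod_decode n)) p) \<le> H u' t)" for n and u u' :: "'x \<Rightarrow> 't \<Rightarrow> real"
  have "\<exists>u. \<forall>n. admissible Z (u n) \<and> step n (u n) (u (Suc n))"
  proof (rule dependent_nat_choice)
    show "\<exists>u. admissible Z u" by (rule admissible_exists[OF Z]) (assumption, blast)
  next
    fix u n assume u: "admissible Z u"
    define i where "i = prod_decode n"
    have "T (snd i) \<in> sets M" "emeasure M (T (snd i)) < \<infinity>"
      using T(1,3) by (auto simp: less_top)
    then obtain u' where "admissible Z u'"
      "\<And>t. (\<Sum>p\<in>P. y p * u p t) \<le> (\<Sum>p\<in>P. y p * u' p t)"
      "\<And>t. t \<in> T (snd i) \<Longrightarrow> (\<forall>b\<in>Z. ereal (\<Sum>p\<in>P. b p * q (fst i) p) \<le> f t (pt b)) \<Longrightarrow>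
        (\<Sum>p\<in>P. y p * q (fst i) p) \<le> (\<Sum>p\<in>P. y p * u' p t)"
      by (rule switch_admissible[OF u Z(1)]) (rule that)
    then show "\<exists>u'. admissible Z u' \<and> step n u u'" unfolding step_def H_def i_def by blast
  qed
  then obtain u where adm: "\<And>n. admissible Z (u n)" and st: "\<And>n. step n (u n) (u (Suc n))" by blast
  have H_int: "integrable M (H (u n))" for n
    unfolding H_def[abs_def] by (rule admissible_sum_integrable[OF adm])
  have H_mono: "AE t in M. H (u n) t \<le> H (u (Suc n)) t" for n using st[of n] by (simp add: step_def)
  have H_bd: "(\<integral>t. H (u n) t \<partial>M) \<le> c" for n
    unfolding H_def admissible_integral_sum[OF adm] by (rule le[OF adm])
  obtain U where U: "integrable M U" "AE t in M. \<forall>n. H (u n) t \<le> U t" "(\<integral>t. U t \<partial>M) \<le> c"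
    by (rule beppo_levi[of M "\<lambda>n. H (u n)" c, OF H_int H_mono H_bd]) (rule that)
  have "AE t in M. f t (pt y) \<le> ereal (U t)"
    using AE_space AE_Gamma0 AE_all_F U(2)
  proof eventually_elim
    case (elim t)
    show ?case
    proof (rule ccontr)
      assume "\<not> f t (pt y) \<le> ereal (U t)"
      then have r: "ereal (U t) < f t (pt y)" by simp
      have fin: "f t p < \<infinity>" if "p \<in> P" for p using elim(3) that by simp
      obtain w where w: "w \<in> rational_weights P" "U t < (\<Sum>p\<in>P. y p * w p)"
        "\<forall>b\<in>Z. ereal (\<Sum>p\<in>P. b p * w p) \<le> f t (pt b)"
        by (rule rational_minorant[OF elim(2) fin Z y r]) (assumption, assumption, rule that)
      obtain j where j: "q j = w" using q_surj[OF w(1)] by blast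
      obtain m where m: "t \<in> T m" using elim(1) T(2) by blast
      have "(\<Sum>p\<in>P. y p * w p) \<le> H (u (Suc (prod_encode (j, m)))) t"
        using st[of "prod_encode (j, m)"] m w(3) by (simp add: step_def j)
      also have "\<dots> \<le> U t" using elim(4) by blast
      finally show False using w(2) by simp
    qed
  qed
  then have "integral_functional M f (pt y) \<le> ereal (\<integral>t. U t \<partial>M)"
    unfolding integral_functional_def by (rule upper_integral_le[OF U(1)])
  then show ?thesis using U(3) by (auto intro: order_trans)
qed

text \<open>If the vectors of integrals stayed away from \<open>\<Phi>\<close>, a vector \<open>w\<close> would separate them. Since admissible
families may be lowered by any nonnegative integrable function, \<open>w\<close> has nonpositive sum; after a small perturbation and
normalisation, \<open>- w\<close> is a system of weights of a point at which the preceding lemma contradicts that \<open>\<Phi>\<close>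
minorises the integral functional.\<close>

lemma admissible_approximation:
  assumes Z: "finite Z" "\<And>b. b \<in> Z \<Longrightarrow> (\<Sum>p\<in>P. b p) = 1" "\<And>p. p \<in> P \<Longrightarrow> unit_weight p \<in> Z"
    and \<delta>: "\<delta> > 0"
  shows "\<exists>u. admissible Z u \<and> (\<forall>p\<in>P. \<bar>(\<integral>t. u p t \<partial>M) - \<Phi> p\<bar> \<le> \<delta>)"
proof (rule ccontr)
  assume neg: "\<not> ?thesis"
  define gap where "gap u p = (if p \<in> P then (\<integral>t. u p t \<partial>M) - \<Phi> p else 0)" for u :: "'x \<Rightarrow> 't \<Rightarrow> real" and p
  define S where "S = gap ` {u. admissible Z u}"
  have int: "integrable M (u p)" if "admissible Z u" "p \<in> P" for u p using that by (simp add: admissible_def)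
  obtain u0 where u0: "admissible Z u0" by (rule admissible_exists[OF Z(1,2)])
  have ne: "S \<noteq> {}" using u0 by (auto simp: S_def)
  have far: "\<delta>\<^sup>2 \<le> (\<Sum>p\<in>P. (s p)\<^sup>2)" if s: "s \<in> S" for s
  proof (rule ccontr)
    assume small: "\<not> \<delta>\<^sup>2 \<le> (\<Sum>p\<in>P. (s p)\<^sup>2)"
    obtain u where u: "admissible Z u" "s = gap u" using s by (auto simp: S_def)
    have "\<bar>(\<integral>t. u p t \<partial>M) - \<Phi> p\<bar> \<le> \<delta>" if p: "p \<in> P" for p
    proof -
      have "(gap u p)\<^sup>2 \<le> (\<Sum>p\<in>P. (s p)\<^sup>2)"
        unfolding u(2) by (rule member_le_sum[OF p]) (use finP in auto)
      then have "(gap u p)\<^sup>2 \<le> \<delta>\<^sup>2" using small by simp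
      then have "\<bar>gap u p\<bar> \<le> \<delta>" using abs_le_square_iff[of "gap u p" \<delta>] \<delta> by simp
      then show ?thesis using p by (simp add: gap_def)
    qed
    then show False using neg u(1) by blast
  qed
  have conv: "(\<lambda>i. (1 - c) * s i + c * t i) \<in> S" if st: "s \<in> S" "t \<in> S" and c: "0 \<le> c" "c \<le> 1" for s t c
  proof -
    obtain u v where u: "admissible Z u" "s = gap u" and v: "admissible Z v" "t = gap v"
      using st by (auto simp: S_def)
    define h where "h = (\<lambda>p t. (1 - c) * u p t + c * v p t)"
    have h: "admissible Z h" unfolding h_def by (rule admissible_convex[OF u(1) v(1) c])
    have "(1 - c) * s p + c * t p = gap h p" for p
    proof (cases "p \<in> P")
      case True
      have "(\<integral>t. h p t \<partial>M) = (1 - c) * (\<integral>t. u p t \<partial>M) + c * (\<integral>t. v p t \<partial>M)"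
        unfolding h_def using int[OF u(1) True] int[OF v(1) True] by simp
      then show ?thesis using True by (simp add: u(2) v(2) gap_def algebra_simps)
    qed (simp add: u(2) v(2) gap_def)
    then have "(\<lambda>i. (1 - c) * s i + c * t i) = gap h" by (rule ext)
    then show ?thesis using h unfolding S_def by blast
  qed
  obtain w where w: "\<And>s. s \<in> S \<Longrightarrow> \<delta>\<^sup>2 \<le> (\<Sum>p\<in>P. w p * s p)"
    by (rule min_norm_separation[OF finP ne conv far]) (assumption+, rule that)
  have sep: "\<delta>\<^sup>2 \<le> (\<Sum>p\<in>P. w p * (\<integral>t. u p t \<partial>M)) - (\<Sum>p\<in>P. w p * \<Phi> p)" if u: "admissible Z u" for u
  proof -
    have "\<delta>\<^sup>2 \<le> (\<Sum>p\<in>P. w p * gap u p)" by (rule w) (use u in \<open>auto simp: S_def\<close>)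
    also have "\<dots> = (\<Sum>p\<in>P. w p * (\<integral>t. u p t \<partial>M) - w p * \<Phi> p)"
      by (rule sum.cong) (auto simp: gap_def right_diff_distrib)
    finally show ?thesis by (simp add: sum_subtractf)
  qed
  define W where "W = (\<Sum>p\<in>P. w p)"
  have d2: "\<delta>\<^sup>2 > 0" using \<delta> by simp
  \<comment> \<open>Otherwise lowering \<open>u0\<close> by multiples of a positive function violates the separation.\<close>
  have W: "W \<le> 0"
  proof (rule ccontr)
    assume "\<not> W \<le> 0"
    obtain \<rho> :: "'t \<Rightarrow> real" where \<rho>: "integrable M \<rho>" "\<And>t. 0 < \<rho> t" "0 < (\<integral>t. \<rho> t \<partial>M)"
      by (rule positive_integral_weight[OF nonnull]) (rule that)
    define A where "A = (\<Sum>p\<in>P. w p * (\<integral>t. u0 p t \<partial>M)) - (\<Sum>p\<in>P. w p * \<Phi> p)"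
    define B where "B = W * (\<integral>t. \<rho> t \<partial>M)"
    have B: "B > 0" using \<open>\<not> W \<le> 0\<close> \<rho>(3) by (simp add: B_def)
    obtain n where n: "A / B < real n" using reals_Archimedean2 by blast
    have adm: "admissible Z (\<lambda>p t. u0 p t - real n * \<rho> t)"
      by (rule admissible_decrease[OF u0 Z(2)]) (use \<rho> in \<open>auto simp: less_imp_le\<close>)
    have "(\<Sum>p\<in>P. w p * (\<integral>t. u0 p t - real n * \<rho> t \<partial>M))
        = (\<Sum>p\<in>P. w p * (\<integral>t. u0 p t \<partial>M) - w p * (real n * (\<integral>t. \<rho> t \<partial>M)))"
      by (rule sum.cong) (use int[OF u0] \<rho>(1) in \<open>auto simp: right_diff_distrib\<close>)
    also have "\<dots> = (\<Sum>p\<in>P. w p * (\<integral>t. u0 p t \<partial>M)) - real n * B"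
      unfolding sum_subtractf sum_distrib_right[symmetric] W_def[symmetric] by (simp add: B_def)
    finally have "\<delta>\<^sup>2 \<le> A - real n * B" using sep[OF adm] by (simp add: A_def)
    moreover have "A < real n * B" using n B by (simp add: pos_divide_less_eq)
    ultimately show False using d2 by linarith
  qed
  obtain p0 where p0: "p0 \<in> P" using P_ne by blast
  define G where "G = (\<integral>t. F p0 t \<partial>M) - \<Phi> p0"
  \<comment> \<open>The perturbation \<open>\<eta>\<close> in direction \<open>p0\<close> makes the sum of the weights positive and costs at most half of the gap.\<close>
  define \<eta> where "\<eta> = \<delta>\<^sup>2 / (2 * (1 + \<bar>G\<bar>))"
  have \<eta>: "\<eta> > 0" using d2 by (simp add: \<eta>_def)
  define \<sigma> where "\<sigma> = \<eta> - W"
  have \<sigma>: "\<sigma> > 0" using \<eta> W by (simp add: \<sigma>_def)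
  define y where "y p = (\<eta> * unit_weight p0 p - w p) / \<sigma>" for p
  have y_sum: "(\<Sum>p\<in>P. y p * h p) = (\<eta> * h p0 - (\<Sum>p\<in>P. w p * h p)) / \<sigma>" for h
  proof -
    have "(\<Sum>p\<in>P. y p * h p) = (\<Sum>p\<in>P. (\<eta> * (unit_weight p0 p * h p) - w p * h p) / \<sigma>)"
      by (rule sum.cong) (auto simp: y_def left_diff_distrib)
    also have "\<dots> = (\<eta> * (\<Sum>p\<in>P. unit_weight p0 p * h p) - (\<Sum>p\<in>P. w p * h p)) / \<sigma>"
      unfolding sum_divide_distrib[symmetric] sum_subtractf sum_distrib_left[symmetric] by (rule refl)
    finally show ?thesis unfolding sum_unit_weight(2)[OF finP p0] .
  qed
  have y1: "(\<Sum>p\<in>P. y p) = 1" using y_sum[of "\<lambda>_. 1"] \<sigma> by (simp add: W_def[symmetric] \<sigma>_def)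
  define c where "c = (\<eta> * (\<integral>t. F p0 t \<partial>M) - \<delta>\<^sup>2 - (\<Sum>p\<in>P. w p * \<Phi> p)) / \<sigma>"
  have "integral_functional M f (pt y) \<le> ereal c"
  proof (rule integral_functional_le_of_admissible[OF Z(1,2) y1])
    fix u assume u: "admissible Z u"
    have "(\<integral>t. u p0 t \<partial>M) \<le> (\<integral>t. F p0 t \<partial>M)"
    proof (rule integral_mono_AE[OF int[OF u p0] integrable_F[OF p0]])
      have "AE t in M. ereal (\<Sum>p\<in>P. unit_weight p0 p * u p t) \<le> f t (pt (unit_weight p0))"
        using conjunct2[OF u[unfolded admissible_def]] Z(3)[OF p0] by (rule bspec)
      then show "AE t in M. u p0 t \<le> F p0 t"
        using AE_F[OF p0] unfolding sum_unit_weight(2)[OF finP p0] sum_unit_weight_scaleR[OF finP p0]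
        by eventually_elim simp
    qed
    then have "\<eta> * (\<integral>t. u p0 t \<partial>M) \<le> \<eta> * (\<integral>t. F p0 t \<partial>M)" using \<eta> by simp
    then show "(\<Sum>p\<in>P. y p * (\<integral>t. u p t \<partial>M)) \<le> c"
      unfolding y_sum c_def using sep[OF u] \<sigma> by (intro divide_right_mono) auto
  qed simp_all
  then have "ereal (\<Sum>p\<in>P. y p * \<Phi> p) \<le> ereal c" using minorant[OF y1] by (rule order_trans[rotated])
  then have "(\<Sum>p\<in>P. y p * \<Phi> p) \<le> c" by simp
  then have "\<eta> * \<Phi> p0 - (\<Sum>p\<in>P. w p * \<Phi> p) \<le> \<eta> * (\<integral>t. F p0 t \<partial>M) - \<delta>\<^sup>2 - (\<Sum>p\<in>P. w p * \<Phi> p)"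
    unfolding y_sum c_def using \<sigma> by (simp add: divide_le_cancel)
  then have "\<delta>\<^sup>2 \<le> \<eta> * G" by (simp add: G_def right_diff_distrib)
  also have "\<dots> \<le> \<eta> * (1 + \<bar>G\<bar>)" using \<eta> by (intro mult_left_mono) auto
  also have "\<dots> = \<delta>\<^sup>2 / 2" by (simp add: \<eta>_def field_simps add_pos_nonneg)
  finally show False using d2 by simp
qed

end


section \<open>Passage to the limit\<close>

lemma convex_edom_integral_functional:
  assumes f: "convex_normal_integrand M f"
  shows "convex (edom (integral_functional M f))"
proof (rule convexI)
  fix x y and u v :: real
  assume xy: "x \<in> edom (integral_functional M f)" "y \<in> edom (integral_functional M f)"
    and uv: "0 \<le> u" "0 \<le> v" "u + v = 1"
  obtain a where a: "integrable M a" "AE t in M. f t x \<le> ereal (a t)"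
    by (rule upper_integral_majorant[of M "\<lambda>t. f t x"])
      (use xy(1) in \<open>simp add: edom_def integral_functional_def\<close>, rule that)
  obtain b where b: "integrable M b" "AE t in M. f t y \<le> ereal (b t)"
    by (rule upper_integral_majorant[of M "\<lambda>t. f t y"])
      (use xy(2) in \<open>simp add: edom_def integral_functional_def\<close>, rule that)
  have "AE t in M. f t \<in> Gamma0" using f by (simp add: convex_normal_integrand_def)
  then have "AE t in M. f t (u *\<^sub>R x + v *\<^sub>R y) \<le> ereal (u * a t + v * b t)"
    using a(2) b(2) by eventually_elim (rule econvexD[OF Gamma0_econvex _ _ uv(3)], use uv in auto)
  then have "integral_functional M f (u *\<^sub>R x + v *\<^sub>R y) \<le> ereal (\<integral>t. u * a t + v * b t \<partial>M)"
    unfolding integral_functional_def by (intro upper_integral_le) (use a b in simp)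
  then show "u *\<^sub>R x + v *\<^sub>R y \<in> edom (integral_functional M f)"
    by (auto simp: edom_def intro: le_less_trans)
qed

lemma econvex_delta:
  assumes "convex A" shows "econvex (delta A)"
proof -
  have "{(v, r). delta A v \<le> ereal r} = A \<times> {0..}"
    by (auto simp: delta_def split: if_splits)
  then show ?thesis using assms by (simp add: econvex_def convex_Times)
qed

text \<open>The limit of the exponentials is positive: if it were zero, \<open>v\<close> would tend to infinity.\<close>

lemma convergent_of_exp_convergent:
  fixes v :: "nat \<Rightarrow> real"
  assumes conv: "convergent (\<lambda>k. exp (- v k / 2))" and fin: "liminf (\<lambda>k. ennreal (v k)) \<noteq> \<infinity>"
  shows "convergent v"
proof -
  obtain e where e: "(\<lambda>k. exp (- v k / 2)) \<longlonglongrightarrow> e" using conv by (auto simp: convergent_def)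
  have "e \<ge> 0" by (rule LIMSEQ_le_const[OF e]) simp
  moreover have "e \<noteq> 0"
  proof
    assume "e = 0"
    have "\<infinity> \<le> liminf (\<lambda>k. ennreal (v k))"
      unfolding le_Liminf_iff
    proof (intro allI impI)
      fix y :: ennreal assume "y < \<infinity>"
      then obtain c where c: "0 \<le> c" "y = ennreal c" by (cases y) auto
      have "\<forall>\<^sub>F k in sequentially. exp (- v k / 2) < exp (- c / 2)"
        by (rule order_tendstoD(2)[OF e]) (simp add: \<open>e = 0\<close>)
      then show "\<forall>\<^sub>F k in sequentially. y < ennreal (v k)"
        by eventually_elim (use c in \<open>auto simp: ennreal_less_iff\<close>)
    qed
    then show False using fin by (simp add: top_unique)
  qed
  ultimately have "(\<lambda>k. - 2 * ln (exp (- v k / 2))) \<longlonglongrightarrow> - 2 * ln e"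
    by (intro tendsto_mult tendsto_const tendsto_ln e) auto
  then show ?thesis by (auto simp: convergent_def)
qed

context weighted_integrand begin

definition approximants :: "('x \<Rightarrow> real) set \<Rightarrow> real \<Rightarrow> ('x \<Rightarrow> 't \<Rightarrow> real) set" where
  "approximants Z \<delta> = {u. admissible Z u \<and> (\<forall>p\<in>P. \<bar>(\<integral>t. u p t \<partial>M) - \<Phi> p\<bar> \<le> \<delta>)}"

lemma approximants_mono: "Z' \<subseteq> Z \<Longrightarrow> \<delta> \<le> \<delta>' \<Longrightarrow> approximants Z \<delta> \<subseteq> approximants Z' \<delta>'"
  unfolding approximants_def using admissible_mono by (fastforce intro: order_trans)

lemma approximants_midpoint:
  assumes u: "u \<in> approximants Z \<delta>" and v: "v \<in> approximants Z \<delta>"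
  shows "(\<lambda>p t. (1 - 1/2) * u p t + 1/2 * v p t) \<in> approximants Z \<delta>"
proof -
  have "\<bar>(\<integral>t. (1 - 1/2) * u p t + 1/2 * v p t \<partial>M) - \<Phi> p\<bar> \<le> \<delta>" if p: "p \<in> P" for p
  proof -
    have "integrable M (u p)" "integrable M (v p)"
      using u v p by (simp_all add: approximants_def admissible_def)
    then have "(\<integral>t. (1 - 1/2) * u p t + 1/2 * v p t \<partial>M)
        = (1 - 1/2) * (\<integral>t. u p t \<partial>M) + 1/2 * (\<integral>t. v p t \<partial>M)" by simp
    moreover have "\<bar>(\<integral>t. u p t \<partial>M) - \<Phi> p\<bar> \<le> \<delta>" "\<bar>(\<integral>t. v p t \<partial>M) - \<Phi> p\<bar> \<le> \<delta>"
      using u v p by (simp_all add: approximants_def)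
    ultimately show ?thesis by (simp add: abs_le_iff)
  qed
  then show ?thesis using admissible_convex[of Z u v "1/2"] u v by (simp add: approximants_def)
qed

lemma approximants_le_F:
  assumes Z: "unit_weight ` P \<subseteq> Z" and u: "u \<in> approximants Z \<delta>" and p: "p \<in> P"
  shows "AE t in M. u p t \<le> F p t"
proof -
  have "AE t in M. ereal (\<Sum>p'\<in>P. unit_weight p p' * u p' t) \<le> f t (pt (unit_weight p))"
  proof -
    have "unit_weight p \<in> Z" using Z p by blast
    then show ?thesis using u by (simp only: approximants_def admissible_def mem_Collect_eq)
  qed
  then show ?thesis
    using AE_F[OF p] unfolding sum_unit_weight(2)[OF finP p] sum_unit_weight_scaleR[OF finP p]
    by eventually_elim simp
qed

text \<open>Near-minimisers of \<open>G\<close> form a Cauchy sequence: the midpoint of the \<open>n\<close>-th and the \<open>m\<close>-th one, \<open>n \<le> m\<close>, is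
again an approximant of stage \<open>n\<close>, so its value is at least the infimum \<open>g n\<close>, while the defect of convexity
of \<open>exp\<close> at a midpoint is a square.\<close>

lemma convergent_approximants:
  assumes Z: "\<And>n. finite (Z n)" "\<And>n b. b \<in> Z n \<Longrightarrow> (\<Sum>p\<in>P. b p) = 1" "\<And>n. unit_weight ` P \<subseteq> Z n"
    "\<And>n m. n \<le> m \<Longrightarrow> Z n \<subseteq> Z m"
  obtains u where "\<And>n. u n \<in> approximants (Z n) (1 / real (Suc n))"
    "AE t in M. \<forall>p\<in>P. convergent (\<lambda>n. u n p t)"
proof -
  define V where "V n = approximants (Z n) (1 / real (Suc n))" for n
  have V_ne: "V n \<noteq> {}" for n
    using admissible_approximation[OF Z(1)[of n] Z(2)[of _ n], of "1 / real (Suc n)"] Z(3)[of n]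
    by (auto simp: V_def approximants_def)
  have V_mono: "V m \<subseteq> V n" if "n \<le> m" for n m
    unfolding V_def by (rule approximants_mono[OF Z(4)[OF that]]) (use that in \<open>simp add: frac_le\<close>)
  obtain \<rho> :: "'t \<Rightarrow> real" where \<rho>: "integrable M \<rho>" "\<And>t. 0 < \<rho> t" "0 < (\<integral>t. \<rho> t \<partial>M)"
    by (rule positive_integral_weight[OF nonnull]) (rule that)
  have [measurable]: "\<rho> \<in> borel_measurable M" using \<rho>(1) by simp
  have Fm[measurable]: "F p \<in> borel_measurable M" if "p \<in> P" for p using integrable_F[OF that] by simp
  have Vm: "u p \<in> borel_measurable M" if "u \<in> V n" "p \<in> P" for u n p
    by (rule borel_measurable_integrable) (use that in \<open>simp add: V_def approximants_def admissible_def\<close>)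
  define X where "X u p t = exp (- (F p t - u p t)) * \<rho> t" for u and p :: 'x and t
  have X_le: "AE t in M. X u p t \<le> \<rho> t" if "u \<in> V n" "p \<in> P" for u n p
    using approximants_le_F[OF Z(3) that(1)[unfolded V_def] that(2)]
    by eventually_elim (use \<rho>(2) in \<open>simp add: X_def mult_le_cancel_right1 less_imp_le not_less\<close>)
  have X_pos: "0 \<le> X u p t" for u p t using \<rho>(2)[of t] by (simp add: X_def)
  have X_int: "integrable M (X u p)" if u: "u \<in> V n" and p: "p \<in> P" for u n p
  proof (rule Bochner_Integration.integrable_bound[OF \<rho>(1)])
    show "X u p \<in> borel_measurable M" unfolding X_def[abs_def] using Vm[OF u p] Fm[OF p] by measurable
    show "AE t in M. norm (X u p t) \<le> norm (\<rho> t)"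
      using X_le[OF u p] by eventually_elim (use X_pos \<rho>(2) in \<open>simp add: less_imp_le\<close>)
  qed
  define G where "G u = (\<Sum>p\<in>P. \<integral>t. X u p t \<partial>M)" for u
  define K where "K = (\<Sum>p\<in>P. \<integral>t. \<rho> t \<partial>M)"
  have G_pos: "0 \<le> G u" for u unfolding G_def by (intro sum_nonneg integral_nonneg_AE) (simp add: X_pos)
  have G_le: "G u \<le> K" if u: "u \<in> V n" for u n
    unfolding G_def K_def by (intro sum_mono integral_mono_AE X_int[OF u] \<rho>(1) X_le[OF u])
  have bdd: "bdd_below (G ` A)" for A by (rule bdd_belowI2[of _ 0]) (rule G_pos)
  define g where "g n = Inf (G ` V n)" for n
  have g_le: "g n \<le> G u" if "u \<in> V n" for u n unfolding g_def by (rule cINF_lower[OF bdd that])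
  have g_mono: "g n \<le> g m" if "n \<le> m" for n m
    unfolding g_def by (rule cINF_superset_mono[OF V_ne bdd V_mono[OF that]]) simp
  have "g n \<le> K" for n
  proof -
    obtain u where "u \<in> V n" using V_ne by blast
    then show ?thesis using g_le G_le by (blast intro: order_trans)
  qed
  then obtain l where l: "g \<longlonglongrightarrow> l" "\<forall>n. g n \<le> l"
    using incseq_convergent[of g K] g_mono by (auto simp: incseq_def)
  have "\<exists>u. u \<in> V n \<and> G u < g n + 1 / real (Suc n)" for n
    using cInf_lessD[of "G ` V n" "g n + 1 / real (Suc n)"] V_ne[of n] by (auto simp: g_def)
  then obtain u where u: "\<And>n. u n \<in> V n" and uG: "\<And>n. G (u n) < g n + 1 / real (Suc n)" by metis
  define E where "E n p t = exp (- (F p t - u n p t) / 2)" for n p t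
  define c where "c n = (l - g n) + 2 * (1 / real (Suc n))" for n
  have c0: "c \<longlonglongrightarrow> (l - l) + 2 * 0" unfolding c_def[abs_def]
    by (intro tendsto_add tendsto_diff tendsto_mult tendsto_const l(1) LIMSEQ_Suc[OF lim_1_over_n])
  have cauchy: "(\<integral>\<^sup>+ t. ennreal (\<Sum>p\<in>P. (E n p t - E m p t)\<^sup>2 * \<rho> t) \<partial>M) \<le> ennreal (c n)" if nm: "n \<le> m" for n m
  proof -
    have um: "u m \<in> V n" using u V_mono[OF nm] by blast
    define h where "h = (\<lambda>p t. (1 - 1/2) * u n p t + 1/2 * u m p t)"
    have h: "h \<in> V n" unfolding h_def V_def
      by (rule approximants_midpoint) (use u um in \<open>auto simp: V_def\<close>)
    \<comment> \<open>The defect of convexity at the midpoint \<open>h\<close> as a square.\<close>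
    have eq: "(E n p t - E m p t)\<^sup>2 * \<rho> t = X (u n) p t + X (u m) p t - 2 * X h p t" for p t
    proof -
      have 1: "(E n' p t)\<^sup>2 = exp (- (F p t - u n' p t))" for n'
        unfolding E_def power2_eq_square exp_add[symmetric] by simp
      have 2: "E n p t * E m p t = exp (- (F p t - h p t))"
        unfolding E_def exp_add[symmetric] h_def by (rule arg_cong[of _ _ exp]) (simp add: field_simps)
      show ?thesis unfolding power2_diff 1 mult.assoc[of 2] 2 X_def by (simp add: algebra_simps)
    qed
    have int: "integrable M (\<lambda>t. \<Sum>p\<in>P. (E n p t - E m p t)\<^sup>2 * \<rho> t)"
      unfolding eq
      by (intro Bochner_Integration.integrable_sum Bochner_Integration.integrable_add
          Bochner_Integration.integrable_diff integrable_mult_right X_int[OF u] X_int[OF um] X_int[OF h])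
    have "(\<integral>\<^sup>+ t. ennreal (\<Sum>p\<in>P. (E n p t - E m p t)\<^sup>2 * \<rho> t) \<partial>M)
        = ennreal (\<integral>t. (\<Sum>p\<in>P. (E n p t - E m p t)\<^sup>2 * \<rho> t) \<partial>M)"
      by (rule nn_integral_eq_integral[OF int]) (use \<rho>(2) in \<open>auto intro!: sum_nonneg simp: less_imp_le\<close>)
    also have "(\<integral>t. (\<Sum>p\<in>P. (E n p t - E m p t)\<^sup>2 * \<rho> t) \<partial>M)
        = (\<Sum>p\<in>P. \<integral>t. X (u n) p t + X (u m) p t - 2 * X h p t \<partial>M)"
      unfolding eq
      by (intro Bochner_Integration.integral_sum Bochner_Integration.integrable_add
          Bochner_Integration.integrable_diff integrable_mult_right X_int[OF u] X_int[OF um] X_int[OF h])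
    also have "\<dots> = (\<Sum>p\<in>P. (\<integral>t. X (u n) p t \<partial>M) + (\<integral>t. X (u m) p t \<partial>M) - 2 * (\<integral>t. X h p t \<partial>M))"
      by (rule sum.cong) (simp_all add: X_int[OF u] X_int[OF um] X_int[OF h])
    also have "\<dots> = G (u n) + G (u m) - 2 * G h"
      by (simp add: G_def sum.distrib sum_subtractf sum_distrib_left)
    also have "\<dots> \<le> c n"
    proof -
      have "1 / real (Suc m) \<le> 1 / real (Suc n)" using nm by (simp add: frac_le)
      then show ?thesis using uG[of n] uG[of m] g_le[OF h] l(2)[rule_format, of m] unfolding c_def by linarith
    qed
    finally show ?thesis by (simp add: ennreal_leI)
  qed
  have Em: "E n p \<in> borel_measurable M" if "p \<in> P" for n p
    unfolding E_def[abs_def] using Vm[OF u that] Fm[OF that] by measurable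
  obtain r :: "nat \<Rightarrow> nat" where r: "strict_mono r" "AE t in M. \<forall>p\<in>P. convergent (\<lambda>k. E (r k) p t)"
    by (rule AE_convergent_subsequence[where M = M and E = E and P = P and \<rho> = \<rho> and c = c,
          OF Em borel_measurable_integrable[OF \<rho>(1)] \<rho>(2) finP cauchy c0[simplified]])
      (assumption, assumption, rule that)
  \<comment> \<open>The nonnegative functions \<open>F p - u (r k) p\<close> have bounded integrals, so they do not escape to infinity.\<close>
  have fin: "AE t in M. liminf (\<lambda>k. ennreal (F p t - u (r k) p t)) \<noteq> \<infinity>" if p: "p \<in> P" for p
  proof (rule nn_integral_noteq_infinite)
    have uint: "integrable M (u k p)" for k using u[of k] p by (simp add: V_def approximants_def admissible_def)
    show "(\<lambda>t. liminf (\<lambda>k. ennreal (F p t - u (r k) p t))) \<in> borel_measurable M"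
      using Vm[OF u p] Fm[OF p] by measurable
    have "(\<integral>\<^sup>+ t. liminf (\<lambda>k. ennreal (F p t - u (r k) p t)) \<partial>M)
        \<le> liminf (\<lambda>k. \<integral>\<^sup>+ t. ennreal (F p t - u (r k) p t) \<partial>M)"
      by (rule nn_integral_liminf) (use Vm[OF u p] Fm[OF p] in measurable)
    also have "\<dots> \<le> liminf (\<lambda>k. ennreal ((\<integral>t. F p t \<partial>M) - \<Phi> p + 1))"
    proof (intro Liminf_mono always_eventually allI)
      fix k
      have "(\<integral>\<^sup>+ t. ennreal (F p t - u (r k) p t) \<partial>M) = ennreal (\<integral>t. F p t - u (r k) p t \<partial>M)"
      proof (rule nn_integral_eq_integral)
        show "AE t in M. 0 \<le> F p t - u (r k) p t"
          using approximants_le_F[OF Z(3) u[unfolded V_def] p] by eventually_elim simp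
      qed (use integrable_F[OF p] uint in simp)
      also have "\<dots> \<le> ennreal ((\<integral>t. F p t \<partial>M) - \<Phi> p + 1)"
      proof (rule ennreal_leI)
        have "\<bar>(\<integral>t. u (r k) p t \<partial>M) - \<Phi> p\<bar> \<le> 1 / real (Suc (r k))"
          using u[of "r k"] p by (simp add: V_def approximants_def)
        also have "\<dots> \<le> 1" by simp
        finally show "(\<integral>t. F p t - u (r k) p t \<partial>M) \<le> (\<integral>t. F p t \<partial>M) - \<Phi> p + 1"
          using integrable_F[OF p] uint by simp
      qed
      finally show "(\<integral>\<^sup>+ t. ennreal (F p t - u (r k) p t) \<partial>M) \<le> ennreal ((\<integral>t. F p t \<partial>M) - \<Phi> p + 1)" .
    qed
    also have "\<dots> < \<infinity>" by (simp add: Liminf_const)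
    finally show "(\<integral>\<^sup>+ t. liminf (\<lambda>k. ennreal (F p t - u (r k) p t)) \<partial>M) \<noteq> \<infinity>" by simp
  qed
  then have "AE t in M. \<forall>p\<in>P. liminf (\<lambda>k. ennreal (F p t - u (r k) p t)) \<noteq> \<infinity>"
    using finP by (simp add: AE_finite_all)
  with r(2) have "AE t in M. \<forall>p\<in>P. convergent (\<lambda>k. u (r k) p t)"
  proof eventually_elim
    case (elim t)
    show ?case
    proof
      fix p assume p: "p \<in> P"
      have "convergent (\<lambda>k. F p t - u (r k) p t)"
        by (rule convergent_of_exp_convergent) (use elim p in \<open>auto simp: E_def\<close>)
      then have "convergent (\<lambda>k. F p t - (F p t - u (r k) p t))"
        by (rule convergent_diff[OF convergent_const])
      then show "convergent (\<lambda>k. u (r k) p t)" by (simp only: diff_diff_eq2 add_diff_cancel_left')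
    qed
  qed
  moreover have "u (r n) \<in> approximants (Z n) (1 / real (Suc n))" for n
  proof -
    have "u (r n) \<in> V n" using u V_mono[OF seq_suble[OF r(1)]] by blast
    then show ?thesis by (simp add: V_def)
  qed
  ultimately show thesis using that[of "\<lambda>n. u (r n)"] by blast
qed

end


context weighted_integrand begin

text \<open>Fatou's lemma is applied to the nonnegative functions \<open>f (z) - h\<close>: at the points of \<open>P\<close> it gives integrability,
and at a point \<open>z\<close> where the integral functional is finite it gives the inequality for the integrals, because
the integral of \<open>f (z)\<close> occurs on both sides and cancels.\<close>

lemma limit_of_approximants:
  assumes Z: "\<And>n. unit_weight ` P \<subseteq> Z n"
    and u: "\<And>n. u n \<in> approximants (Z n) (1 / real (Suc n))"
    and lim: "AE t in M. \<forall>p\<in>P. (\<lambda>n. u n p t) \<longlonglongrightarrow> U p t"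
    and U: "\<And>p. p \<in> P \<Longrightarrow> U p \<in> borel_measurable M"
  shows limit_integrable: "\<And>p. p \<in> P \<Longrightarrow> integrable M (U p)"
    and limit_le: "\<And>b i. (\<And>n. n \<ge> i \<Longrightarrow> b \<in> Z n) \<Longrightarrow>
      AE t in M. ereal (\<Sum>p\<in>P. b p * U p t) \<le> f t (pt b)"
    and limit_integral_ge: "\<And>b i. (\<And>n. n \<ge> i \<Longrightarrow> b \<in> Z n) \<Longrightarrow> (\<Sum>p\<in>P. b p) = 1 \<Longrightarrow>
      integral_functional M f (pt b) < \<infinity> \<Longrightarrow>
      (\<Sum>p\<in>P. b p * \<Phi> p) \<le> (\<Sum>p\<in>P. b p * (\<integral>t. U p t \<partial>M))"
proof -
  have int: "integrable M (u n p)" if "p \<in> P" for n p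
    using u[of n] that by (simp add: approximants_def admissible_def)
  have u_lim: "(\<lambda>n. \<integral>t. u n p t \<partial>M) \<longlonglongrightarrow> \<Phi> p" if p: "p \<in> P" for p
  proof (rule LIM_zero_cancel, rule tendsto_rabs_zero_cancel, rule tendsto_sandwich)
    show "\<forall>\<^sub>F n in sequentially. 0 \<le> \<bar>(\<integral>t. u n p t \<partial>M) - \<Phi> p\<bar>" by simp
    show "\<forall>\<^sub>F n in sequentially. \<bar>(\<integral>t. u n p t \<partial>M) - \<Phi> p\<bar> \<le> 1 / real (Suc n)"
      using u p unfolding approximants_def by (intro always_eventually allI) blast
    show "(\<lambda>n. 1 / real (Suc n)) \<longlonglongrightarrow> 0" by (rule LIMSEQ_Suc[OF lim_1_over_n])
  qed (rule tendsto_const)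
  show U_int: "integrable M (U p)" if p: "p \<in> P" for p
  proof -
    have "integrable M (\<lambda>t. F p t - U p t)"
    proof (rule fatou_real(1))
      show "integrable M (\<lambda>t. F p t - u n p t)" for n using integrable_F[OF p] int[OF p] by simp
      show "AE t in M. 0 \<le> F p t - u n p t" for n
        using approximants_le_F[OF Z u p] by eventually_elim simp
      show "AE t in M. (\<lambda>n. F p t - u n p t) \<longlonglongrightarrow> F p t - U p t"
        using lim by eventually_elim (intro tendsto_diff tendsto_const, use p in blast)
      show "(\<lambda>t. F p t - U p t) \<in> borel_measurable M"
        using integrable_F[OF p] U[OF p] by simp
      have "(\<lambda>n. (\<integral>t. F p t \<partial>M) - (\<integral>t. u n p t \<partial>M)) \<longlonglongrightarrow> (\<integral>t. F p t \<partial>M) - \<Phi> p"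
        by (intro tendsto_diff tendsto_const u_lim p)
      then show "(\<lambda>n. \<integral>t. F p t - u n p t \<partial>M) \<longlonglongrightarrow> (\<integral>t. F p t \<partial>M) - \<Phi> p"
        using integrable_F[OF p] int[OF p] by simp
    qed
    then have "integrable M (\<lambda>t. F p t - (F p t - U p t))"
      by (rule Bochner_Integration.integrable_diff[OF integrable_F[OF p]])
    then show ?thesis by simp
  qed
  have le: "AE t in M. ereal (\<Sum>p\<in>P. b p * u n p t) \<le> f t (pt b)" if "b \<in> Z n" for b n
    using u[of n] that by (simp add: approximants_def admissible_def)
  have sum_lim: "AE t in M. (\<lambda>n. \<Sum>p\<in>P. b p * u n p t) \<longlonglongrightarrow> (\<Sum>p\<in>P. b p * U p t)" for b
    using lim by eventually_elim (intro tendsto_sum tendsto_mult tendsto_const, blast)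
  show "AE t in M. ereal (\<Sum>p\<in>P. b p * U p t) \<le> f t (pt b)" if bZ: "\<And>n. n \<ge> i \<Longrightarrow> b \<in> Z n" for b i
  proof -
    have "AE t in M. \<forall>n. ereal (\<Sum>p\<in>P. b p * u (n + i) p t) \<le> f t (pt b)"
      unfolding AE_all_countable by (intro allI le bZ) simp
    with sum_lim[of b] show ?thesis
    proof eventually_elim
      case (elim t)
      show ?case
      proof (rule ereal_le_real)
        fix r assume r: "f t (pt b) \<le> ereal r"
        have "(\<Sum>p\<in>P. b p * u (n + i) p t) \<le> r" for n using order_trans[OF elim(2)[rule_format, of n] r] by simp
        then have "(\<Sum>p\<in>P. b p * U p t) \<le> r"
          by (intro LIMSEQ_le_const2[OF LIMSEQ_ignore_initial_segment[OF elim(1), of i]]) blast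
        then show "ereal (\<Sum>p\<in>P. b p * U p t) \<le> ereal r" by simp
      qed
    qed
  qed
  show "(\<Sum>p\<in>P. b p * \<Phi> p) \<le> (\<Sum>p\<in>P. b p * (\<integral>t. U p t \<partial>M))"
    if bZ: "\<And>n. n \<ge> i \<Longrightarrow> b \<in> Z n" and b: "(\<Sum>p\<in>P. b p) = 1"
      and fin: "integral_functional M f (pt b) < \<infinity>" for b i
  proof -
    define B where "B t = real_of_ereal (f t (pt b))" for t
    have B: "integrable M B" "AE t in M. f t (pt b) = ereal (B t)"
      using integrable_at_pt[OF b fin] AE_at_pt[OF b fin] by (simp_all add: B_def[abs_def])
    have sint: "integrable M (\<lambda>t. \<Sum>p\<in>P. b p * u n p t)" for n
      by (intro Bochner_Integration.integrable_sum integrable_mult_right int)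
    have Uint: "integrable M (\<lambda>t. \<Sum>p\<in>P. b p * U p t)"
      by (intro Bochner_Integration.integrable_sum integrable_mult_right U_int)
    have int_sum: "(\<integral>t. (\<Sum>p\<in>P. b p * w p t) \<partial>M) = (\<Sum>p\<in>P. b p * (\<integral>t. w p t \<partial>M))"
      if "\<And>p. p \<in> P \<Longrightarrow> integrable M (w p)" for w
      using that by simp
    have "(\<integral>t. B t - (\<Sum>p\<in>P. b p * U p t) \<partial>M) \<le> (\<integral>t. B t \<partial>M) - (\<Sum>p\<in>P. b p * \<Phi> p)"
    proof (rule fatou_real(2))
      show "integrable M (\<lambda>t. B t - (\<Sum>p\<in>P. b p * u (n + i) p t))" for n using B(1) sint by simp
      show "AE t in M. 0 \<le> B t - (\<Sum>p\<in>P. b p * u (n + i) p t)" for n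
        using B(2) le[OF bZ[OF le_add2[of i n]]] by eventually_elim simp
      show "AE t in M. (\<lambda>n. B t - (\<Sum>p\<in>P. b p * u (n + i) p t)) \<longlonglongrightarrow> B t - (\<Sum>p\<in>P. b p * U p t)"
        using sum_lim[of b]
        by eventually_elim (intro tendsto_diff tendsto_const, rule LIMSEQ_ignore_initial_segment)
      show "(\<lambda>t. B t - (\<Sum>p\<in>P. b p * U p t)) \<in> borel_measurable M"
        by (intro borel_measurable_integrable Bochner_Integration.integrable_diff B Uint)
      have "(\<lambda>n. (\<integral>t. B t \<partial>M) - (\<Sum>p\<in>P. b p * (\<integral>t. u (n + i) p t \<partial>M)))
          \<longlonglongrightarrow> (\<integral>t. B t \<partial>M) - (\<Sum>p\<in>P. b p * \<Phi> p)"
        by (intro tendsto_diff tendsto_const tendsto_sum tendsto_mult LIMSEQ_ignore_initial_segment u_lim)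
      moreover have "(\<integral>t. B t - (\<Sum>p\<in>P. b p * u (n + i) p t) \<partial>M)
          = (\<integral>t. B t \<partial>M) - (\<Sum>p\<in>P. b p * (\<integral>t. u (n + i) p t \<partial>M))" for n
        by (subst Bochner_Integration.integral_diff[OF B(1) sint]) (simp add: int_sum int)
      ultimately show "(\<lambda>n. \<integral>t. B t - (\<Sum>p\<in>P. b p * u (n + i) p t) \<partial>M)
          \<longlonglongrightarrow> (\<integral>t. B t \<partial>M) - (\<Sum>p\<in>P. b p * \<Phi> p)"
        by simp
    qed
    moreover have "(\<integral>t. B t - (\<Sum>p\<in>P. b p * U p t) \<partial>M)
        = (\<integral>t. B t \<partial>M) - (\<Sum>p\<in>P. b p * (\<integral>t. U p t \<partial>M))"
      by (subst Bochner_Integration.integral_diff[OF B(1) Uint]) (simp add: int_sum U_int)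
    ultimately show ?thesis by simp
  qed
qed

text \<open>Both inequalities hold at rational weights by the preceding lemma. They extend to all weights by
convexity: of \<open>f t\<close> for the first one, of the indicator function of the domain of the integral functional for
the second one.\<close>

theorem integrable_affine_minorant:
  obtains u where "\<And>p. p \<in> P \<Longrightarrow> integrable M (u p)"
    "AE t in M. \<forall>b. (\<Sum>p\<in>P. b p) = 1 \<longrightarrow> ereal (\<Sum>p\<in>P. b p * u p t) \<le> f t (pt b)"
    "\<And>b. (\<Sum>p\<in>P. b p) = 1 \<Longrightarrow> integral_functional M f (pt b) < \<infinity> \<Longrightarrow>
      (\<Sum>p\<in>P. b p * \<Phi> p) \<le> (\<Sum>p\<in>P. b p * (\<integral>t. u p t \<partial>M))"
proof -
  define D where "D = {b \<in> rational_weights P. (\<Sum>p\<in>P. b p) = 1}"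
  define d where "d = from_nat_into D"
  have D_count: "countable D"
    unfolding D_def by (rule countable_subset[OF _ countable_rational_weights[OF finP]]) blast
  have unitD: "unit_weight ` P \<subseteq> D"
    using finP by (auto simp: D_def rational_weights_def)
  then have D_ne: "D \<noteq> {}" using P_ne by blast
  define Z where "Z n = unit_weight ` P \<union> d ` {..<n}" for n
  have ZD: "Z n \<subseteq> D" for n
    unfolding Z_def d_def using unitD from_nat_into[OF D_ne] by blast
  have Z: "finite (Z n)" "\<And>b. b \<in> Z n \<Longrightarrow> (\<Sum>p\<in>P. b p) = 1" "unit_weight ` P \<subseteq> Z n" for n
    using finP ZD[of n] by (auto simp: Z_def D_def)
  have Z_mono: "Z n \<subseteq> Z m" if "n \<le> m" for n m unfolding Z_def using that by (intro Un_mono image_mono) auto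
  obtain u where u: "\<And>n. u n \<in> approximants (Z n) (1 / real (Suc n))"
    and conv: "AE t in M. \<forall>p\<in>P. convergent (\<lambda>n. u n p t)"
    by (rule convergent_approximants[of Z, OF Z Z_mono]) (assumption, assumption, rule that)
  define U where "U p t = lim (\<lambda>n. u n p t)" for p t
  have lim: "AE t in M. \<forall>p\<in>P. (\<lambda>n. u n p t) \<longlonglongrightarrow> U p t"
    using conv by eventually_elim (simp add: U_def convergent_LIMSEQ_iff)
  have Um: "U p \<in> borel_measurable M" if p: "p \<in> P" for p
    unfolding U_def[abs_def]
  proof (rule borel_measurable_lim_metric)
    fix n
    have "integrable M (u n p)" using u[of n] p by (simp add: approximants_def admissible_def)
    then show "u n p \<in> borel_measurable M" by simp
  qed
  have D_index: "\<exists>i. \<forall>n\<ge>i. b \<in> Z n" if b: "b \<in> D" for b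
  proof -
    obtain i where "d i = b" unfolding d_def using from_nat_into_surj[OF D_count b] by blast
    then show ?thesis by (intro exI[of _ "Suc i"]) (auto simp: Z_def)
  qed
  note limit = limit_of_approximants[of Z u U, OF Z(3) u lim Um]
  show thesis
  proof (rule that[of U])
    show "integrable M (U p)" if "p \<in> P" for p by (rule limit(1)) (use that in auto)
    have "AE t in M. \<forall>b\<in>D. ereal (\<Sum>p\<in>P. b p * U p t) \<le> f t (pt b)"
      unfolding AE_ball_countable[OF D_count]
    proof
      fix b assume "b \<in> D"
      then obtain i where i: "\<forall>n\<ge>i. b \<in> Z n" using D_index by blast
      show "AE t in M. ereal (\<Sum>p\<in>P. b p * U p t) \<le> f t (pt b)"
        by (rule limit(2)[of i]) (use i in auto)
    qed
    with AE_Gamma0 AE_all_F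
    show "AE t in M. \<forall>b. (\<Sum>p\<in>P. b p) = 1 \<longrightarrow> ereal (\<Sum>p\<in>P. b p * U p t) \<le> f t (pt b)"
    proof eventually_elim
      case (elim t)
      show ?case
      proof (intro allI impI)
        fix b :: "'x \<Rightarrow> real" assume b: "(\<Sum>p\<in>P. b p) = 1"
        show "ereal (\<Sum>p\<in>P. b p * U p t) \<le> f t (pt b)"
        proof (rule affine_le_econvex_of_rational[OF finP P_ne Gamma0_econvex[OF elim(1)] _ _ b])
          show "f t p \<le> ereal (F p t)" if "p \<in> P" for p using elim(2) that by simp
        qed (use elim(3) in \<open>simp add: D_def\<close>)
      qed
    qed
    fix b :: "'x \<Rightarrow> real" assume b: "(\<Sum>p\<in>P. b p) = 1" and fin: "integral_functional M f (pt b) < \<infinity>"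
    define g where "g = delta (edom (integral_functional M f))"
    have "ereal (\<Sum>p\<in>P. b p * (\<Phi> p - (\<integral>t. U p t \<partial>M))) \<le> g (pt b)"
    proof (rule affine_le_econvex_of_rational[OF finP P_ne _ _ _ b])
      show "econvex g" unfolding g_def by (rule econvex_delta[OF convex_edom_integral_functional[OF normal]])
      show "g p \<le> ereal 0" if "p \<in> P" for p using dom[OF that] by (simp add: g_def delta_def edom_def)
      fix b assume b: "b \<in> rational_weights P" "(\<Sum>p\<in>P. b p) = 1"
      then have "b \<in> D" by (simp add: D_def)
      then obtain i where i: "\<forall>n\<ge>i. b \<in> Z n" using D_index by blast
      show "ereal (\<Sum>p\<in>P. b p * (\<Phi> p - (\<integral>t. U p t \<partial>M))) \<le> g (pt b)"
      proof (cases "integral_functional M f (pt b) < \<infinity>")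
        case True
        have "(\<Sum>p\<in>P. b p * \<Phi> p) \<le> (\<Sum>p\<in>P. b p * (\<integral>t. U p t \<partial>M))"
          by (rule limit(3)[of i]) (use i b True in auto)
        then show ?thesis using True by (simp add: g_def delta_def edom_def right_diff_distrib sum_subtractf)
      next
        case False
        then show ?thesis by (simp add: g_def delta_def edom_def)
      qed
    qed
    then show "(\<Sum>p\<in>P. b p * \<Phi> p) \<le> (\<Sum>p\<in>P. b p * (\<integral>t. U p t \<partial>M))"
      using fin by (simp add: g_def delta_def edom_def right_diff_distrib sum_subtractf)
  qed
qed

end


section \<open>Strong integrability\<close>

lemma compatible_evaluation:
  assumes "compatible_topology \<tau>"
  shows "continuous_map \<tau> euclideanreal (\<lambda>\<phi>. \<phi> z)"
proof -
  have "\<forall>\<Lambda>. continuous_map \<tau> euclideanreal \<Lambda> \<and>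
        (\<forall>\<phi>\<in>tdual. \<forall>\<psi>\<in>tdual. \<Lambda> (\<lambda>x. \<phi> x + \<psi> x) = \<Lambda> \<phi> + \<Lambda> \<psi>) \<and>
        (\<forall>c. \<forall>\<phi>\<in>tdual. \<Lambda> (\<lambda>x. c * \<phi> x) = c * \<Lambda> \<phi>)
        \<longleftrightarrow> (\<exists>x. \<forall>\<phi>\<in>tdual. \<Lambda> \<phi> = \<phi> x)"
    using assms unfolding compatible_topology_def by (elim conjE) assumption
  from this[rule_format, of "\<lambda>\<phi>. \<phi> z"] show ?thesis by blast
qed

lemma compatible_topspace: "compatible_topology \<tau> \<Longrightarrow> topspace \<tau> = tdual"
  by (simp add: compatible_topology_def)

lemma compatible_limit_add:
  assumes \<tau>: "compatible_topology \<tau>" and "limitin \<tau> a k F" "limitin \<tau> b l F"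
  shows "limitin \<tau> (\<lambda>n x. a n x + b n x) (\<lambda>x. k x + l x) F"
proof -
  have "continuous_map (prod_topology \<tau> \<tau>) \<tau> (\<lambda>(\<phi>, \<psi>). (\<lambda>x. \<phi> x + \<psi> x))"
    using \<tau> by (simp add: compatible_topology_def)
  moreover have "limitin (prod_topology \<tau> \<tau>) (\<lambda>n. (a n, b n)) (k, l) F"
    unfolding limitin_pairwise using assms by (simp add: o_def)
  ultimately have "limitin \<tau> ((\<lambda>(\<phi>, \<psi>). (\<lambda>x. \<phi> x + \<psi> x)) \<circ> (\<lambda>n. (a n, b n))) ((\<lambda>(\<phi>, \<psi>). (\<lambda>x. \<phi> x + \<psi> x)) (k, l)) F"
    by (rule continuous_map_limit)
  then show ?thesis by (simp add: o_def)
qed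

lemma compatible_limit_cmult:
  assumes \<tau>: "compatible_topology \<tau>" and c: "(c \<longlongrightarrow> d) F" and \<phi>: "\<phi> \<in> tdual"
  shows "limitin \<tau> (\<lambda>n x. c n * \<phi> x) (\<lambda>x. d * \<phi> x) F"
proof -
  have "continuous_map (prod_topology euclideanreal \<tau>) \<tau> (\<lambda>(c, \<phi>). (\<lambda>x. c * \<phi> x))"
    using \<tau> by (simp add: compatible_topology_def)
  moreover have "limitin (prod_topology euclideanreal \<tau>) (\<lambda>n. (c n, \<phi>)) (d, \<phi>) F"
    unfolding limitin_pairwise using c \<phi> compatible_topspace[OF \<tau>] by (simp add: o_def)
  ultimately have "limitin \<tau> ((\<lambda>(c, \<phi>). (\<lambda>x. c * \<phi> x)) \<circ> (\<lambda>n. (c n, \<phi>))) ((\<lambda>(c, \<phi>). (\<lambda>x. c * \<phi> x)) (d, \<phi>)) F"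
    by (rule continuous_map_limit)
  then show ?thesis by (simp add: o_def)
qed

lemma tdual_bounded_on_vn_bounded:
  assumes B: "vn_bounded B" and \<phi>: "\<phi> \<in> tdual"
  obtains K where "K \<ge> 0" "\<And>v. v \<in> B \<Longrightarrow> \<bar>\<phi> v\<bar> \<le> K"
proof -
  have lin: "linear \<phi>" and cont: "continuous_on UNIV \<phi>" using \<phi> by (auto simp: tdual_def)
  define U where "U = {v. \<bar>\<phi> v\<bar> < 1}"
  have "open U" unfolding U_def
    by (intro open_Collect_less continuous_on_rabs cont continuous_on_const)
  moreover have "0 \<in> U" using linear_0[OF lin] by (simp add: U_def)
  ultimately obtain s where s: "s > 0" "\<And>r. r > s \<Longrightarrow> B \<subseteq> (\<lambda>x. r *\<^sub>R x) ` U"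
    using B unfolding vn_bounded_def by blast
  have "\<bar>\<phi> v\<bar> \<le> s + 1" if v: "v \<in> B" for v
  proof -
    obtain w where w: "w \<in> U" "v = (s + 1) *\<^sub>R w" using s(2)[of "s + 1"] v by auto
    have "\<bar>\<phi> v\<bar> = (s + 1) * \<bar>\<phi> w\<bar>" using s(1) by (simp add: w(2) linear_scale[OF lin] abs_mult)
    also have "\<dots> \<le> (s + 1) * 1" using w(1) s(1) by (intro mult_left_mono) (auto simp: U_def)
    finally show ?thesis by simp
  qed
  then show thesis using that[of "s + 1"] s(1) by simp
qed

lemma balanced_0: "balanced B \<Longrightarrow> 0 \<in> B"
proof -
  assume B: "balanced B"
  then obtain b where b: "b \<in> B" by (auto simp: balanced_def)
  have "(\<lambda>x. (0::real) *\<^sub>R x) ` B \<subseteq> B" using B[unfolded balanced_def, THEN conjunct2, rule_format, of 0] by simp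
  then show "0 \<in> B" using b by auto
qed

text \<open>Balanced sets contain the origin. So finiteness of the upper integral in the definition of strong
integrability is a matter of majorants only.\<close>

lemma upper_integral_sup_nonneg:
  assumes m: "\<And>t. t \<in> space M \<Longrightarrow> m t \<in> tdual" and B: "balanced B"
  shows "0 \<le> upper_integral M (\<lambda>t. SUP x\<in>B. ereal (m t x))"
proof -
  have "ereal (\<integral>t. 0 \<partial>M) \<le> upper_integral M (\<lambda>t. SUP x\<in>B. ereal (m t x))"
  proof (rule upper_integral_ge)
    show "AE t in M. ereal 0 \<le> (SUP x\<in>B. ereal (m t x))"
    proof (rule AE_I2)
      fix t assume "t \<in> space M"
      then have "m t 0 = 0" using m[of t] linear_0[of "m t"] by (simp add: tdual_def)
      then show "ereal 0 \<le> (SUP x\<in>B. ereal (m t x))"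
        using SUP_upper[OF balanced_0[OF B], of "\<lambda>x. ereal (m t x)"] by simp
    qed
  qed simp
  then show ?thesis by (simp add: zero_ereal_def)
qed

lemma strongly_integrable_cmult:
  assumes \<tau>: "compatible_topology \<tau>" and \<phi>: "\<phi> \<in> tdual" and c: "integrable M c"
  shows "strongly_integrable M \<tau> (\<lambda>t v. c t * \<phi> v)"
  unfolding strongly_integrable_def
proof (intro conjI allI impI ballI)
  show td: "(\<lambda>v. c t * \<phi> v) \<in> tdual" for t by (rule tdual_cmult[OF \<phi>])
  have "c \<in> borel_measurable M" using c by simp
  from borel_measurable_implies_sequence_metric[OF this, of 0]
  obtain s where s: "\<And>n. simple_function M (s n)" "\<And>t. t \<in> space M \<Longrightarrow> (\<lambda>n. s n t) \<longlonglongrightarrow> c t"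
    by blast
  show "\<exists>s. (\<forall>n::nat. simple_function M (s n) \<and> (\<forall>t\<in>space M. s n t \<in> tdual)) \<and>
          (AE t in M. limitin \<tau> (\<lambda>n. s n t) (\<lambda>v. c t * \<phi> v) sequentially)"
  proof (intro exI[of _ "\<lambda>n t v. s n t * \<phi> v"] conjI allI ballI)
    show "simple_function M (\<lambda>t v. s n t * \<phi> v)" for n
      by (rule simple_function_compose1[OF s(1), of "\<lambda>c v. c * \<phi> v"])
    show "(\<lambda>v. s n t * \<phi> v) \<in> tdual" for n t by (rule tdual_cmult[OF \<phi>])
    show "AE t in M. limitin \<tau> (\<lambda>n v. s n t * \<phi> v) (\<lambda>v. c t * \<phi> v) sequentially"
      by (intro AE_I2 compatible_limit_cmult[OF \<tau> s(2) \<phi>])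
  qed
  fix B :: "'a set" assume B: "vn_bounded B \<and> balanced B"
  obtain K where K: "K \<ge> 0" "\<And>v. v \<in> B \<Longrightarrow> \<bar>\<phi> v\<bar> \<le> K"
    by (rule tdual_bounded_on_vn_bounded[OF conjunct1[OF B] \<phi>]) (rule that)
  have "upper_integral M (\<lambda>t. SUP x\<in>B. ereal (c t * \<phi> x)) \<le> ereal (\<integral>t. \<bar>c t\<bar> * K \<partial>M)"
  proof (rule upper_integral_le)
    show "AE t in M. (SUP x\<in>B. ereal (c t * \<phi> x)) \<le> ereal (\<bar>c t\<bar> * K)"
    proof (intro AE_I2 SUP_least)
      fix t v assume "v \<in> B"
      have "c t * \<phi> v \<le> \<bar>c t\<bar> * \<bar>\<phi> v\<bar>" by (metis abs_ge_self abs_mult)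
      also have "\<dots> \<le> \<bar>c t\<bar> * K" by (rule mult_left_mono[OF K(2)[OF \<open>v \<in> B\<close>]]) simp
      finally show "ereal (c t * \<phi> v) \<le> ereal (\<bar>c t\<bar> * K)" by simp
    qed
  qed (use c in simp)
  moreover have "0 \<le> upper_integral M (\<lambda>t. SUP x\<in>B. ereal (c t * \<phi> x))"
    by (rule upper_integral_sup_nonneg[OF td conjunct2[OF B]])
  ultimately show "\<bar>upper_integral M (\<lambda>t. SUP x\<in>B. ereal (c t * \<phi> x))\<bar> \<noteq> \<infinity>" by auto
qed

lemma strongly_integrable_add:
  assumes \<tau>: "compatible_topology \<tau>"
    and m: "strongly_integrable M \<tau> m" and m': "strongly_integrable M \<tau> m'"
  shows "strongly_integrable M \<tau> (\<lambda>t v. m t v + m' t v)"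
  unfolding strongly_integrable_def
proof (intro conjI allI impI ballI)
  show td: "(\<lambda>v. m t v + m' t v) \<in> tdual" if "t \<in> space M" for t
    using m m' that unfolding strongly_integrable_def by (blast intro: tdual_add)
  obtain s where s: "\<And>n::nat. simple_function M (s n)" "\<And>n t. t \<in> space M \<Longrightarrow> s n t \<in> tdual"
    "AE t in M. limitin \<tau> (\<lambda>n. s n t) (m t) sequentially"
    using m unfolding strongly_integrable_def by blast
  obtain s' where s': "\<And>n::nat. simple_function M (s' n)" "\<And>n t. t \<in> space M \<Longrightarrow> s' n t \<in> tdual"
    "AE t in M. limitin \<tau> (\<lambda>n. s' n t) (m' t) sequentially"
    using m' unfolding strongly_integrable_def by blast
  show "\<exists>s. (\<forall>n::nat. simple_function M (s n) \<and> (\<forall>t\<in>space M. s n t \<in> tdual)) \<and>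
          (AE t in M. limitin \<tau> (\<lambda>n. s n t) (\<lambda>v. m t v + m' t v) sequentially)"
  proof (intro exI[of _ "\<lambda>n t v. s n t v + s' n t v"] conjI allI ballI)
    show "simple_function M (\<lambda>t v. s n t v + s' n t v)" for n
      by (rule simple_function_compose2[OF s(1) s'(1), of "\<lambda>a b v. a v + b v"])
    show "(\<lambda>v. s n t v + s' n t v) \<in> tdual" if "t \<in> space M" for n t
      by (intro tdual_add s(2) s'(2) that)
    show "AE t in M. limitin \<tau> (\<lambda>n v. s n t v + s' n t v) (\<lambda>v. m t v + m' t v) sequentially"
      using s(3) s'(3) by eventually_elim (rule compatible_limit_add[OF \<tau>])
  qed
  fix B :: "'a set" assume B: "vn_bounded B \<and> balanced B"
  have "upper_integral M (\<lambda>t. SUP x\<in>B. ereal (m t x)) < \<infinity>" "upper_integral M (\<lambda>t. SUP x\<in>B. ereal (m' t x)) < \<infinity>"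
    using m m' B unfolding strongly_integrable_def by auto
  note bounds = this
  obtain g where g: "integrable M g" "AE t in M. (SUP x\<in>B. ereal (m t x)) \<le> ereal (g t)"
    by (rule upper_integral_majorant[OF bounds(1)])
  obtain g' where g': "integrable M g'" "AE t in M. (SUP x\<in>B. ereal (m' t x)) \<le> ereal (g' t)"
    by (rule upper_integral_majorant[OF bounds(2)])
  have "upper_integral M (\<lambda>t. SUP x\<in>B. ereal (m t x + m' t x)) \<le> ereal (\<integral>t. g t + g' t \<partial>M)"
  proof (rule upper_integral_le)
    show "AE t in M. (SUP x\<in>B. ereal (m t x + m' t x)) \<le> ereal (g t + g' t)"
      using g(2) g'(2)
    proof eventually_elim
      case (elim t)
      show ?case
      proof (rule SUP_least)
        fix v assume v: "v \<in> B"
        have "ereal (m t v) \<le> ereal (g t)" "ereal (m' t v) \<le> ereal (g' t)"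
          using elim v by (auto simp: SUP_le_iff)
        then show "ereal (m t v + m' t v) \<le> ereal (g t + g' t)" by simp
      qed
    qed
  qed (use g g' in simp)
  moreover have "0 \<le> upper_integral M (\<lambda>t. SUP x\<in>B. ereal (m t x + m' t x))"
    by (rule upper_integral_sup_nonneg[OF td conjunct2[OF B]])
  ultimately show "\<bar>upper_integral M (\<lambda>t. SUP x\<in>B. ereal (m t x + m' t x))\<bar> \<noteq> \<infinity>" by auto
qed

lemma strongly_integrable_sum:
  assumes \<tau>: "compatible_topology \<tau>" and J: "finite J"
    and \<phi>: "\<And>i. i \<in> J \<Longrightarrow> \<phi> i \<in> tdual" and c: "\<And>i. i \<in> J \<Longrightarrow> integrable M (c i)"
  shows "strongly_integrable M \<tau> (\<lambda>t v. \<Sum>i\<in>J. c i t * \<phi> i v)"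
  using J \<phi> c
proof (induction J rule: finite_induct)
  case empty
  then show ?case using strongly_integrable_cmult[OF \<tau> tdual_0, of M "\<lambda>t. 0"] by simp
next
  case (insert i J)
  have "strongly_integrable M \<tau> (\<lambda>t v. c i t * \<phi> i v + (\<Sum>i\<in>J. c i t * \<phi> i v))"
    by (intro strongly_integrable_add[OF \<tau>] strongly_integrable_cmult[OF \<tau>] insert.IH insert.prems) auto
  then show ?case using insert.hyps by simp
qed

lemma vn_bounded_balanced_segment:
  fixes z :: "'x::locally_convex_space"
  shows "vn_bounded ((\<lambda>c. c *\<^sub>R z) ` {-1..1})" and "balanced ((\<lambda>c. c *\<^sub>R z) ` {-1..1})"
proof -
  show "vn_bounded ((\<lambda>c. c *\<^sub>R z) ` {-1..1})"
    unfolding vn_bounded_def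
  proof (intro allI impI)
    fix U :: "'x set" assume U: "open U \<and> 0 \<in> U"
    have "((\<lambda>c. c *\<^sub>R z) \<longlongrightarrow> 0 *\<^sub>R z) (nhds (0::real))"
      by (rule tendsto_scaleR_lcs[OF filterlim_ident tendsto_const])
    then have "\<forall>\<^sub>F c in nhds (0::real). c *\<^sub>R z \<in> U" by (rule topological_tendstoD) (use U in auto)
    then have "\<exists>d>0. \<forall>c. dist c 0 < d \<longrightarrow> c *\<^sub>R z \<in> U" by (simp only: eventually_nhds_metric)
    then obtain d where d: "d > 0" "\<forall>c. dist c 0 < d \<longrightarrow> c *\<^sub>R z \<in> U" by blast
    show "\<exists>s>0. \<forall>r>s. (\<lambda>c. c *\<^sub>R z) ` {-1..1} \<subseteq> (\<lambda>x. r *\<^sub>R x) ` U"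
    proof (intro exI[of _ "1 / d"] conjI allI impI)
      show "0 < 1 / d" using d by simp
      fix r assume r: "1 / d < r"
      have "0 < 1 / d" using d by simp
      then have r0: "r > 0" using r by linarith
      show "(\<lambda>c. c *\<^sub>R z) ` {-1..1} \<subseteq> (\<lambda>x. r *\<^sub>R x) ` U"
      proof
        fix v assume "v \<in> (\<lambda>c. c *\<^sub>R z) ` {-1..1}"
        then obtain c where c: "v = c *\<^sub>R z" "c \<in> {-1..1}" by (rule imageE)
        have "\<bar>c\<bar> \<le> 1" using c(2) by auto
        then have "\<bar>c / r\<bar> \<le> 1 / r" using r0 by (simp add: divide_right_mono)
        also have "\<dots> < d" using r r0 d by (simp add: field_simps)
        finally have "dist (c / r) 0 < d" by (simp only: dist_real_def diff_0_right)
        then have "(c / r) *\<^sub>R z \<in> U" using d(2) by blast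
        moreover have "v = r *\<^sub>R ((c / r) *\<^sub>R z)" using r0 c by simp
        ultimately show "v \<in> (\<lambda>x. r *\<^sub>R x) ` U" by blast
      qed
    qed
  qed
  show "balanced ((\<lambda>c. c *\<^sub>R z) ` {-1..1})"
    unfolding balanced_def
  proof (intro conjI allI impI subsetI)
    show "(\<lambda>c. c *\<^sub>R z) ` {-1..1} \<noteq> {}" by simp
    fix k :: real and v assume k: "\<bar>k\<bar> \<le> 1" and "v \<in> (\<lambda>x. k *\<^sub>R x) ` (\<lambda>c. c *\<^sub>R z) ` {-1..1}"
    then obtain c where "c \<in> {-1..1}" "v = k *\<^sub>R (c *\<^sub>R z)" by blast
    then have c: "\<bar>c\<bar> \<le> 1" "v = (k * c) *\<^sub>R z" by (auto simp: abs_le_iff)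
    have "\<bar>k * c\<bar> \<le> 1" unfolding abs_mult using k c(1) by (simp add: mult_le_one)
    then show "v \<in> (\<lambda>c. c *\<^sub>R z) ` {-1..1}" unfolding c(2) by (intro imageI) (simp add: abs_le_iff)
  qed
qed

lemma complete_measure_AE_measurable:
  fixes g h :: "'t \<Rightarrow> real"
  assumes M: "complete_measure M" and g: "g \<in> borel_measurable M" and eq: "AE t in M. g t = h t"
  shows "h \<in> borel_measurable M"
proof (rule measurableI)
  fix A :: "real set" assume A: "A \<in> sets borel"
  show "h -` A \<inter> space M \<in> sets M"
  proof (rule complete_measure.in_sets_AE[OF M])
    show "g -` A \<inter> space M \<in> sets M" by (rule measurable_sets[OF g A])
    show "AE t in M. (t \<in> g -` A \<inter> space M) = (t \<in> h -` A \<inter> space M)"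
      using eq by eventually_elim auto
  qed simp
qed simp

text \<open>Measurability comes from the approximating simple functions, since evaluation at \<open>z\<close> is continuous for
the compatible topology; the integrable bound comes from the bounded balanced segment between \<open>- z\<close> and \<open>z\<close>.\<close>

lemma strongly_integrable_pairing:
  assumes M: "complete_measure M" and \<tau>: "compatible_topology \<tau>" and m: "strongly_integrable M \<tau> m"
  shows "integrable M (\<lambda>t. m t z)"
proof -
  obtain s where s: "\<And>n::nat. simple_function M (s n)"
    "AE t in M. limitin \<tau> (\<lambda>n. s n t) (m t) sequentially"
    using m unfolding strongly_integrable_def by blast
  have lim: "AE t in M. (\<lambda>n. s n t z) \<longlonglongrightarrow> m t z"
    using s(2)
  proof eventually_elim
    case (elim t)
    have "limitin euclideanreal ((\<lambda>\<phi>. \<phi> z) \<circ> (\<lambda>n. s n t)) (m t z) sequentially"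
      by (rule continuous_map_limit[OF compatible_evaluation[OF \<tau>] elim])
    then show ?case by (simp add: o_def)
  qed
  have "(\<lambda>t. s n t z) \<in> borel_measurable M" for n
    by (rule borel_measurable_simple_function) (rule simple_function_compose1[OF s(1), of "\<lambda>\<phi>. \<phi> z"])
  then have "(\<lambda>t. lim (\<lambda>n. s n t z)) \<in> borel_measurable M" by (rule borel_measurable_lim_metric)
  moreover have "AE t in M. lim (\<lambda>n. s n t z) = m t z"
    using lim by eventually_elim (rule limI)
  ultimately have meas: "(\<lambda>t. m t z) \<in> borel_measurable M" by (rule complete_measure_AE_measurable[OF M])
  have "\<bar>upper_integral M (\<lambda>t. SUP x\<in>(\<lambda>c. c *\<^sub>R z) ` {-1..1}. ereal (m t x))\<bar> \<noteq> \<infinity>"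
    by (rule conjunct2[OF conjunct2[OF m[unfolded strongly_integrable_def]], rule_format])
      (intro conjI vn_bounded_balanced_segment)
  then have "upper_integral M (\<lambda>t. SUP x\<in>(\<lambda>c. c *\<^sub>R z) ` {-1..1}. ereal (m t x)) < \<infinity>" by auto
  then obtain g where g: "integrable M g"
    "AE t in M. (SUP x\<in>(\<lambda>c. c *\<^sub>R z) ` {-1..1}. ereal (m t x)) \<le> ereal (g t)"
    by (rule upper_integral_majorant)
  have "AE t in M. norm (m t z) \<le> norm (g t)"
    using AE_space g(2)
  proof eventually_elim
    case (elim t)
    have "linear (m t)" using m elim(1) by (auto simp: strongly_integrable_def tdual_def)
    then have neg: "m t (- z) = - m t z" by (rule linear_neg)
    have "z \<in> (\<lambda>c. c *\<^sub>R z) ` {-1..1}" "- z \<in> (\<lambda>c. c *\<^sub>R z) ` {-1..1}"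
      by (auto intro: image_eqI[of _ _ "1::real"] image_eqI[of _ _ "- 1::real"])
    then have "ereal (m t z) \<le> ereal (g t)" "ereal (m t (- z)) \<le> ereal (g t)"
      using elim(2) unfolding SUP_le_iff by blast+
    then show ?case using neg by simp
  qed
  then show ?thesis by (rule Bochner_Integration.integrable_bound[OF g(1) meas])
qed


section \<open>Epsilon-subgradients of the integral functional\<close>

lemma eps_subdiffD:
  assumes "\<phi> \<in> eps_subdiff \<eta> g x"
  shows "\<bar>g x\<bar> \<noteq> \<infinity>" "\<phi> \<in> tdual" "ereal (\<phi> (y - x)) \<le> g y - g x + ereal \<eta>"
  using assms by (auto simp: eps_subdiff_def split: if_splits)

lemma eps_subdiff_restrict_iff:
  assumes "x \<in> G" "g x = ereal a"
  shows "\<phi> \<in> eps_subdiff \<eta> (\<lambda>y. g y + delta G y) x \<longleftrightarrow>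
    \<phi> \<in> tdual \<and> (\<forall>y\<in>G. ereal (\<phi> (y - x) + a - \<eta>) \<le> g y)"
proof -
  have "(ereal (\<phi> (y - x)) \<le> (g y + delta G y) - (g x + delta G x) + ereal \<eta>) \<longleftrightarrow>
      (y \<in> G \<longrightarrow> ereal (\<phi> (y - x) + a - \<eta>) \<le> g y)" for y
    using assms by (cases "g y") (auto simp: delta_def)
  then show ?thesis using assms by (simp add: eps_subdiff_def delta_def Ball_def)
qed

lemma eps_subdiff_restrict_finite:
  assumes "\<phi> \<in> eps_subdiff \<eta> (\<lambda>y. g y + delta G y) x"
  shows "x \<in> G" "\<exists>a. g x = ereal a"
  using eps_subdiffD(1)[OF assms] by (cases "g x"; auto simp: delta_def split: if_splits)+

lemma eps_normal_iff:
  "\<psi> \<in> eps_normal \<eta> A x \<longleftrightarrow> x \<in> A \<and> \<psi> \<in> tdual \<and> (\<forall>y\<in>A. \<psi> (y - x) \<le> \<eta>)"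
proof (cases "x \<in> A")
  case True
  have "(ereal (\<psi> (y - x)) \<le> delta A y - delta A x + ereal \<eta>) \<longleftrightarrow> (y \<in> A \<longrightarrow> \<psi> (y - x) \<le> \<eta>)" for y
    using True by (auto simp: delta_def)
  then show ?thesis using True by (auto simp: eps_normal_def eps_subdiff_def delta_def)
next
  case False
  then show ?thesis by (simp add: eps_normal_def eps_subdiff_def delta_def)
qed

lemma integral_subgradient_le:
  assumes M: "complete_measure M" "sigma_finite_measure M" and \<tau>: "compatible_topology \<tau>"
    and f: "convex_normal_integrand M f" and fin: "\<bar>integral_functional M f x\<bar> \<noteq> \<infinity>"
    and m: "strongly_integrable M \<tau> m" and l: "integrable M l"
    and sub: "AE t in M. m t \<in> eps_subdiff (l t) (\<lambda>y. f t y + delta G y) x" and y: "y \<in> G"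
  shows "ereal (weak_integral M m (y - x)) \<le> integral_functional M f y - integral_functional M f x + ereal (\<integral>t. l t \<partial>M)"
proof -
  define F where "F t = real_of_ereal (f t x)" for t
  have "AE t in M. f t \<in> Gamma0" using f by (simp add: convex_normal_integrand_def)
  then have "AE t in M. f t x \<noteq> - \<infinity>" by eventually_elim (simp add: Gamma0_def)
  note * = sigma_finite_measure.upper_integral_finite[OF M(2) convex_normal_section[OF f] this fin[unfolded integral_functional_def]]
  have F: "integrable M F" "AE t in M. f t x = ereal (F t)" "integral_functional M f x = ereal (\<integral>t. F t \<partial>M)"
    using * by (simp_all add: F_def[abs_def] integral_functional_def)
  have mi: "integrable M (\<lambda>t. m t (y - x))" by (rule strongly_integrable_pairing[OF M(1) \<tau> m])
  have "AE t in M. ereal (m t (y - x) + F t - l t) \<le> f t y"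
    using sub F(2)
  proof eventually_elim
    case (elim t)
    show ?case
      using elim(1) y unfolding eps_subdiff_restrict_iff[where g = "f t", OF eps_subdiff_restrict_finite(1)[OF elim(1)] elim(2)] by blast
  qed
  then have "ereal (\<integral>t. m t (y - x) + F t - l t \<partial>M) \<le> integral_functional M f y"
    unfolding integral_functional_def by (intro upper_integral_ge) (use mi F l in simp)
  then have "ereal (weak_integral M m (y - x) + (\<integral>t. F t \<partial>M) - (\<integral>t. l t \<partial>M)) \<le> integral_functional M f y"
    using mi F(1) l by (simp add: weak_integral_def)
  then show ?thesis unfolding F(3) by (cases "integral_functional M f y") auto
qed

text \<open>Weights on \<open>x\<close> and the points \<open>x + b\<close> that represent \<open>z\<close>: a weighted sum of values becomes the value at \<open>x\<close> plus a
linear functional, expressed through the dual system \<open>\<theta>\<close>, of the displacement \<open>z - x\<close>.\<close>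

lemma affine_coordinates:
  fixes x :: "'x::real_vector"
  assumes B: "finite B" "independent B" and z: "z - x \<in> span B"
    and \<chi>: "\<And>b. b \<in> B \<Longrightarrow> linear (\<theta> b)" "\<And>b b'. b \<in> B \<Longrightarrow> b' \<in> B \<Longrightarrow> \<theta> b b' = (if b = b' then 1 else 0 :: real)"
  obtains c where "(\<Sum>p\<in>insert x ((+) x ` B). c p) = 1"
    "(\<Sum>p\<in>insert x ((+) x ` B). c p *\<^sub>R p) = z"
    "\<And>h. (\<Sum>p\<in>insert x ((+) x ` B). c p * h p) = h x + (\<Sum>b\<in>B. (h (x + b) - h x) * \<theta> b (z - x))"
proof -
  have B0: "0 \<notin> B" using B(2) dependent_zero by blast
  obtain a where a: "z - x = (\<Sum>b\<in>B. a b *\<^sub>R b)" using z unfolding span_finite[OF B(1)] by blast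
  have \<theta>a: "\<theta> b (z - x) = a b" if b: "b \<in> B" for b
  proof -
    have "\<theta> b (z - x) = (\<Sum>b'\<in>B. a b' * \<theta> b b')"
      unfolding a by (simp add: linear_sum[OF \<chi>(1)[OF b]] linear_scale[OF \<chi>(1)[OF b]])
    also have "\<dots> = (\<Sum>b'\<in>B. if b' = b then a b else 0)" by (rule sum.cong) (auto simp: \<chi>(2) b)
    finally show ?thesis using b B(1) by simp
  qed
  define c where "c p = (if p = x then 1 - (\<Sum>b\<in>B. a b) else a (p - x))" for p
  have notin: "x \<notin> (+) x ` B" using B0 by auto
  have fin: "finite ((+) x ` B)" using B(1) by simp
  have inj: "inj_on ((+) x) B" by simp
  have c_b: "c (x + b) = a b" if "b \<in> B" for b using that B0 by (auto simp: c_def)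
  have sumP: "(\<Sum>p\<in>insert x ((+) x ` B). c p * h p) = h x + (\<Sum>b\<in>B. a b * (h (x + b) - h x))" for h :: "'x \<Rightarrow> real"
  proof -
    have "(\<Sum>p\<in>insert x ((+) x ` B). c p * h p) = c x * h x + (\<Sum>b\<in>B. c (x + b) * h (x + b))"
      unfolding sum.insert[OF fin notin] sum.reindex[OF inj] by simp
    also have "(\<Sum>b\<in>B. c (x + b) * h (x + b)) = (\<Sum>b\<in>B. a b * h (x + b))" by (rule sum.cong) (auto simp: c_b)
    finally show ?thesis
      by (simp add: c_def left_diff_distrib right_diff_distrib sum_subtractf sum_distrib_right)
  qed
  have "(\<Sum>p\<in>insert x ((+) x ` B). c p) = 1" using sumP[of "\<lambda>_. 1"] by simp
  moreover have "(\<Sum>p\<in>insert x ((+) x ` B). c p *\<^sub>R p) = z"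
  proof -
    have "(\<Sum>p\<in>insert x ((+) x ` B). c p *\<^sub>R p) = c x *\<^sub>R x + (\<Sum>b\<in>B. c (x + b) *\<^sub>R (x + b))"
      unfolding sum.insert[OF fin notin] sum.reindex[OF inj] by simp
    also have "(\<Sum>b\<in>B. c (x + b) *\<^sub>R (x + b)) = (\<Sum>b\<in>B. a b *\<^sub>R x + a b *\<^sub>R b)"
      by (rule sum.cong) (auto simp: c_b scaleR_add_right)
    also have "\<dots> = (\<Sum>b\<in>B. a b) *\<^sub>R x + (z - x)" by (simp add: sum.distrib a scaleR_sum_left)
    finally show ?thesis by (simp add: c_def scaleR_diff_left)
  qed
  moreover have "(\<Sum>p\<in>insert x ((+) x ` B). c p * h p) = h x + (\<Sum>b\<in>B. (h (x + b) - h x) * \<theta> b (z - x))" for h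
    unfolding sumP by (simp add: \<theta>a mult.commute)
  ultimately show thesis by (rule that)
qed

lemma upper_integral_null:
  assumes "emeasure M (space M) = 0"
  shows "upper_integral M h = 0"
proof -
  have "AE t in M. P t" for P using assms by (intro AE_I[of _ _ "space M"]) auto
  then show ?thesis using upper_integral_eq[of M "\<lambda>t. 0" h] by (simp add: zero_ereal_def)
qed

text \<open>The affine minorants \<open>u\<close> of \<open>f t\<close> on the affine hull of \<open>A\<close> are split at \<open>x\<close> into the linear part \<open>m\<close>, extended to the
whole space by the dual system, and the gap \<open>l\<close> at \<open>x\<close>. The rest of \<open>\<phi>\<close> is \<open>\<psi>\<close>. If the measure vanishes then so
does the integral functional, and \<open>\<phi>\<close> itself is the normal vector.\<close>

lemma eps_subgradient_decomposition:
  fixes f :: "'t \<Rightarrow> 'x::locally_convex_space \<Rightarrow> ereal"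
  assumes M: "sigma_finite_measure M" and \<tau>: "compatible_topology \<tau>"
    and f: "convex_normal_integrand M f" and \<epsilon>: "\<epsilon> \<ge> 0"
    and \<phi>: "\<phi> \<in> eps_subdiff \<epsilon> (integral_functional M f) x" and L: "L \<in> fin_dim_subspaces x"
  defines "A \<equiv> L \<inter> edom (integral_functional M f)"
  obtains \<epsilon>\<^sub>1 \<epsilon>\<^sub>2 l m \<psi> where "\<epsilon> = \<epsilon>\<^sub>1 + \<epsilon>\<^sub>2" "\<epsilon>\<^sub>1 \<ge> 0" "\<epsilon>\<^sub>2 \<ge> 0" "l \<in> L1_budget M \<epsilon>\<^sub>1"
    "strongly_integrable M \<tau> m"
    "AE t in M. m t \<in> eps_subdiff (l t) (\<lambda>y. f t y + delta (affine hull A) y) x"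
    "weak_integral M m \<in> tdual" "\<psi> \<in> eps_normal \<epsilon>\<^sub>2 A x" "\<phi> = (\<lambda>v. weak_integral M m v + \<psi> v)"
proof (cases "emeasure M (space M) = 0")
  case True
  have td: "\<phi> \<in> tdual" by (rule eps_subdiffD(2)[OF \<phi>])
  have I0: "integral_functional M f y = 0" for y
    unfolding integral_functional_def by (rule upper_integral_null[OF True])
  have AE: "AE t in M. Q t" for Q using True by (intro AE_I[of _ _ "space M"]) auto
  have "x \<in> A" using L I0 by (simp add: A_def edom_def fin_dim_subspaces_def)
  moreover have "\<phi> (y - x) \<le> \<epsilon>" for y using eps_subdiffD(3)[OF \<phi>, of y] I0 by simp
  ultimately have \<psi>: "\<phi> \<in> eps_normal \<epsilon> A x" using td by (simp add: eps_normal_iff)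
  have 0: "strongly_integrable M \<tau> (\<lambda>t v. 0 * (\<lambda>v. 0) v)"
    by (rule strongly_integrable_cmult[OF \<tau> tdual_0]) simp
  show thesis
    by (rule that[of 0 \<epsilon> "\<lambda>t. 0" "\<lambda>t v. 0" \<phi>])
      (use \<epsilon> 0 \<psi> tdual_0 in \<open>auto simp: L1_budget_def weak_integral_def intro: AE\<close>)
next
  case False
  let ?I = "integral_functional M f"
  have td: "\<phi> \<in> tdual" by (rule eps_subdiffD(2)[OF \<phi>])
  have lin: "linear \<phi>" using td by (simp add: tdual_def)
  obtain i where i: "?I x = ereal i" using eps_subdiffD(1)[OF \<phi>] by (cases "?I x") auto
  have \<phi>I: "ereal (\<phi> (y - x) + i - \<epsilon>) \<le> ?I y" for y
    using eps_subdiffD(3)[OF \<phi>, of y] unfolding i by (cases "?I y") auto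
  obtain C where C: "finite C" "span C = L" and subL: "subspace L" and xL: "x \<in> L"
    using L by (auto simp: fin_dim_subspaces_def)
  have xA: "x \<in> A" using xL i by (simp add: A_def edom_def)
  define V where "V = (\<lambda>a. a - x) ` A"
  obtain B where B: "B \<subseteq> V" "independent B" "V \<subseteq> span B" using maximal_independent_subset[of V] by blast
  have "V \<subseteq> L" using subspace_diff[OF subL _ xL] by (auto simp: V_def A_def)
  then have "B \<subseteq> span C" using B(1) C(2) by blast
  then have finB: "finite B" using independent_span_bound[OF C(1) B(2)] by blast
  obtain \<theta> where \<theta>: "\<And>b. b \<in> B \<Longrightarrow> \<theta> b \<in> tdual"
    "\<And>b b'. b \<in> B \<Longrightarrow> b' \<in> B \<Longrightarrow> \<theta> b b' = (if b = b' then 1 else 0)"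
    using dual_system[OF finB B(2)] by blast
  have \<theta>lin: "\<And>b. b \<in> B \<Longrightarrow> linear (\<theta> b)" using \<theta>(1) by (simp add: tdual_def)
  define P where "P = insert x ((+) x ` B)"
  have PA: "P \<subseteq> A" using xA B(1) by (auto simp: P_def V_def)
  define \<Phi> where "\<Phi> p = \<phi> (p - x) + i - \<epsilon>" for p
  have \<Phi>_sum: "(\<Sum>p\<in>P. b p * \<Phi> p) = \<phi> ((\<Sum>p\<in>P. b p *\<^sub>R p) - x) + i - \<epsilon>" if b: "(\<Sum>p\<in>P. b p) = 1" for b
  proof -
    have "(\<Sum>p\<in>P. b p * \<Phi> p) = (\<Sum>p\<in>P. b p * \<phi> p + b p * (i - \<epsilon> - \<phi> x))"
      by (rule sum.cong) (auto simp: \<Phi>_def linear_diff[OF lin] algebra_simps)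
    also have "\<dots> = (\<Sum>p\<in>P. b p * \<phi> p) + (\<Sum>p\<in>P. b p) * (i - \<epsilon> - \<phi> x)"
      unfolding sum.distrib sum_distrib_right by (rule refl)
    also have "(\<Sum>p\<in>P. b p * \<phi> p) = \<phi> (\<Sum>p\<in>P. b p *\<^sub>R p)"
      by (simp add: linear_sum[OF lin] linear_scale[OF lin])
    finally show ?thesis by (simp add: b linear_diff[OF lin])
  qed
  interpret weighted_integrand M f P \<Phi>
  proof (unfold weighted_integrand_def weighted_integrand_axioms_def, intro conjI allI impI)
    show "sigma_finite_measure M" by (rule M)
    show "finite P" using finB by (simp add: P_def)
    show "P \<noteq> {}" by (simp add: P_def)
    show "?I p < \<infinity>" if "p \<in> P" for p using that PA by (auto simp: A_def edom_def)
    show "ereal (\<Sum>p\<in>P. b p * \<Phi> p) \<le> ?I (\<Sum>p\<in>P. b p *\<^sub>R p)" if "(\<Sum>p\<in>P. b p) = 1" for b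
      unfolding \<Phi>_sum[OF that] by (rule \<phi>I)
  qed (use f False in auto)
  obtain u where u: "\<And>p. p \<in> P \<Longrightarrow> integrable M (u p)"
    "AE t in M. \<forall>b. (\<Sum>p\<in>P. b p) = 1 \<longrightarrow> ereal (\<Sum>p\<in>P. b p * u p t) \<le> f t (\<Sum>p\<in>P. b p *\<^sub>R p)"
    "\<And>b. (\<Sum>p\<in>P. b p) = 1 \<Longrightarrow> ?I (\<Sum>p\<in>P. b p *\<^sub>R p) < \<infinity> \<Longrightarrow>
      (\<Sum>p\<in>P. b p * \<Phi> p) \<le> (\<Sum>p\<in>P. b p * (\<integral>t. u p t \<partial>M))"
    by (rule integrable_affine_minorant) (rule that)
  have xP: "x \<in> P" by (simp add: P_def)
  have bP: "x + b \<in> P" if "b \<in> B" for b using that by (simp add: P_def)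
  have coords: "\<exists>c. (\<Sum>p\<in>P. c p) = 1 \<and> (\<Sum>p\<in>P. c p *\<^sub>R p) = z \<and>
      (\<forall>h. (\<Sum>p\<in>P. c p * h p) = h x + (\<Sum>b\<in>B. (h (x + b) - h x) * \<theta> b (z - x)))" if "z - x \<in> span B" for z
    using affine_coordinates[OF finB B(2) that \<theta>lin \<theta>(2)] unfolding P_def by blast
  have hull: "z - x \<in> span B" if z: "z \<in> affine hull A" for z
  proof -
    have "A \<subseteq> {z. z - x \<in> span B}" using B(3) by (auto simp: V_def)
    moreover have "affine {z. z - x \<in> span B}"
      unfolding affine_def
    proof (intro ballI allI impI)
      fix y z and v w :: real
      assume yz: "y \<in> {z. z - x \<in> span B}" "z \<in> {z. z - x \<in> span B}" and vw: "v + w = 1"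
      have "v *\<^sub>R y + w *\<^sub>R z - x = v *\<^sub>R y + w *\<^sub>R z - (v + w) *\<^sub>R x" by (simp add: vw)
      also have "\<dots> = v *\<^sub>R (y - x) + w *\<^sub>R (z - x)" by (simp add: algebra_simps)
      also have "\<dots> \<in> span B" by (intro span_add span_scale) (use yz in auto)
      finally show "v *\<^sub>R y + w *\<^sub>R z \<in> {z. z - x \<in> span B}" by simp
    qed
    ultimately have "affine hull A \<subseteq> {z. z - x \<in> span B}" by (rule hull_minimal)
    then show ?thesis using z by blast
  qed
  define m where "m t v = (\<Sum>b\<in>B. (u (x + b) t - u x t) * \<theta> b v)" for t v
  \<comment> \<open>The maximum matters only on a null set, but budgets are nonnegative at every point.\<close>
  define l where "l t = max 0 (F x t - u x t)" for t
  define s where "s b = (\<integral>t. u (x + b) t \<partial>M) - (\<integral>t. u x t \<partial>M)" for b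
  have m_int: "strongly_integrable M \<tau> m"
    unfolding m_def by (rule strongly_integrable_sum[OF \<tau> finB \<theta>(1)]) (use u(1) xP bP in auto)
  have m_weak: "weak_integral M m = (\<lambda>v. \<Sum>b\<in>B. s b * \<theta> b v)"
    unfolding weak_integral_def m_def s_def using u(1) xP bP by (simp add: fun_eq_iff)
  have m_td: "weak_integral M m \<in> tdual" unfolding m_weak by (rule tdual_sum[OF finB \<theta>(1)])
  have h_le: "AE t in M. \<forall>z. z - x \<in> span B \<longrightarrow> ereal (u x t + m t (z - x)) \<le> f t z"
    using u(2)
  proof eventually_elim
    case (elim t)
    show ?case
    proof (intro allI impI)
      fix z assume "z - x \<in> span B"
      then obtain c where c: "(\<Sum>p\<in>P. c p) = 1" "(\<Sum>p\<in>P. c p *\<^sub>R p) = z"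
        "\<And>h. (\<Sum>p\<in>P. c p * h p) = h x + (\<Sum>b\<in>B. (h (x + b) - h x) * \<theta> b (z - x))"
        using coords[of z] by blast
      then show "ereal (u x t + m t (z - x)) \<le> f t z"
        using elim[rule_format, OF c(1)] unfolding c(2) c(3) by (simp add: m_def)
    qed
  qed
  have tdm: "m t \<in> tdual" for t unfolding m_def by (rule tdual_sum[OF finB \<theta>(1)])
  have x_hull: "x \<in> affine hull A" using xA by (rule hull_inc)
  have sub: "AE t in M. m t \<in> eps_subdiff (l t) (\<lambda>y. f t y + delta (affine hull A) y) x"
    using h_le AE_F[OF xP]
  proof eventually_elim
    case (elim t)
    show ?case
      unfolding eps_subdiff_restrict_iff[where g = "f t", OF x_hull elim(2)]
    proof (intro conjI ballI tdm)
      fix y assume "y \<in> affine hull A"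
      then have "ereal (u x t + m t (y - x)) \<le> f t y" using elim(1) hull by blast
      moreover have "m t (y - x) + F x t - l t \<le> u x t + m t (y - x)" by (simp add: l_def)
      ultimately show "ereal (m t (y - x) + F x t - l t) \<le> f t y"
        by (meson ereal_less_eq(3) order_trans)
    qed
  qed
  have l_eq: "AE t in M. l t = F x t - u x t"
    using h_le AE_F[OF xP]
  proof eventually_elim
    case (elim t)
    have "ereal (u x t + m t (x - x)) \<le> f t x" using elim(1) span_zero[of B] by (metis diff_self)
    moreover have "m t (x - x) = 0" using tdm[of t] linear_0 by (auto simp: tdual_def)
    ultimately show ?case using elim(2) by (simp add: l_def)
  qed
  have l_int: "integrable M l" unfolding l_def[abs_def] using integrable_F[OF xP] u(1)[OF xP] by simp
  have "(\<integral>t. l t \<partial>M) = (\<integral>t. F x t - u x t \<partial>M)"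
    by (rule integral_cong_AE) (use l_int integrable_F[OF xP] u(1)[OF xP] l_eq in auto)
  then have l_val: "(\<integral>t. l t \<partial>M) = i - (\<integral>t. u x t \<partial>M)"
    using integrable_F[OF xP] u(1)[OF xP] integral_F[OF xP] i by simp
  define \<psi> where "\<psi> v = \<phi> v + (\<Sum>b\<in>B. (- s b) * \<theta> b v)" for v
  have \<psi>_td: "\<psi> \<in> tdual" unfolding \<psi>_def by (intro tdual_add td tdual_sum finB \<theta>(1))
  have \<psi>_bound: "\<psi> (y - x) \<le> \<epsilon> - (\<integral>t. l t \<partial>M)" if y: "y \<in> A" for y
  proof -
    obtain c where c: "(\<Sum>p\<in>P. c p) = 1" "(\<Sum>p\<in>P. c p *\<^sub>R p) = y"
      "\<And>h. (\<Sum>p\<in>P. c p * h p) = h x + (\<Sum>b\<in>B. (h (x + b) - h x) * \<theta> b (y - x))"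
      using coords[OF hull[OF hull_inc[OF y]]] by blast
    have "?I y < \<infinity>" using y by (simp add: A_def edom_def)
    then have "(\<Sum>p\<in>P. c p * \<Phi> p) \<le> (\<Sum>p\<in>P. c p * (\<integral>t. u p t \<partial>M))" using u(3)[OF c(1)] c(2) by simp
    then have "\<phi> (y - x) + i - \<epsilon> \<le> (\<integral>t. u x t \<partial>M) + (\<Sum>b\<in>B. s b * \<theta> b (y - x))"
      unfolding \<Phi>_sum[OF c(1)] c(2) by (simp add: c(3) s_def)
    then show ?thesis by (simp add: \<psi>_def l_val sum_negf)
  qed
  have l0: "0 \<le> (\<integral>t. l t \<partial>M)" by (rule integral_nonneg_AE) (simp add: l_def)
  have "\<psi> (x - x) = 0" using \<psi>_td linear_0 by (auto simp: tdual_def)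
  then have l\<epsilon>: "(\<integral>t. l t \<partial>M) \<le> \<epsilon>" using \<psi>_bound[OF xA] by simp
  show thesis
  proof (rule that[of "\<integral>t. l t \<partial>M" "\<epsilon> - (\<integral>t. l t \<partial>M)" l m \<psi>])
    have "0 \<le> l t" for t by (simp add: l_def)
    then show "l \<in> L1_budget M (\<integral>t. l t \<partial>M)" using l_int by (simp add: L1_budget_def)
    show "\<psi> \<in> eps_normal (\<epsilon> - (\<integral>t. l t \<partial>M)) A x" using xA \<psi>_td \<psi>_bound by (simp add: eps_normal_iff)
    show "\<phi> = (\<lambda>v. weak_integral M m v + \<psi> v)" unfolding m_weak \<psi>_def by (simp add: sum_negf)
  qed (use l0 l\<epsilon> m_int sub m_td in auto)
qed


text \<open>On \<open>A\<close> the functional \<open>\<rho>(t) \<psi>\<close> costs at most \<open>\<rho>(t) \<epsilon>\<^sub>2\<close>, so adding it to \<open>m\<close> raises the budget by \<open>\<epsilon>\<^sub>2 \<rho>\<close>, of integral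
\<open>\<epsilon>\<^sub>2\<close>, once the restriction is to \<open>A\<close> and no longer to its affine hull.\<close>

lemma absorb_normal_vector:
  assumes \<tau>: "compatible_topology \<tau>" and m: "strongly_integrable M \<tau> m"
    and l: "l \<in> L1_budget M \<epsilon>\<^sub>1" and \<epsilon>\<^sub>2: "\<epsilon>\<^sub>2 \<ge> 0"
    and sub: "AE t in M. m t \<in> eps_subdiff (l t) (\<lambda>y. f t y + delta (affine hull A) y) x"
    and \<psi>: "\<psi> \<in> eps_normal \<epsilon>\<^sub>2 A x"
    and m_td: "weak_integral M m \<in> tdual" and M: "complete_measure M"
    and \<rho>: "integrable M \<rho>" "\<And>t. 0 \<le> \<rho> t" "(\<integral>t. \<rho> t \<partial>M) = 1"
  shows "(\<lambda>t. l t + \<epsilon>\<^sub>2 * \<rho> t) \<in> L1_budget M (\<epsilon>\<^sub>1 + \<epsilon>\<^sub>2)"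
    and "(\<lambda>v. weak_integral M m v + \<psi> v) \<in> set_valued_integral M \<tau>
      (\<lambda>t. eps_subdiff (l t + \<epsilon>\<^sub>2 * \<rho> t) (\<lambda>y. f t y + delta A y) x)"
proof -
  have \<psi>': "x \<in> A" "\<psi> \<in> tdual" "\<And>y. y \<in> A \<Longrightarrow> \<psi> (y - x) \<le> \<epsilon>\<^sub>2" using \<psi> by (auto simp: eps_normal_iff)
  have l': "integrable M l" "\<And>t. t \<in> space M \<Longrightarrow> 0 \<le> l t" "(\<integral>t. l t \<partial>M) \<le> \<epsilon>\<^sub>1" using l by (auto simp: L1_budget_def)
  show "(\<lambda>t. l t + \<epsilon>\<^sub>2 * \<rho> t) \<in> L1_budget M (\<epsilon>\<^sub>1 + \<epsilon>\<^sub>2)"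
    using l' \<rho> \<epsilon>\<^sub>2 by (simp add: L1_budget_def)
  define m' where "m' t v = m t v + \<rho> t * \<psi> v" for t v
  have m'_int: "strongly_integrable M \<tau> m'"
    unfolding m'_def by (intro strongly_integrable_add strongly_integrable_cmult \<tau> m \<psi>'(2) \<rho>(1))
  have eq: "weak_integral M m' = (\<lambda>v. weak_integral M m v + \<psi> v)"
    using strongly_integrable_pairing[OF M \<tau> m] \<rho> by (simp add: weak_integral_def m'_def fun_eq_iff)
  have "AE t in M. m' t \<in> eps_subdiff (l t + \<epsilon>\<^sub>2 * \<rho> t) (\<lambda>y. f t y + delta A y) x"
    using sub
  proof eventually_elim
    case (elim t)
    have x: "x \<in> affine hull A" using \<psi>'(1) by (rule hull_inc)
    obtain a where a: "f t x = ereal a" using eps_subdiff_restrict_finite(2)[OF elim] by blast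
    have *: "m t \<in> tdual" "\<And>y. y \<in> affine hull A \<Longrightarrow> ereal (m t (y - x) + a - l t) \<le> f t y"
      using elim unfolding eps_subdiff_restrict_iff[where g = "f t", OF x a] by blast+
    show ?case
      unfolding eps_subdiff_restrict_iff[where g = "f t", OF \<psi>'(1) a]
    proof (intro conjI ballI)
      show "m' t \<in> tdual" unfolding m'_def by (intro tdual_add *(1) tdual_cmult \<psi>'(2))
      fix y assume y: "y \<in> A"
      have "\<rho> t * \<psi> (y - x) \<le> \<rho> t * \<epsilon>\<^sub>2" by (rule mult_left_mono[OF \<psi>'(3)[OF y] \<rho>(2)])
      then have "ereal (m' t (y - x) + a - (l t + \<epsilon>\<^sub>2 * \<rho> t)) \<le> ereal (m t (y - x) + a - l t)"
        by (simp add: m'_def mult.commute)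
      then show "ereal (m' t (y - x) + a - (l t + \<epsilon>\<^sub>2 * \<rho> t)) \<le> f t y"
        using *(2)[OF hull_inc[OF y]] by (rule order_trans)
    qed
  qed
  moreover have "(\<lambda>v. weak_integral M m v + \<psi> v) \<in> tdual" by (rule tdual_add[OF m_td \<psi>'(2)])
  ultimately show "(\<lambda>v. weak_integral M m v + \<psi> v) \<in> set_valued_integral M \<tau>
      (\<lambda>t. eps_subdiff (l t + \<epsilon>\<^sub>2 * \<rho> t) (\<lambda>y. f t y + delta A y) x)"
    unfolding set_valued_integral_def using m'_int eq[symmetric] by (intro CollectI exI[of _ m']) simp
qed

lemma linear_bounded_above_zero:
  assumes "linear \<phi>" "\<And>v. \<phi> v \<le> (\<epsilon> :: real)"
  shows "\<phi> v = 0"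
proof (rule ccontr)
  assume ne: "\<phi> v \<noteq> 0"
  have "\<phi> (((\<epsilon> + 1) / \<phi> v) *\<^sub>R v) = \<epsilon> + 1" using ne by (simp add: linear_scale[OF assms(1)])
  then show False using assms(2)[of "((\<epsilon> + 1) / \<phi> v) *\<^sub>R v"] by simp
qed

text \<open>For the zero measure there is no \<open>\<rho>\<close> with integral one; there the integral functional vanishes everywhere and
\<open>\<phi>\<close>, being linear and bounded above, is zero.\<close>

lemma eps_subgradient_as_integral:
  fixes f :: "'t \<Rightarrow> 'x::locally_convex_space \<Rightarrow> ereal"
  assumes M: "complete_measure M" "sigma_finite_measure M" and \<tau>: "compatible_topology \<tau>"
    and f: "convex_normal_integrand M f" and \<epsilon>: "\<epsilon> \<ge> 0"
    and \<phi>: "\<phi> \<in> eps_subdiff \<epsilon> (integral_functional M f) x" and L: "L \<in> fin_dim_subspaces x"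
  shows "\<exists>l\<in>L1_budget M \<epsilon>. \<phi> \<in> set_valued_integral M \<tau> (\<lambda>t. eps_subdiff (l t)
    (\<lambda>y. f t y + delta (L \<inter> edom (integral_functional M f)) y) x)"
proof (cases "emeasure M (space M) = 0")
  case True
  have I0: "integral_functional M f y = 0" for y
    unfolding integral_functional_def by (rule upper_integral_null[OF True])
  have AE: "AE t in M. Q t" for Q using True by (intro AE_I[of _ _ "space M"]) auto
  have "linear \<phi>" using eps_subdiffD(2)[OF \<phi>] by (simp add: tdual_def)
  moreover have "\<phi> v \<le> \<epsilon>" for v using eps_subdiffD(3)[OF \<phi>, of "v + x"] I0 by simp
  ultimately have \<phi>0: "\<phi> = (\<lambda>v. 0)" using linear_bounded_above_zero by blast
  have 0: "strongly_integrable M \<tau> (\<lambda>t v. 0 * (\<lambda>v. 0) v)"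
    by (rule strongly_integrable_cmult[OF \<tau> tdual_0]) simp
  show ?thesis
  proof (rule bexI[of _ "\<lambda>t. 0"])
    show "(\<lambda>t. 0) \<in> L1_budget M \<epsilon>" using \<epsilon> by (simp add: L1_budget_def)
    show "\<phi> \<in> set_valued_integral M \<tau> (\<lambda>t. eps_subdiff 0
        (\<lambda>y. f t y + delta (L \<inter> edom (integral_functional M f)) y) x)"
      unfolding set_valued_integral_def
      by (intro CollectI exI[of _ "\<lambda>t v. 0"] conjI AE)
        (use 0 \<phi>0 tdual_0 in \<open>simp_all add: weak_integral_def\<close>)
  qed
next
  case False
  obtain \<epsilon>\<^sub>1 \<epsilon>\<^sub>2 l m \<psi> where d: "\<epsilon> = \<epsilon>\<^sub>1 + \<epsilon>\<^sub>2" "\<epsilon>\<^sub>1 \<ge> 0" "\<epsilon>\<^sub>2 \<ge> 0" "l \<in> L1_budget M \<epsilon>\<^sub>1"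
    "strongly_integrable M \<tau> m"
    "AE t in M. m t \<in> eps_subdiff (l t) (\<lambda>y. f t y + delta (affine hull (L \<inter> edom (integral_functional M f))) y) x"
    "weak_integral M m \<in> tdual" "\<psi> \<in> eps_normal \<epsilon>\<^sub>2 (L \<inter> edom (integral_functional M f)) x"
    "\<phi> = (\<lambda>v. weak_integral M m v + \<psi> v)"
    by (rule eps_subgradient_decomposition[OF M(2) \<tau> f \<epsilon> \<phi> L]) (rule that)
  obtain \<rho> :: "'t \<Rightarrow> real" where \<rho>: "integrable M \<rho>" "\<And>t. 0 < \<rho> t" "0 < (\<integral>t. \<rho> t \<partial>M)"
    by (rule sigma_finite_measure.positive_integral_weight[OF M(2) False]) (rule that)
  define \<rho>' where "\<rho>' t = \<rho> t / (\<integral>t. \<rho> t \<partial>M)" for t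
  have \<rho>': "integrable M \<rho>'" "\<And>t. 0 \<le> \<rho>' t" "(\<integral>t. \<rho>' t \<partial>M) = 1"
    using \<rho> by (simp_all add: \<rho>'_def[abs_def] less_imp_le)
  note absorbed = absorb_normal_vector[OF \<tau> d(5,4,3,6,8,7) M(1) \<rho>']
  show ?thesis
    by (rule bexI[of _ "\<lambda>t. l t + \<epsilon>\<^sub>2 * \<rho>' t"]) (use absorbed d(1,9) in simp_all)
qed

text \<open>Both formulas are covered: \<open>H\<close> is the affine hull for the first one, the identity with \<open>\<psi> = 0\<close> for the second.
To test \<open>\<phi>\<close> at \<open>y\<close> it suffices to take the subspace spanned by \<open>x\<close> and \<open>y\<close>.\<close>

lemma eps_subdiff_of_integrals:
  fixes f :: "'t \<Rightarrow> 'x::locally_convex_space \<Rightarrow> ereal" and H :: "'x set \<Rightarrow> 'x set"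
  assumes M: "complete_measure M" "sigma_finite_measure M" and \<tau>: "compatible_topology \<tau>"
    and f: "convex_normal_integrand M f" and fin: "\<bar>integral_functional M f x\<bar> \<noteq> \<infinity>"
    and td: "\<phi> \<in> tdual"
    and H: "\<And>S. S \<subseteq> H S"
    and rep: "\<And>L. L \<in> fin_dim_subspaces x \<Longrightarrow> \<exists>\<epsilon>\<^sub>1 \<epsilon>\<^sub>2. \<epsilon> = \<epsilon>\<^sub>1 + \<epsilon>\<^sub>2 \<and> (\<exists>l\<in>L1_budget M \<epsilon>\<^sub>1.
      \<exists>\<alpha> \<psi>. \<phi> = (\<lambda>v. \<alpha> v + \<psi> v) \<and>
        \<alpha> \<in> set_valued_integral M \<tau> (\<lambda>t. eps_subdiff (l t)
          (\<lambda>y. f t y + delta (H (L \<inter> edom (integral_functional M f))) y) x) \<and>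
        \<psi> \<in> eps_normal \<epsilon>\<^sub>2 (L \<inter> edom (integral_functional M f)) x)"
  shows "\<phi> \<in> eps_subdiff \<epsilon> (integral_functional M f) x"
proof -
  let ?I = "integral_functional M f"
  have "ereal (\<phi> (y - x)) \<le> ?I y - ?I x + ereal \<epsilon>" for y
  proof (cases "?I y < \<infinity>")
    case False
    then show ?thesis using fin by (cases "?I x") auto
  next
    case True
    define L where "L = span {x, y}"
    have L: "L \<in> fin_dim_subspaces x" "y \<in> L"
      unfolding fin_dim_subspaces_def L_def
      by (intro CollectI conjI exI[of _ "{x, y}"] subspace_span) (simp_all add: span_base)
    obtain \<epsilon>\<^sub>1 \<epsilon>\<^sub>2 l \<alpha> \<psi> where eq: "\<epsilon> = \<epsilon>\<^sub>1 + \<epsilon>\<^sub>2" and l: "l \<in> L1_budget M \<epsilon>\<^sub>1" and \<phi>: "\<phi> = (\<lambda>v. \<alpha> v + \<psi> v)"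
      and \<alpha>: "\<alpha> \<in> set_valued_integral M \<tau> (\<lambda>t. eps_subdiff (l t) (\<lambda>y. f t y + delta (H (L \<inter> edom ?I)) y) x)"
      and \<psi>: "\<psi> \<in> eps_normal \<epsilon>\<^sub>2 (L \<inter> edom ?I) x"
      using rep[OF L(1)] by blast
    have y: "y \<in> L \<inter> edom ?I" using L True by (simp add: edom_def)
    obtain m where m: "\<alpha> = weak_integral M m" "strongly_integrable M \<tau> m"
      "AE t in M. m t \<in> eps_subdiff (l t) (\<lambda>y. f t y + delta (H (L \<inter> edom ?I)) y) x"
      using \<alpha> unfolding set_valued_integral_def by blast
    have l': "integrable M l" "(\<integral>t. l t \<partial>M) \<le> \<epsilon>\<^sub>1" using l by (auto simp: L1_budget_def)
    have "ereal (\<alpha> (y - x)) \<le> ?I y - ?I x + ereal (\<integral>t. l t \<partial>M)"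
      unfolding m(1)
      by (rule integral_subgradient_le[OF M \<tau> f fin m(2) l'(1) m(3)]) (use y H in blast)
    also have "\<dots> \<le> ?I y - ?I x + ereal \<epsilon>\<^sub>1" by (rule add_left_mono) (use l' in simp)
    finally have 1: "ereal (\<alpha> (y - x)) \<le> ?I y - ?I x + ereal \<epsilon>\<^sub>1" .
    have "\<psi> (y - x) \<le> \<epsilon>\<^sub>2" using \<psi> y by (simp add: eps_normal_iff)
    then have "ereal (\<alpha> (y - x)) + ereal (\<psi> (y - x)) \<le> (?I y - ?I x + ereal \<epsilon>\<^sub>1) + ereal \<epsilon>\<^sub>2"
      by (intro add_mono 1) simp
    then show ?thesis by (simp add: \<phi> eq add.assoc)
  qed
  then show ?thesis using fin td by (simp add: eps_subdiff_def)
qed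

theorem theorem3:
  fixes M :: "'t measure"
    and \<tau> :: "('x::locally_convex_space \<Rightarrow> real) topology"
    and f :: "'t \<Rightarrow> 'x \<Rightarrow> ereal"
    and x :: 'x and \<epsilon> :: real
  assumes "complete_measure M" and "sigma_finite_measure M"
    and "compatible_topology \<tau>"
    and "convex_normal_integrand M f"
    and "\<epsilon> \<ge> 0"
    and "integral_functional M f x \<noteq> -\<infinity>"
  shows "(eps_subdiff \<epsilon> (integral_functional M f) x =
      (\<Inter>L\<in>fin_dim_subspaces x.
        \<Union>(\<epsilon>\<^sub>1, \<epsilon>\<^sub>2)\<in>{(\<epsilon>\<^sub>1, \<epsilon>\<^sub>2). \<epsilon> = \<epsilon>\<^sub>1 + \<epsilon>\<^sub>2 \<and> \<epsilon>\<^sub>1 \<ge> 0 \<and> \<epsilon>\<^sub>2 \<ge> 0}.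
          \<Union>l\<in>L1_budget M \<epsilon>\<^sub>1.
            msum
              (set_valued_integral M \<tau> (\<lambda>t. eps_subdiff (l t)
                 (\<lambda>y. f t y + delta (affine hull (L \<inter> edom (integral_functional M f))) y) x))
              (eps_normal \<epsilon>\<^sub>2 (L \<inter> edom (integral_functional M f)) x)))
    \<and> (eps_subdiff \<epsilon> (integral_functional M f) x =
      (\<Inter>L\<in>fin_dim_subspaces x.
        \<Union>l\<in>L1_budget M \<epsilon>.
          set_valued_integral M \<tau> (\<lambda>t. eps_subdiff (l t)
            (\<lambda>y. f t y + delta (L \<inter> edom (integral_functional M f)) y) x)))"
    (is "?D = (\<Inter>L\<in>_. ?R1 L) \<and> ?D = (\<Inter>L\<in>_. ?R2 L)")
proof -
  let ?I = "integral_functional M f"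
  define L0 where "L0 = span {x}"
  have L0: "L0 \<in> fin_dim_subspaces x"
    unfolding fin_dim_subspaces_def L0_def
    by (intro CollectI conjI exI[of _ "{x}"] subspace_span) (simp_all add: span_base)
  have in1: "\<phi> \<in> ?R1 L" if \<phi>: "\<phi> \<in> ?D" and L: "L \<in> fin_dim_subspaces x" for \<phi> L
  proof -
    obtain \<epsilon>\<^sub>1 \<epsilon>\<^sub>2 l m \<psi> where d: "\<epsilon> = \<epsilon>\<^sub>1 + \<epsilon>\<^sub>2" "\<epsilon>\<^sub>1 \<ge> 0" "\<epsilon>\<^sub>2 \<ge> 0" "l \<in> L1_budget M \<epsilon>\<^sub>1"
      "strongly_integrable M \<tau> m"
      "AE t in M. m t \<in> eps_subdiff (l t) (\<lambda>y. f t y + delta (affine hull (L \<inter> edom ?I)) y) x"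
      "weak_integral M m \<in> tdual" "\<psi> \<in> eps_normal \<epsilon>\<^sub>2 (L \<inter> edom ?I) x"
      "\<phi> = (\<lambda>v. weak_integral M m v + \<psi> v)"
      by (rule eps_subgradient_decomposition[OF assms(2,3,4,5) \<phi> L]) (rule that)
    have "weak_integral M m \<in> set_valued_integral M \<tau> (\<lambda>t. eps_subdiff (l t)
        (\<lambda>y. f t y + delta (affine hull (L \<inter> edom ?I)) y) x)"
      using d(5,6,7) unfolding set_valued_integral_def by blast
    then have "\<phi> \<in> msum (set_valued_integral M \<tau> (\<lambda>t. eps_subdiff (l t)
        (\<lambda>y. f t y + delta (affine hull (L \<inter> edom ?I)) y) x)) (eps_normal \<epsilon>\<^sub>2 (L \<inter> edom ?I) x)"
      using d(8,9) unfolding msum_def by blast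
    then show ?thesis using d(1-4) by blast
  qed
  have in2: "\<phi> \<in> ?R2 L" if \<phi>: "\<phi> \<in> ?D" and L: "L \<in> fin_dim_subspaces x" for \<phi> L
    using eps_subgradient_as_integral[OF assms(1-5) \<phi> L] by blast
  have out1: "\<phi> \<in> ?D" if \<phi>: "\<And>L. L \<in> fin_dim_subspaces x \<Longrightarrow> \<phi> \<in> ?R1 L" for \<phi>
  proof -
    have rep: "\<exists>\<epsilon>\<^sub>1 \<epsilon>\<^sub>2. \<epsilon> = \<epsilon>\<^sub>1 + \<epsilon>\<^sub>2 \<and> (\<exists>l\<in>L1_budget M \<epsilon>\<^sub>1. \<exists>\<alpha> \<psi>. \<phi> = (\<lambda>v. \<alpha> v + \<psi> v) \<and>
        \<alpha> \<in> set_valued_integral M \<tau> (\<lambda>t. eps_subdiff (l t)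
          (\<lambda>y. f t y + delta (affine hull (L \<inter> edom ?I)) y) x) \<and>
        \<psi> \<in> eps_normal \<epsilon>\<^sub>2 (L \<inter> edom ?I) x)" if L: "L \<in> fin_dim_subspaces x" for L
      using \<phi>[OF L] unfolding msum_def by blast
    obtain \<epsilon>\<^sub>2 \<alpha> \<psi> where *: "\<phi> = (\<lambda>v. \<alpha> v + \<psi> v)" "\<alpha> \<in> tdual" "\<psi> \<in> eps_normal \<epsilon>\<^sub>2 (L0 \<inter> edom ?I) x"
      using rep[OF L0] unfolding set_valued_integral_def by blast
    have td: "\<phi> \<in> tdual" unfolding *(1) by (rule tdual_add) (use * in \<open>auto simp: eps_normal_iff\<close>)
    have "x \<in> edom ?I" using *(3) by (simp add: eps_normal_iff)
    then have fin: "\<bar>?I x\<bar> \<noteq> \<infinity>" using assms(6) by (auto simp: edom_def)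
    show ?thesis
      by (rule eps_subdiff_of_integrals[where H = "\<lambda>S. affine hull S", OF assms(1-4) fin td hull_subset rep])
  qed
  have out2: "\<phi> \<in> ?D" if \<phi>: "\<And>L. L \<in> fin_dim_subspaces x \<Longrightarrow> \<phi> \<in> ?R2 L" for \<phi>
  proof -
    obtain l m where m: "\<phi> = weak_integral M m"
      "AE t in M. m t \<in> eps_subdiff (l t) (\<lambda>y. f t y + delta (L0 \<inter> edom ?I) y) x" "weak_integral M m \<in> tdual"
      using \<phi>[OF L0] unfolding set_valued_integral_def by blast
    have td: "\<phi> \<in> tdual" using m by simp
    \<comment> \<open>Outside the domain the restricted integrand is infinite at \<open>x\<close> and has no subgradients, which only a
      null measure tolerates; but then the integral functional is finite.\<close>
    have xdom: "x \<in> edom ?I"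
    proof (rule ccontr)
      assume "x \<notin> edom ?I"
      then have "AE t in M. False"
        using m(2) by (auto dest: eps_subdiff_restrict_finite(1))
      then have "emeasure M (space M) = 0" by (simp add: AE_iff_measurable[OF sets.top])
      then have "?I x = 0" unfolding integral_functional_def by (rule upper_integral_null)
      then show False using \<open>x \<notin> edom ?I\<close> by (simp add: edom_def)
    qed
    then have fin: "\<bar>?I x\<bar> \<noteq> \<infinity>" using assms(6) by (auto simp: edom_def)
    have rep: "\<exists>\<epsilon>\<^sub>1 \<epsilon>\<^sub>2. \<epsilon> = \<epsilon>\<^sub>1 + \<epsilon>\<^sub>2 \<and> (\<exists>l\<in>L1_budget M \<epsilon>\<^sub>1. \<exists>\<alpha> \<psi>. \<phi> = (\<lambda>v. \<alpha> v + \<psi> v) \<and>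
        \<alpha> \<in> set_valued_integral M \<tau> (\<lambda>t. eps_subdiff (l t) (\<lambda>y. f t y + delta (L \<inter> edom ?I) y) x) \<and>
        \<psi> \<in> eps_normal \<epsilon>\<^sub>2 (L \<inter> edom ?I) x)" if L: "L \<in> fin_dim_subspaces x" for L
    proof -
      have "x \<in> L" using L by (simp add: fin_dim_subspaces_def)
      then have "(\<lambda>v. 0) \<in> eps_normal 0 (L \<inter> edom ?I) x" using xdom tdual_0 by (simp add: eps_normal_iff)
      moreover obtain l where "l \<in> L1_budget M \<epsilon>"
        "\<phi> \<in> set_valued_integral M \<tau> (\<lambda>t. eps_subdiff (l t) (\<lambda>y. f t y + delta (L \<inter> edom ?I) y) x)"
        using \<phi>[OF L] by blast
      ultimately show ?thesis
        by (intro exI[of _ \<epsilon>] exI[of _ 0] conjI bexI[of _ l] exI[of _ \<phi>] exI[of _ "\<lambda>v. 0"]) simp_all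
    qed
    show ?thesis
      by (rule eps_subdiff_of_integrals[where H = "\<lambda>S. S", OF assms(1-4) fin td subset_refl rep])
  qed
  have "?D = (\<Inter>L\<in>fin_dim_subspaces x. ?R1 L)"
  proof (intro equalityI subsetI INT_I)
    fix \<phi> assume "\<phi> \<in> (\<Inter>L\<in>fin_dim_subspaces x. ?R1 L)"
    then show "\<phi> \<in> ?D" by (intro out1) (rule INT_D)
  qed (rule in1)
  moreover have "?D = (\<Inter>L\<in>fin_dim_subspaces x. ?R2 L)"
  proof (intro equalityI subsetI INT_I)
    fix \<phi> assume "\<phi> \<in> (\<Inter>L\<in>fin_dim_subspaces x. ?R2 L)"
    then show "\<phi> \<in> ?D" by (intro out2) (rule INT_D)
  qed (rule in2)
  ultimately show ?thesis by (rule conjI)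
qed

end
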